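(* For every $\alpha>0$ there is a $\Delta>0$ such that the following holds for every $I\ge1$, every Boolean function $f:\mathcal X\times\mathcal Y\to\{0,1\}$ and every protocol distribution $p(xym)$ with $m=(m_0,m_1,\dots,m_C)$. If $\mathsf M^{\mathsf{ext}}_I(p,f)\le\alpha I$, $\mu(xy)=p(xy)$, and moreover the messages are such that $m_2,\dots,m_C\in\{0,1\}$, then $$\mathsf{adv}_\mu\big(\Delta I\log^2C,\,f\big)\ \ge\ 1/\Delta.$$
   Context: All sets are finite, $xy$ means $(x,y)$, logs are base 2. For joint distributions we write e.g. $q(xy|m)$ for conditionals, $p(xy)$ for marginals. Protocol distribution: a distribution $p(xym)$ on inputs $xy$ and $m=(m_0,m_1,\dots,m_C)$, where $m_0$ is the public randomness and $m_1,\dots,m_C$ are the messages (odd ones sent by Alice, even ones by Bob), such that $$p(xym)=p(xy)\cdot p(m_0)\cdot\prod_{i=1,3,5,\dots}p(m_i|xm_{<i})\cdot p(m_{i+1}|ym_{\le i}).$$ A distribution $q(xym)$ is rectangular with respect to $\mu(xy)$ if $q(xym)=\mu(xy)\cdot A(xm)\cdot B(ym)$ for some functions $A,B$. External marginal information: for $I\ge1$, $\delta=1/15$, $$\mathsf M^{\mathsf{ext}}_I(p,f)=\inf_q\sup_{xym}\log\Big(\frac{q(xy|m)}{p(xy)}\cdot\Big(\frac{q(xym)}{p(xym)}\Big)^I\cdot\Big|\mathbb E_{q(xy|m)}[(-1)^{f(xy)}]\Big|^{-12I/\delta}\Big),$$ infimum over distributions $q$ rectangular with respect to $p(xy)$,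 supremum over $xym$ in the support of $q$ (division by $0$, or a negative power of $0$, is read as $+\infty$). A randomized two-party communication protocol $\pi$: Alice receives $x$, Bob receives $y$, they have public and private randomness and exchange bits; the output $\pi(xy)$ is determined by the transcript and the public randomness; $\|\pi\|$ is the maximum number of bits exchanged (public randomness not counted). For a distribution $\mu(xy)$ on inputs, $$\mathsf{adv}_\mu(T,f)=\sup_{\|\pi\|\le T}\mathbb E\big[(-1)^{\pi(xy)+f(xy)}\big],$$ the expectation being over $xy\sim\mu$ and the randomness of $\pi$.
   Formalization: C ≥ 2 is assumed, since for C = 1 the bound fails (x, y uniform bits, f = x, m_1 = x: the budget is 0 bits and the advantage is 0) and for C = 0 log C is undefined; the finite sets of inputs and messages are taken as finite sets of natural numbers. *)

theory Defs
  imports "HOL-Probability.Probability"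
begin

text \<open>
  A joint distribution of inputs and messages is a pmf on triples \<open>(x, y, m)\<close>, where the list
  \<open>m = [m\<^sub>0, m\<^sub>1, \<dots>, m\<^sub>C]\<close> has length \<open>C + 1\<close>; thus \<open>m ! i = m\<^sub>i\<close> and
  \<open>take i m = m\<^bsub><i\<^esub>\<close>. Message symbols and random seeds are natural numbers, which loses nothing
  since only finite alphabets and finitely supported randomness are considered.
\<close>

type_synonym ('x, 'y) joint = "('x \<times> 'y \<times> nat list) pmf"

definition inputs :: "('x, 'y) joint \<Rightarrow> ('x \<times> 'y) pmf" where
  "inputs p = map_pmf (\<lambda>(x, y, m). (x, y)) p"

definition public_marginal :: "('x, 'y) joint \<Rightarrow> nat pmf" where
  "public_marginal p = map_pmf (\<lambda>(x, y, m). m ! 0) p"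

text \<open>
  The conditional probabilities of the \<open>i\<close>-th message given the sender's input and \<open>m\<^bsub><i\<^esub>\<close>. They are
  \<open>0\<close> when the conditioning event is null; in the factorization below this is harmless, because
  the left-hand side vanishes there as well.
\<close>

definition alice_msg_prob :: "('x, 'y) joint \<Rightarrow> nat \<Rightarrow> 'x \<Rightarrow> nat list \<Rightarrow> real" where
  "alice_msg_prob p i x m =
     cond_prob (measure_pmf p) (\<lambda>(x', y', m'). m' ! i = m ! i)
                               (\<lambda>(x', y', m'). x' = x \<and> take i m' = take i m)"

definition bob_msg_prob :: "('x, 'y) joint \<Rightarrow> nat \<Rightarrow> 'y \<Rightarrow> nat list \<Rightarrow> real" where
  "bob_msg_prob p i y m =
     cond_prob (measure_pmf p) (\<lambda>(x', y', m'). m' ! i = m ! i)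
                               (\<lambda>(x', y', m'). y' = y \<and> take i m' = take i m)"

definition protocol_distribution ::
  "'x set \<Rightarrow> 'y set \<Rightarrow> nat set \<Rightarrow> nat \<Rightarrow> ('x, 'y) joint \<Rightarrow> bool" where
  "protocol_distribution X Y M C p \<longleftrightarrow>
     set_pmf p \<subseteq> X \<times> Y \<times> {m. length m = C + 1 \<and> set m \<subseteq> M} \<and>
     (\<forall>x y m. length m = C + 1 \<longrightarrow>
        pmf p (x, y, m) =
          pmf (inputs p) (x, y) * pmf (public_marginal p) (m ! 0) *
          (\<Prod>i\<in>{1..C}. if odd i then alice_msg_prob p i x m else bob_msg_prob p i y m))"

definition rectangular :: "('x \<times> 'y) pmf \<Rightarrow> ('x, 'y) joint \<Rightarrow> bool" where
  "rectangular \<mu> q \<longleftrightarrow>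
     (\<exists>(A :: 'x \<Rightarrow> nat list \<Rightarrow> real) (B :: 'y \<Rightarrow> nat list \<Rightarrow> real).
        \<forall>x y m. pmf q (x, y, m) = pmf \<mu> (x, y) * A x m * B y m)"

text \<open>The conditional distribution \<open>q(xy|m)\<close>, used only for \<open>m\<close> of positive probability under \<open>q\<close>.\<close>

definition posterior :: "('x, 'y) joint \<Rightarrow> nat list \<Rightarrow> ('x \<times> 'y) pmf" where
  "posterior q m = inputs (cond_pmf q {(x', y', m'). m' = m})"

definition bias :: "('x, 'y) joint \<Rightarrow> ('x \<Rightarrow> 'y \<Rightarrow> bool) \<Rightarrow> nat list \<Rightarrow> real" where
  "bias q f m = measure_pmf.expectation (posterior q m) (\<lambda>(x, y). (- 1) ^ of_bool (f x y))"

definition delta :: real where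
  "delta = 1 / 15"

text \<open>
  The quantity under the supremum, for \<open>(x, y, m)\<close> in the support of \<open>q\<close>. For \<open>q\<close> rectangular with
  respect to \<open>p(xy)\<close> the factors \<open>q(xy|m) / p(xy)\<close> and \<open>q(xym)\<close> are then positive, so \<open>\<infinity>\<close> arises
  exactly from \<open>p(xym) = 0\<close> or from a vanishing bias.
\<close>

definition ext_cost ::
  "real \<Rightarrow> ('x, 'y) joint \<Rightarrow> ('x \<Rightarrow> 'y \<Rightarrow> bool) \<Rightarrow> ('x, 'y) joint \<Rightarrow> 'x \<times> 'y \<times> nat list \<Rightarrow> ereal" where
  "ext_cost I p f q = (\<lambda>(x, y, m).
     if pmf p (x, y, m) = 0 \<or> bias q f m = 0 then \<infinity>
     else ereal (log 2 (pmf (posterior q m) (x, y) / pmf (inputs p) (x, y)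
                        * (pmf q (x, y, m) / pmf p (x, y, m)) powr I
                        * \<bar>bias q f m\<bar> powr (- 12 * I / delta))))"

definition M_ext :: "real \<Rightarrow> ('x, 'y) joint \<Rightarrow> ('x \<Rightarrow> 'y \<Rightarrow> bool) \<Rightarrow> ereal" where
  "M_ext I p f = (INF q\<in>{q. rectangular (inputs p) q}. SUP w\<in>set_pmf q. ext_cost I p f q w)"

text \<open>
  Protocol trees with private randomness: the owner of an inner node sends a bit computed from her
  or his input and private seed, and the bit selects the subtree (\<open>False\<close>: the first one).
  Public randomness selects the tree, so that the output is determined by the transcript
  and the public randomness.
\<close>

datatype ('x, 'y) ptree =
    Output bool
  | Alice "'x \<Rightarrow> nat \<Rightarrow> bool" "('x, 'y) ptree" "('x, 'y) ptree"
  | Bob "'y \<Rightarrow> nat \<Rightarrow> bool" "('x, 'y) ptree" "('x, 'y) ptree"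

primrec run :: "('x, 'y) ptree \<Rightarrow> 'x \<Rightarrow> nat \<Rightarrow> 'y \<Rightarrow> nat \<Rightarrow> bool" where
  "run (Output b) x a y b' = b"
| "run (Alice s t0 t1) x a y b' = (if s x a then run t1 x a y b' else run t0 x a y b')"
| "run (Bob s t0 t1) x a y b' = (if s y b' then run t1 x a y b' else run t0 x a y b')"

primrec depth :: "('x, 'y) ptree \<Rightarrow> nat" where
  "depth (Output b) = 0"
| "depth (Alice s t0 t1) = Suc (max (depth t0) (depth t1))"
| "depth (Bob s t0 t1) = Suc (max (depth t0) (depth t1))"

record ('x, 'y) protocol =
  public_seed :: "nat pmf"
  alice_seed :: "nat pmf"
  bob_seed :: "nat pmf"
  tree :: "nat \<Rightarrow> ('x, 'y) ptree"

definition finite_randomness :: "('x, 'y) protocol \<Rightarrow> bool" where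
  "finite_randomness \<pi> \<longleftrightarrow>
     finite (set_pmf (public_seed \<pi>)) \<and> finite (set_pmf (alice_seed \<pi>)) \<and>
     finite (set_pmf (bob_seed \<pi>))"

definition communication :: "('x, 'y) protocol \<Rightarrow> nat" where
  "communication \<pi> = (MAX r\<in>set_pmf (public_seed \<pi>). depth (tree \<pi> r))"

definition correlation :: "('x \<times> 'y) pmf \<Rightarrow> ('x, 'y) protocol \<Rightarrow> ('x \<Rightarrow> 'y \<Rightarrow> bool) \<Rightarrow> real" where
  "correlation \<mu> \<pi> f =
     measure_pmf.expectation
       (pair_pmf \<mu> (pair_pmf (public_seed \<pi>) (pair_pmf (alice_seed \<pi>) (bob_seed \<pi>))))
       (\<lambda>((x, y), r, a, b). (- 1) ^ (of_bool (run (tree \<pi> r) x a y b) + of_bool (f x y)))"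

text \<open>For \<open>T \<ge> 0\<close> the supremum ranges over a nonempty set of reals bounded by \<open>1\<close>.\<close>

definition adv :: "('x \<times> 'y) pmf \<Rightarrow> real \<Rightarrow> ('x \<Rightarrow> 'y \<Rightarrow> bool) \<Rightarrow> real" where
  "adv \<mu> T f =
     (SUP \<pi>\<in>{\<pi>. finite_randomness \<pi> \<and> real (communication \<pi>) \<le> T}. correlation \<mu> \<pi> f)"

end

theory Submission
  imports Defs
begin

text \<open>
  Fix a near-optimal rectangular \<open>q\<close>. It suffices to sample \<open>m\<close> from \<open>p(m|xy)\<close>, to accept with
  probability proportional to \<open>q(xym)/p(xym)\<close>, and to output the sign of the bias given \<open>m\<close>, or a fair
  coin after a rejection. Averaging the logarithm of the cost over \<open>q\<close> shows that \<open>q\<close> has bounded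
  divergence from \<open>p\<close> and, on average, a bias bounded away from \<open>0\<close>; so \<open>q(xym)/p(xym)\<close> is
  typically bounded, and events that are sufficiently rare under \<open>p\<close> are rare under \<open>q\<close>.

  As \<open>q/p\<close> is a product of a function of \<open>(x, m)\<close> and one of \<open>(y, m)\<close>, the acceptance step costs two
  bits: shared random signs test for free whether the scales of the two factors match.

  The messages are sampled by comparison with the public prior \<open>q(m)\<close>. The first two have unbounded
  alphabets and are sent in one go, by an index into a list of public samples. The remaining bits
  are sampled in chunks: a public path is drawn from the prior up to the first point where the
  likelihood ratio of a player exceeds \<open>2\<close>, and rejection sampling corrects it, at a cost of
  \<open>O(log C)\<close> per attempt. A Hellinger affinity argument shows that every such crossing increases the
  total likelihood ratio \<open>p(m|xy)/q(m)\<close> by a constant factor, typically, while the cost bounds this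
  ratio by \<open>exp (O(I))\<close>. Hence \<open>O(I)\<close> attempts are enough.
\<close>

text \<open>Failures must not bias the output. So each sampling step is calibrated to succeed with a
  probability that does not depend on the inputs, \<open>1 / 2\<close> for the first two messages
  and \<open>1 / 8\<close> for a chunk; a failed attempt at a chunk leaves the walk where it is and
  only spends budget. What does depend on the inputs is truncation, and it loses at most half of the
  mean absolute bias under \<open>q\<close>. The threshold \<open>2\<close> keeps both ratios
  bounded inside a chunk: the player who does not end it can accept with half of the own ratio as
  probability, and only the one who ends it has to announce an index. The \<open>log C\<close> per
  attempt has two sources: the O(C) possible lengths of a chunk, and the step that crosses the
  threshold, which may multiply a ratio by up to \<open>4 * C\<close> because the smoothed prior can
  be as small as \<open>1 / (4 * C)\<close>. A likelihood ratio may fall again after a crossing, so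
  crossings do not bound it from below pointwise. They do so on average: the \<open>p\<close>-mean
  of the reward for the crossings, divided by the square root of the ratio, stays bounded.\<close>

section \<open>Convex hulls of deterministic strategies\<close>

text \<open>The convex hull of \<open>T\<close> as functions on \<open>\<Omega>\<close>, in dual form: no linear functional separates \<open>g\<close>
  from \<open>T\<close>. This keeps explicit random seeds out of the simulation.\<close>

definition mixes :: "'w set \<Rightarrow> ('w \<Rightarrow> real) set \<Rightarrow> ('w \<Rightarrow> real) set" where
  "mixes \<Omega> T = {g. \<forall>w. \<exists>t\<in>T. (\<Sum>\<omega>\<in>\<Omega>. w \<omega> * g \<omega>) \<le> (\<Sum>\<omega>\<in>\<Omega>. w \<omega> * t \<omega>)}"

lemma mixI: "(\<And>w. \<exists>t\<in>T. (\<Sum>\<omega>\<in>\<Omega>. w \<omega> * g \<omega>) \<le> (\<Sum>\<omega>\<in>\<Omega>. w \<omega> * t \<omega>)) \<Longrightarrow> g \<in> mixes \<Omega> T"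
  by (simp add: mixes_def)

lemma mixD: "g \<in> mixes \<Omega> T \<Longrightarrow> \<exists>t\<in>T. (\<Sum>\<omega>\<in>\<Omega>. w \<omega> * g \<omega>) \<le> (\<Sum>\<omega>\<in>\<Omega>. w \<omega> * t \<omega>)"
  by (simp add: mixes_def)

lemma mix_mono: "T \<subseteq> T' \<Longrightarrow> mixes \<Omega> T \<subseteq> mixes \<Omega> T'"
  unfolding mixes_def by blast

lemma mix_superset: "T \<subseteq> mixes \<Omega> T"
  unfolding mixes_def by auto

lemma mix_cong:
  assumes "g \<in> mixes \<Omega> T" "\<And>\<omega>. \<omega> \<in> \<Omega> \<Longrightarrow> g' \<omega> = g \<omega>"
  shows "g' \<in> mixes \<Omega> T"
  using assms by (simp add: mixes_def cong: sum.cong)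

lemma mix_convex:
  assumes "finite A" "\<And>i. i \<in> A \<Longrightarrow> l i \<ge> 0" "sum l A = 1" "\<And>i. i \<in> A \<Longrightarrow> g i \<in> mixes \<Omega> T"
  shows "(\<lambda>\<omega>. \<Sum>i\<in>A. l i * g i \<omega>) \<in> mixes \<Omega> T"
proof (rule mixI)
  fix w :: "_ \<Rightarrow> real"
  define G where "G i = (\<Sum>\<omega>\<in>\<Omega>. w \<omega> * g i \<omega>)" for i
  have ne: "A \<noteq> {}" using assms(3) by auto
  have "Max (G ` A) \<in> G ` A" using assms(1) ne by (intro Max_in) auto
  then obtain i0 where i0: "i0 \<in> A" "G i0 = Max (G ` A)" by auto
  then have i0: "i0 \<in> A" "\<And>i. i \<in> A \<Longrightarrow> G i \<le> G i0"
    using assms(1) by auto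
  obtain t where t: "t \<in> T" "G i0 \<le> (\<Sum>\<omega>\<in>\<Omega>. w \<omega> * t \<omega>)"
    using mixD[OF assms(4)[OF i0(1)], of w] unfolding G_def by blast
  have "(\<Sum>\<omega>\<in>\<Omega>. w \<omega> * (\<Sum>i\<in>A. l i * g i \<omega>)) = (\<Sum>i\<in>A. l i * G i)"
    unfolding G_def sum_distrib_left by (subst sum.swap) (simp add: ac_simps)
  also have "\<dots> \<le> (\<Sum>i\<in>A. l i * G i0)"
    by (intro sum_mono mult_left_mono i0 assms)
  also have "\<dots> = G i0" by (simp add: sum_distrib_right[symmetric] assms(3))
  finally show "\<exists>t\<in>T. (\<Sum>\<omega>\<in>\<Omega>. w \<omega> * (\<Sum>i\<in>A. l i * g i \<omega>)) \<le> (\<Sum>\<omega>\<in>\<Omega>. w \<omega> * t \<omega>)"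
    using t by (meson order_trans)
qed

lemma mix_convex2:
  assumes "0 \<le> l" "l \<le> 1" "g \<in> mixes \<Omega> T" "g' \<in> mixes \<Omega> T"
  shows "(\<lambda>\<omega>. l * g \<omega> + (1 - l) * g' \<omega>) \<in> mixes \<Omega> T"
  using mix_convex[of "{True, False}" "\<lambda>b. if b then l else 1 - l" "\<lambda>b. if b then g else g'" \<Omega> T] assms
  by auto

text \<open>This removes private randomness: a functional splits over the fibres of
  \<open>k\<close>, and on each fibre the better continuation can be chosen outright. So a bit sent
  with a probability depending only on the view \<open>k\<close> is dominated by a deterministic bit
  \<open>s\<close> of that view.\<close>

lemma mix_select:
  assumes "finite \<Omega>" and a: "\<And>z. 0 \<le> a z" "\<And>z. a z \<le> (1::real)"
    and g: "g \<in> mixes \<Omega> T" and g': "g' \<in> mixes \<Omega> T'"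
    and S: "\<And>s t t'. t \<in> T \<Longrightarrow> t' \<in> T' \<Longrightarrow> (\<lambda>\<omega>. if s (k \<omega>) then t \<omega> else t' \<omega>) \<in> S"
  shows "(\<lambda>\<omega>. a (k \<omega>) * g \<omega> + (1 - a (k \<omega>)) * g' \<omega>) \<in> mixes \<Omega> S"
proof (rule mixI)
  fix w :: "'a \<Rightarrow> real"
  obtain t where t: "t \<in> T" "(\<Sum>\<omega>\<in>\<Omega>. (w \<omega> * a (k \<omega>)) * g \<omega>) \<le> (\<Sum>\<omega>\<in>\<Omega>. (w \<omega> * a (k \<omega>)) * t \<omega>)"
    using mixD[OF g, of "\<lambda>\<omega>. w \<omega> * a (k \<omega>)"] by blast
  obtain t' where t': "t' \<in> T'"
    "(\<Sum>\<omega>\<in>\<Omega>. (w \<omega> * (1 - a (k \<omega>))) * g' \<omega>) \<le> (\<Sum>\<omega>\<in>\<Omega>. (w \<omega> * (1 - a (k \<omega>))) * t' \<omega>)"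
    using mixD[OF g', of "\<lambda>\<omega>. w \<omega> * (1 - a (k \<omega>))"] by blast
  define W where "W z = (\<Sum>\<omega> | \<omega> \<in> \<Omega> \<and> k \<omega> = z. w \<omega> * t \<omega>)" for z
  define W' where "W' z = (\<Sum>\<omega> | \<omega> \<in> \<Omega> \<and> k \<omega> = z. w \<omega> * t' \<omega>)" for z
  define s where "s z \<longleftrightarrow> W z \<ge> W' z" for z
  have grp: "(\<Sum>\<omega>\<in>\<Omega>. h \<omega>) = (\<Sum>z\<in>k ` \<Omega>. \<Sum>\<omega> | \<omega> \<in> \<Omega> \<and> k \<omega> = z. h \<omega>)" for h :: "'a \<Rightarrow> real"
    using sum.group[OF assms(1) finite_imageI[OF assms(1)], of k k h] by simp
  have "(\<Sum>\<omega>\<in>\<Omega>. w \<omega> * (a (k \<omega>) * g \<omega> + (1 - a (k \<omega>)) * g' \<omega>))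
     = (\<Sum>\<omega>\<in>\<Omega>. (w \<omega> * a (k \<omega>)) * g \<omega>) + (\<Sum>\<omega>\<in>\<Omega>. (w \<omega> * (1 - a (k \<omega>))) * g' \<omega>)"
    by (simp add: sum.distrib[symmetric] algebra_simps)
  also have "\<dots> \<le> (\<Sum>\<omega>\<in>\<Omega>. (w \<omega> * a (k \<omega>)) * t \<omega>) + (\<Sum>\<omega>\<in>\<Omega>. (w \<omega> * (1 - a (k \<omega>))) * t' \<omega>)"
    using t t' by simp
  also have "\<dots> = (\<Sum>z\<in>k ` \<Omega>. a z * W z + (1 - a z) * W' z)"
    unfolding grp sum.distrib W_def W'_def sum_distrib_left
    by (intro arg_cong2[where f = "(+)"] sum.cong refl) auto
  also have "\<dots> \<le> (\<Sum>z\<in>k ` \<Omega>. if s z then W z else W' z)"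
  proof (intro sum_mono)
    fix z
    show "a z * W z + (1 - a z) * W' z \<le> (if s z then W z else W' z)"
    proof (cases "s z")
      case True
      then have "(1 - a z) * W' z \<le> (1 - a z) * W z" using a by (intro mult_left_mono) (auto simp: s_def)
      then show ?thesis using True by (simp add: algebra_simps)
    next
      case False
      then have "a z * W z \<le> a z * W' z" using a by (intro mult_left_mono) (auto simp: s_def)
      then show ?thesis using False by (simp add: algebra_simps)
    qed
  qed
  also have "\<dots> = (\<Sum>\<omega>\<in>\<Omega>. w \<omega> * (if s (k \<omega>) then t \<omega> else t' \<omega>))"
    unfolding grp W_def W'_def by (intro sum.cong refl) auto
  finally show "\<exists>t\<in>S. (\<Sum>\<omega>\<in>\<Omega>. w \<omega> * (a (k \<omega>) * g \<omega> + (1 - a (k \<omega>)) * g' \<omega>)) \<le> (\<Sum>\<omega>\<in>\<Omega>. w \<omega> * t \<omega>)"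
    by (rule rev_bexI[OF S[OF t(1) t'(1), of s]])
qed

text \<open>The speaker, who sees only \<open>k\<close>, announces an index below \<open>N\<close>,
  and play continues with the strategy of that index.\<close>

definition sel :: "('w \<Rightarrow> 'z) \<Rightarrow> nat \<Rightarrow> ('w \<Rightarrow> real) set \<Rightarrow> ('w \<Rightarrow> real) set" where
  "sel k N T = {\<lambda>\<omega>. t (J (k \<omega>)) \<omega> | J t. (\<forall>z. J z < N) \<and> (\<forall>j<N. t j \<in> T)}"

lemma selE:
  assumes "f \<in> sel k N T"
  obtains J t where "f = (\<lambda>\<omega>. t (J (k \<omega>)) \<omega>)" "\<forall>z. J z < N" "\<forall>j<N. t j \<in> T"
  using assms unfolding sel_def mem_Collect_eq by (elim exE conjE) (rule that)

lemma sel_one: "T \<subseteq> sel k 1 T"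
  unfolding sel_def by (auto intro!: exI[of _ "\<lambda>_. 0"] exI[of _ "\<lambda>_. _"])

lemma sel_Suc:
  assumes "t \<in> T" "t' \<in> sel k N T"
  shows "(\<lambda>\<omega>. if s (k \<omega>) then t \<omega> else t' \<omega>) \<in> sel k (Suc N) T"
proof -
  obtain J t0 where J: "t' = (\<lambda>\<omega>. t0 (J (k \<omega>)) \<omega>)" "\<forall>z. J z < N" "\<forall>j<N. t0 j \<in> T"
    using assms(2) by (rule selE)
  have "(\<lambda>\<omega>. if s (k \<omega>) then t \<omega> else t' \<omega>) = (\<lambda>\<omega>. (t0(N := t)) ((\<lambda>z. if s z then N else J z) (k \<omega>)) \<omega>)"
    using J(2) by (auto simp: J(1) fun_eq_iff)
  then show ?thesis unfolding sel_def using J assms(1)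
    by (auto intro!: exI[of _ "\<lambda>z. if s z then N else J z"] exI[of _ "t0(N := t)"] simp: less_Suc_eq)
qed

text \<open>Alice tries publicly drawn samples one after the other and announces the first one that she
  accepts; a dummy acceptance probability makes every trial succeed with the same probability,
  whatever the speaker's input.\<close>

lemma rejection_sampling_trials:
  fixes h :: "'u \<Rightarrow> 'w \<Rightarrow> real" and e :: "'z \<Rightarrow> 'u \<Rightarrow> real"
  assumes fin: "finite \<Omega>" "finite U" and L: "L \<ge> 1"
    and s: "\<And>u. u \<in> U \<Longrightarrow> 0 \<le> s u" "sum s U \<le> 1"
    and e: "\<And>z u. u \<in> U \<Longrightarrow> 0 \<le> e z u" "\<And>z u. u \<in> U \<Longrightarrow> e z u \<le> L * s u" "\<And>z. (\<Sum>u\<in>U. e z u) \<le> 1"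
    and h: "\<And>u. u \<in> U \<Longrightarrow> h u \<in> mixes \<Omega> T" "h0 \<in> mixes \<Omega> T"
  shows "(\<lambda>\<omega>. h0 \<omega> + (1 - (1 - 1 / (2 * L)) ^ N) * (\<Sum>u\<in>U. e (k \<omega>) u * (h u \<omega> - h0 \<omega>))) \<in> mixes \<Omega> (sel k (Suc N) T)"
proof (induction N)
  case 0
  then show ?case using h(2) mix_mono[OF sel_one, of \<Omega> T k] by auto
next
  case (Suc N)
  define F where "F \<omega> = h0 \<omega> + (1 - (1 - 1 / (2 * L)) ^ N) * (\<Sum>u\<in>U. e (k \<omega>) u * (h u \<omega> - h0 \<omega>))" for \<omega>
  have F: "F \<in> mixes \<Omega> (sel k (Suc N) T)" using Suc by (simp add: F_def[abs_def])
  let ?H = "mixes \<Omega> (sel k (Suc (Suc N)) T)"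
  define t where "t u z = (if s u = 0 then 0 else e z u / (L * s u))" for u z
  define \<sigma> where "\<sigma> z = (\<Sum>u\<in>U. e z u)" for z
  have t: "0 \<le> t u z" "t u z \<le> 1" if "u \<in> U" for u z
    using e(1,2)[OF that, of z] s(1)[OF that] L by (auto simp: t_def divide_simps)
  have tst: "s u * t u z = e z u / L" if "u \<in> U" for u z
    using e(1,2)[OF that, of z] s(1)[OF that] L by (auto simp: t_def)
  have G1: "(\<lambda>\<omega>. t u (k \<omega>) * h u \<omega> + (1 - t u (k \<omega>)) * F \<omega>) \<in> ?H" if "u \<in> U" for u
    by (rule mix_select[where T = T and T' = "sel k (Suc N) T", OF fin(1)])
       (use F h that t sel_Suc in auto)
  have \<sigma>: "0 \<le> \<sigma> z" "\<sigma> z \<le> 1" for z using e by (auto simp: \<sigma>_def intro: sum_nonneg)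
  have "(1 - \<sigma> z) / L \<le> 1" for z using \<sigma>[of z] L by (simp add: divide_simps)
  then have G2: "(\<lambda>\<omega>. (1 - \<sigma> (k \<omega>)) / L * h0 \<omega> + (1 - (1 - \<sigma> (k \<omega>)) / L) * F \<omega>) \<in> ?H"
    using F h \<sigma> L by (intro mix_select[where T = T and T' = "sel k (Suc N) T" and a="\<lambda>z. (1 - \<sigma> z) / L", OF fin(1)])
       (auto intro: sel_Suc)
  have G3: "F \<in> ?H"
  proof -
    have "sel k (Suc N) T \<subseteq> sel k (Suc (Suc N)) T"
    proof
      fix f assume "f \<in> sel k (Suc N) T"
      then obtain J t0 where J: "f = (\<lambda>\<omega>. t0 (J (k \<omega>)) \<omega>)" "\<forall>z. J z < Suc N" "\<forall>j<Suc N. t0 j \<in> T"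
        by (rule selE)
      show "f \<in> sel k (Suc (Suc N)) T" unfolding sel_def using J
        by (auto intro!: exI[of _ J] exI[of _ "\<lambda>j. if j < Suc N then t0 j else t0 0"] simp: less_SucI)
    qed
    then show ?thesis using mix_mono F by blast
  qed
  define G where "G u = (case u of None \<Rightarrow> F | Some u \<Rightarrow> (\<lambda>\<omega>. t u (k \<omega>) * h u \<omega> + (1 - t u (k \<omega>)) * F \<omega>))" for u
  \<comment> \<open>\<open>None\<close> carries the mass missing from \<open>s\<close>; a trial that
    draws it always continues with \<open>F\<close>.\<close>
  define l where "l u = (case u of None \<Rightarrow> 1 - sum s U | Some u \<Rightarrow> s u)" for u
  have ins: "sum f (insert None (Some ` U)) = f None + (\<Sum>u\<in>U. f (Some u))" for f :: "'u option \<Rightarrow> real"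
    using fin by (subst sum.insert) (auto simp: sum.reindex)
  have G4: "(\<lambda>\<omega>. \<Sum>u\<in>insert None (Some ` U). l u * G u \<omega>) \<in> ?H"
    using fin s G1 G3 by (intro mix_convex) (auto simp: l_def G_def ins)
  \<comment> \<open>A fair coin chooses between a real and a dummy trial. Together they accept with
    probability \<open>1 / (2 * L)\<close> for every view, and what is accepted is \<open>u\<close>
    with probability \<open>e z u\<close> and the default otherwise.\<close>
  have "(\<lambda>\<omega>. 1/2 * (\<Sum>u\<in>insert None (Some ` U). l u * G u \<omega>) + (1 - 1/2) * ((1 - \<sigma> (k \<omega>)) / L * h0 \<omega> + (1 - (1 - \<sigma> (k \<omega>)) / L) * F \<omega>)) \<in> ?H"
    by (rule mix_convex2[OF _ _ G4 G2]) auto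
  moreover have "1/2 * (\<Sum>u\<in>insert None (Some ` U). l u * G u \<omega>) + (1 - 1/2) * ((1 - \<sigma> (k \<omega>)) / L * h0 \<omega> + (1 - (1 - \<sigma> (k \<omega>)) / L) * F \<omega>)
     = h0 \<omega> + (1 - (1 - 1 / (2 * L)) ^ Suc N) * (\<Sum>u\<in>U. e (k \<omega>) u * (h u \<omega> - h0 \<omega>))" for \<omega>
  proof -
    let ?z = "k \<omega>"
    define Q where "Q = (\<Sum>u\<in>U. e ?z u * h u \<omega>)"
    have dd: "(\<Sum>u\<in>U. e ?z u * (h u \<omega> - h0 \<omega>)) = Q - \<sigma> ?z * h0 \<omega>"
      by (simp add: Q_def \<sigma>_def right_diff_distrib sum_subtractf sum_distrib_right)
    have "(\<Sum>u\<in>insert None (Some ` U). l u * G u \<omega>) = (1 - sum s U) * F \<omega> + (\<Sum>u\<in>U. s u * (t u ?z * h u \<omega> + (1 - t u ?z) * F \<omega>))"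
      unfolding ins by (simp add: l_def G_def)
    also have "(\<Sum>u\<in>U. s u * (t u ?z * h u \<omega> + (1 - t u ?z) * F \<omega>)) = (\<Sum>u\<in>U. e ?z u / L * h u \<omega> + s u * F \<omega> - e ?z u / L * F \<omega>)"
      by (intro sum.cong refl) (simp add: tst[symmetric] algebra_simps)
    also have "\<dots> = Q / L + sum s U * F \<omega> - \<sigma> ?z / L * F \<omega>"
      by (simp add: sum.distrib sum_subtractf Q_def \<sigma>_def sum_distrib_right sum_divide_distrib)
    finally have 1: "(\<Sum>u\<in>insert None (Some ` U). l u * G u \<omega>) = F \<omega> + Q / L - \<sigma> ?z / L * F \<omega>"
      by (simp add: algebra_simps)
    define c where "c = (1 - 1 / (2 * L)) ^ N"
    have Feq: "F \<omega> = h0 \<omega> + (1 - c) * (Q - \<sigma> ?z * h0 \<omega>)" by (simp add: F_def dd c_def)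
    show ?thesis unfolding 1 dd Feq power_Suc c_def[symmetric]
      using L by (simp add: field_simps)
  qed
  ultimately show ?case by simp
qed

section \<open>Randomized protocols\<close>

text \<open>Both private seeds are fixed to \<open>0\<close>, since all randomness is carried by
  \<open>mixes\<close>.\<close>

definition tree_sign :: "('x, 'y) ptree \<Rightarrow> 'x \<times> 'y \<Rightarrow> real" where
  "tree_sign t = (\<lambda>(x, y). (- 1) ^ of_bool (run t x 0 y 0))"

definition signs :: "nat \<Rightarrow> ('x \<times> 'y \<Rightarrow> real) set" where
  "signs n = {tree_sign t | t. depth t \<le> n}"

abbreviation protocols :: "('x \<times> 'y) set \<Rightarrow> nat \<Rightarrow> ('x \<times> 'y \<Rightarrow> real) set" where
  "protocols \<Omega> n \<equiv> mixes \<Omega> (signs n)"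

text \<open>Abstracts from who speaks: one bit computed from the view \<open>k\<close> can be put in
  front of two trees. Alice (\<open>fst\<close>) and Bob (\<open>snd\<close>) are thus treated at
  once.\<close>

definition speaker :: "('x \<times> 'y \<Rightarrow> 'z) \<Rightarrow> bool" where
  "speaker k \<longleftrightarrow> (\<forall>n s. \<forall>t\<in>signs n. \<forall>t'\<in>signs n. (\<lambda>\<omega>. if s (k \<omega>) then t \<omega> else t' \<omega>) \<in> signs (Suc n))"

lemma speakerD:
  "speaker k \<Longrightarrow> t \<in> signs n \<Longrightarrow> t' \<in> signs n \<Longrightarrow> (\<lambda>\<omega>. if s (k \<omega>) then t \<omega> else t' \<omega>) \<in> signs (Suc n)"
  by (simp add: speaker_def)

lemma speaker_fst: "speaker fst"
  unfolding speaker_def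
proof (intro allI ballI)
  fix n s and t t' :: "'a \<times> 'b \<Rightarrow> real" assume "t \<in> signs n" "t' \<in> signs n"
  then obtain u u' where u: "t = tree_sign u" "t' = tree_sign u'" "depth u \<le> n" "depth u' \<le> n"
    by (auto simp: signs_def)
  have "(\<lambda>\<omega>. if s (fst \<omega>) then t \<omega> else t' \<omega>) = tree_sign (Alice (\<lambda>x _. s x) u' u)"
    by (auto simp: u tree_sign_def)
  then show "(\<lambda>\<omega>. if s (fst \<omega>) then t \<omega> else t' \<omega>) \<in> signs (Suc n)"
    using u by (auto simp: signs_def)
qed

lemma speaker_snd: "speaker snd"
  unfolding speaker_def
proof (intro allI ballI)
  fix n s and t t' :: "'a \<times> 'b \<Rightarrow> real" assume "t \<in> signs n" "t' \<in> signs n"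
  then obtain u u' where u: "t = tree_sign u" "t' = tree_sign u'" "depth u \<le> n" "depth u' \<le> n"
    by (auto simp: signs_def)
  have "(\<lambda>\<omega>. if s (snd \<omega>) then t \<omega> else t' \<omega>) = tree_sign (Bob (\<lambda>x _. s x) u' u)"
    by (auto simp: u tree_sign_def)
  then show "(\<lambda>\<omega>. if s (snd \<omega>) then t \<omega> else t' \<omega>) \<in> signs (Suc n)"
    using u by (auto simp: signs_def)
qed

lemma protocols_mono: "m \<le> n \<Longrightarrow> protocols \<Omega> m \<subseteq> protocols \<Omega> n"
  by (intro mix_mono) (auto simp: signs_def)

lemma protocols_select:
  assumes "finite \<Omega>" "speaker k" "\<And>z. 0 \<le> a z" "\<And>z. a z \<le> (1::real)" "g \<in> protocols \<Omega> n" "g' \<in> protocols \<Omega> n"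
  shows "(\<lambda>\<omega>. a (k \<omega>) * g \<omega> + (1 - a (k \<omega>)) * g' \<omega>) \<in> protocols \<Omega> (Suc n)"
  by (rule mix_select[OF assms(1,3-6)]) (use speakerD[OF assms(2)] in auto)

text \<open>An index below \<open>2 ^ j\<close> is sent in binary, the most significant bit
  first.\<close>

lemma sel_signs:
  assumes "speaker k"
  shows "sel k (2 ^ j) (signs n) \<subseteq> signs (n + j)"
proof (induction j)
  case 0
  have "f \<in> signs n" if f: "f \<in> sel k 1 (signs n)" for f
  proof -
    from f show ?thesis
    proof (rule selE)
      fix J t assume J: "f = (\<lambda>\<omega>. t (J (k \<omega>)) \<omega>)" "\<forall>z. J z < (1::nat)" "\<forall>i<1. t i \<in> signs n"
      have "J z = 0" for z using J(2)[rule_format, of z] by linarith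
      then show ?thesis using J(1,3) by simp
    qed
  qed
  then have "sel k 1 (signs n) \<subseteq> signs n" by (rule subsetI)
  then show ?case by (simp only: power_0 add_0_right)
next
  case (Suc j)
  show ?case
  proof
    fix f assume "f \<in> sel k (2 ^ Suc j) (signs n)"
    then obtain J t where J: "f = (\<lambda>\<omega>. t (J (k \<omega>)) \<omega>)" "\<forall>z. J z < (2::nat) ^ Suc j" "\<forall>i<2 ^ Suc j. t i \<in> signs n"
      by (rule selE)
    let ?r = "\<lambda>z. J z mod 2 ^ j"
    have "(\<lambda>\<omega>. t (?r (k \<omega>)) \<omega>) \<in> sel k (2 ^ j) (signs n)"
      unfolding sel_def using J(3) by (auto intro!: exI[of _ ?r] exI[of _ t])
    moreover have "(\<lambda>\<omega>. t (2 ^ j + ?r (k \<omega>)) \<omega>) \<in> sel k (2 ^ j) (signs n)"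
      unfolding sel_def using J(3) by (auto intro!: exI[of _ ?r] exI[of _ "\<lambda>i. t (2 ^ j + i)"])
    ultimately have "(\<lambda>\<omega>. if J (k \<omega>) < 2 ^ j then t (?r (k \<omega>)) \<omega> else t (2 ^ j + ?r (k \<omega>)) \<omega>) \<in> signs (n + Suc j)"
      using Suc speakerD[OF assms, of _ "n + j" _ "\<lambda>z. J z < 2 ^ j"] by auto
    moreover have "2 ^ j + ?r z = J z" if "\<not> J z < 2 ^ j" for z
    proof -
      have "J z div 2 ^ j = 1"
        using that J(2)[rule_format, of z] by (intro div_nat_eqI) auto
      then show ?thesis using div_mult_mod_eq[of "J z" "2 ^ j"] by simp
    qed
    ultimately show "f \<in> signs (n + Suc j)"
      by (simp add: J(1) if_distrib[of "\<lambda>i. t i _"] cong: if_cong)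
  qed
qed

text \<open>There is room for \<open>2 ^ j - 1 \<ge> 2 * L\<close> trials, the last index meaning
  that all of them failed. They succeed with probability at least \<open>1 - exp (- 1)\<close>;
  mixing with the default lowers this to exactly \<open>1 / 2\<close>, so that the result no longer
  depends on \<open>L\<close>.\<close>

lemma rejection_sampling:
  fixes h :: "'u \<Rightarrow> 'x \<times> 'y \<Rightarrow> real" and e :: "'z \<Rightarrow> 'u \<Rightarrow> real"
  assumes fin: "finite \<Omega>" "finite U" and k: "speaker k" and L: "L \<ge> 1" "2 * L + 1 \<le> 2 ^ j"
    and s: "\<And>u. u \<in> U \<Longrightarrow> 0 \<le> s u" "sum s U \<le> 1"
    and e: "\<And>z u. u \<in> U \<Longrightarrow> 0 \<le> e z u" "\<And>z u. u \<in> U \<Longrightarrow> e z u \<le> L * s u" "\<And>z. (\<Sum>u\<in>U. e z u) \<le> 1"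
    and h: "\<And>u. u \<in> U \<Longrightarrow> h u \<in> protocols \<Omega> n" "h0 \<in> protocols \<Omega> n"
  shows "(\<lambda>\<omega>. h0 \<omega> + 1 / 2 * (\<Sum>u\<in>U. e (k \<omega>) u * (h u \<omega> - h0 \<omega>))) \<in> protocols \<Omega> (n + j)"
proof -
  define N where "N = (2::nat) ^ j - 1"
  have N: "Suc N = 2 ^ j" by (simp add: N_def)
  then have "real (Suc N) = 2 ^ j" by simp
  then have NL: "real N \<ge> 2 * L" using L by simp
  define c where "c = 1 - (1 - 1 / (2 * L)) ^ N"
  have "(1 - 1 / (2 * L)) ^ N \<le> exp (- 1 / (2 * L)) ^ N"
    using L exp_ge_add_one_self[of "- 1 / (2 * L)"] by (intro power_mono) (auto simp: field_simps)
  also have "\<dots> = exp (- (real N / (2 * L)))" by (simp add: exp_of_nat_mult[symmetric])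
  also have "\<dots> \<le> exp (- 1)" using NL L by (simp add: field_simps)
  also have "\<dots> \<le> 1 / 2" using exp_ge_add_one_self[of 1] by (simp add: exp_minus field_simps)
  finally have c: "c \<ge> 1 / 2" by (simp add: c_def)
  have "(\<lambda>\<omega>. h0 \<omega> + c * (\<Sum>u\<in>U. e (k \<omega>) u * (h u \<omega> - h0 \<omega>))) \<in> mixes \<Omega> (sel k (Suc N) (signs n))"
    unfolding c_def using assms by (intro rejection_sampling_trials[where s = s])
  then have 1: "(\<lambda>\<omega>. h0 \<omega> + c * (\<Sum>u\<in>U. e (k \<omega>) u * (h u \<omega> - h0 \<omega>))) \<in> protocols \<Omega> (n + j)"
    using mix_mono[OF sel_signs[OF k]] unfolding N by blast
  have "h0 \<in> protocols \<Omega> (n + j)" using h(2) protocols_mono[of n "n + j" \<Omega>] by auto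
  from mix_convex2[OF _ _ 1 this, of "1 / (2 * c)"] c
  have "(\<lambda>\<omega>. 1 / (2 * c) * (h0 \<omega> + c * (\<Sum>u\<in>U. e (k \<omega>) u * (h u \<omega> - h0 \<omega>))) + (1 - 1 / (2 * c)) * h0 \<omega>)
    \<in> protocols \<Omega> (n + j)" by simp
  moreover have "1 / (2 * c) * (a + c * b) + (1 - 1 / (2 * c)) * a = a + 1 / 2 * b" for a b
    using c by (simp add: field_simps)
  ultimately show ?thesis by simp
qed

lemma protocols_const:
  fixes \<Omega> :: "('x \<times> 'y) set"
  assumes c: "\<bar>c\<bar> \<le> 1"
  shows "(\<lambda>_. c) \<in> protocols \<Omega> n"
proof -
  have s: "(\<lambda>_. if b then - 1 else 1) \<in> protocols \<Omega> n" for b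
  proof -
    have eq: "(\<lambda>_. if b then - 1 else 1) = (tree_sign (Output b) :: 'x \<times> 'y \<Rightarrow> real)"
      by (auto simp: tree_sign_def)
    have "tree_sign (Output b) \<in> (signs n :: ('x \<times> 'y \<Rightarrow> real) set)" unfolding signs_def by force
    then show ?thesis unfolding eq by (rule subsetD[OF mix_superset])
  qed
  from mix_convex2[of "(1 + c) / 2", OF _ _ s[of False] s[of True]] c
  show ?thesis by (simp add: field_simps)
qed

text \<open>Each player sends a random sign with the prescribed mean; by independence the means
  multiply.\<close>

lemma protocols_product:
  assumes "finite \<Omega>" "\<And>x. \<bar>u x\<bar> \<le> 1" "\<And>y. \<bar>v y\<bar> \<le> 1"
  shows "(\<lambda>(x, y). u x * v y) \<in> protocols \<Omega> 2"
proof -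
  have v: "(\<lambda>\<omega>. w (snd \<omega>)) \<in> protocols \<Omega> 1" if w: "\<And>y. \<bar>w y\<bar> \<le> 1" for w
  proof -
    have "0 \<le> (1 + w y) / 2" "(1 + w y) / 2 \<le> 1" for y using w[of y] by auto
    from protocols_select[OF assms(1) speaker_snd this protocols_const[of 1] protocols_const[of "-1"]]
    have "(\<lambda>\<omega>. (1 + w (snd \<omega>)) / 2 * 1 + (1 - (1 + w (snd \<omega>)) / 2) * - 1) \<in> protocols \<Omega> (Suc 0)" by simp
    then show ?thesis unfolding One_nat_def by (rule mix_cong) (simp add: field_simps)
  qed
  have "0 \<le> (1 + u y) / 2" "(1 + u y) / 2 \<le> 1" for y using assms(2)[of y] by auto
  from protocols_select[OF assms(1) speaker_fst this v[of v] v[of "\<lambda>y. - v y"]] assms(3)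
  have "(\<lambda>\<omega>. (1 + u (fst \<omega>)) / 2 * v (snd \<omega>) + (1 - (1 + u (fst \<omega>)) / 2) * - v (snd \<omega>)) \<in> protocols \<Omega> 2"
    by (simp add: numeral_2_eq_2)
  then show ?thesis by (rule mix_cong) (simp add: field_simps split: prod.splits)
qed

text \<open>With public signs $s_k$, the product of $\sum_k s_k a_k(x)$ and $\sum_k s_k b_k(y)$
  has expectation $\sum_k a_k(x) b_k(y)$.\<close>

lemma protocols_sum_products:
  assumes fin: "finite \<Omega>" "finite K"
    and "\<And>x. \<bar>u x\<bar> + (\<Sum>k\<in>K. \<bar>a k x\<bar>) \<le> 1" "\<And>y. \<bar>v y\<bar> + (\<Sum>k\<in>K. \<bar>b k y\<bar>) \<le> 1"
  shows "(\<lambda>(x, y). u x * v y + (\<Sum>k\<in>K. a k x * b k y)) \<in> protocols \<Omega> 2"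
  using fin(2) assms(3,4)
proof (induction K arbitrary: u v rule: finite_induct)
  case empty
  then show ?case using protocols_product[OF fin(1), of u v] by simp
next
  case (insert i K)
  have "\<bar>u x + c * a i x\<bar> + (\<Sum>k\<in>K. \<bar>a k x\<bar>) \<le> 1" if "\<bar>c\<bar> = 1" for c x
    using insert.prems(1)[of x] insert.hyps that abs_triangle_ineq[of "u x" "c * a i x"] by (simp add: abs_mult)
  moreover have "\<bar>v y + c * b i y\<bar> + (\<Sum>k\<in>K. \<bar>b k y\<bar>) \<le> 1" if "\<bar>c\<bar> = 1" for c y
    using insert.prems(2)[of y] insert.hyps that abs_triangle_ineq[of "v y" "c * b i y"] by (simp add: abs_mult)
  ultimately have *: "(\<lambda>(x, y). (u x + c * a i x) * (v y + c * b i y) + (\<Sum>k\<in>K. a k x * b k y)) \<in> protocols \<Omega> 2"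
    if "\<bar>c\<bar> = 1" for c
    using that by (intro insert.IH) auto
  \<comment> \<open>Averaging over the public sign of term \<open>i\<close> cancels the cross terms
    of \<open>u\<close> with \<open>b i\<close> and of \<open>a i\<close> with
    \<open>v\<close>.\<close>
  from mix_convex2[of "1/2", OF _ _ *[of 1] *[of "-1"]]
  have "(\<lambda>\<omega>. 1 / 2 * (case \<omega> of (x, y) \<Rightarrow> (u x + 1 * a i x) * (v y + 1 * b i y) + (\<Sum>k\<in>K. a k x * b k y))
     + (1 - 1 / 2) * (case \<omega> of (x, y) \<Rightarrow> (u x + - 1 * a i x) * (v y + - 1 * b i y) + (\<Sum>k\<in>K. a k x * b k y)))
     \<in> protocols \<Omega> 2" by simp
  then show ?case by (rule mix_cong) (use insert.hyps in \<open>auto simp: field_simps split: prod.splits\<close>)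
qed

lemma sum_powers_of_two_le:
  fixes K :: "int set"
  assumes "finite K" "\<And>k. k \<in> K \<Longrightarrow> k \<le> j"
  shows "(\<Sum>k\<in>K. 2 powr real_of_int k) \<le> 2 powr (real_of_int j + 1)"
  using assms
proof (induction K arbitrary: j rule: finite_linorder_max_induct)
  case empty
  then show ?case by simp
next
  case (insert b A)
  have "(\<Sum>k\<in>A. 2 powr real_of_int k) \<le> 2 powr (real_of_int (b - 1) + 1)"
    using insert by (intro insert.IH) force
  then have "(\<Sum>k\<in>insert b A. 2 powr real_of_int k) \<le> 2 powr real_of_int b + 2 powr real_of_int b"
    using insert by (subst sum.insert) auto
  also have "\<dots> = 2 powr (real_of_int b + 1)" by (simp add: powr_add)
  also have "\<dots> \<le> 2 powr (real_of_int j + 1)" using insert by simp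
  finally show ?case .
qed

text \<open>Alice rounds \<open>A x\<close> down to a power of two and uses that one scale; Bob is
  active in all scales \<open>k\<close> with \<open>2 powr k * B y \<le> S\<close>, whose weights
  are dominated by a geometric series. \<open>\<theta>\<close> tells whether Bob is active in
  Alice's scale, which holds whenever \<open>A x * B y \<le> S\<close>. The \<open>4\<close> is a
  factor \<open>2\<close> for the rounding and one for the series.\<close>

lemma protocols_truncated_product:
  fixes A :: "'x \<Rightarrow> real" and B :: "'y \<Rightarrow> real"
  assumes fin: "finite \<Omega>" and A: "\<And>x. 0 \<le> A x" and B: "\<And>y. 0 \<le> B y" and S: "S > 0" and c: "\<bar>c\<bar> \<le> 1"
  obtains \<theta> where "\<And>x y. 0 \<le> \<theta> x y" "\<And>x y. \<theta> x y \<le> 1" "\<And>x y. A x * B y \<le> S \<Longrightarrow> \<theta> x y = 1"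
    "(\<lambda>(x, y). c * \<theta> x y * (A x * B y) / (4 * S)) \<in> protocols \<Omega> 2"
proof -
  define l where "l x = \<lfloor>log 2 (A x)\<rfloor>" for x
  define K where "K = l ` fst ` \<Omega>"
  define a where "a k x = (if k = l x then A x / 2 powr (l x + 1) else 0)" for k x
  define ok where "ok k y \<longleftrightarrow> 2 powr real_of_int k * B y \<le> S" for k y
  define b where "b k y = (if ok k y then c * 2 powr (real_of_int k + 1) * B y / (4 * S) else 0)" for k y
  have finK: "finite K" using fin by (simp add: K_def)
  have l: "2 powr l x \<le> A x" "A x \<le> 2 powr (l x + 1)" if "A x > 0" for x
  proof -
    have "2 powr l x \<le> 2 powr (log 2 (A x))" unfolding l_def by (subst powr_le_cancel_iff) auto
    then show "2 powr l x \<le> A x" using that by simp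
    have "2 powr (log 2 (A x)) \<le> 2 powr (l x + 1)" unfolding l_def by (subst powr_le_cancel_iff) linarith+
    then show "A x \<le> 2 powr (l x + 1)" using that by simp
  qed
  have a: "\<bar>0\<bar> + (\<Sum>k\<in>K. \<bar>a k x\<bar>) \<le> 1" for x
  proof -
    have "(\<Sum>k\<in>K. \<bar>a k x\<bar>) = (\<Sum>k\<in>K. if k = l x then \<bar>A x / 2 powr (l x + 1)\<bar> else 0)"
      by (intro sum.cong) (auto simp: a_def)
    also have "\<dots> \<le> \<bar>A x / 2 powr (l x + 1)\<bar>" using finK by simp
    also have "\<dots> \<le> 1" using l(2)[of x] A[of x] by (cases "A x = 0") (auto simp: field_simps)
    finally show ?thesis by simp
  qed
  have b: "\<bar>0\<bar> + (\<Sum>k\<in>K. \<bar>b k y\<bar>) \<le> 1" for y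
  proof (cases "B y = 0 \<or> {k \<in> K. ok k y} = {}")
    case True
    then have "b k y = 0" if "k \<in> K" for k using that by (auto simp: b_def)
    then show ?thesis by simp
  next
    case False
    then have By: "B y > 0" using B[of y] by simp
    let ?K = "{k \<in> K. ok k y}"
    have mx: "ok (Max ?K) y" using False finK Max_in[of ?K] by auto
    have "(\<Sum>k\<in>?K. 2 powr real_of_int k) \<le> 2 powr (real_of_int (Max ?K) + 1)"
      using finK by (intro sum_powers_of_two_le) auto
    also have "\<dots> = 2 * 2 powr real_of_int (Max ?K)" by (simp add: powr_add)
    also have "\<dots> \<le> 2 * (S / B y)" using mx By by (simp add: ok_def field_simps)
    finally have *: "(\<Sum>k\<in>?K. 2 powr real_of_int k) \<le> 2 * (S / B y)" .
    have "\<bar>b k y\<bar> = (if ok k y then \<bar>c\<bar> * (2 powr real_of_int k * (B y / (2 * S))) else 0)" for k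
      using S By by (auto simp: b_def abs_mult powr_add)
    then have "(\<Sum>k\<in>K. \<bar>b k y\<bar>) = (\<Sum>k\<in>?K. \<bar>c\<bar> * (2 powr real_of_int k * (B y / (2 * S))))"
      by (simp only: sum.inter_filter[OF finK])
    also have "\<dots> \<le> (\<Sum>k\<in>?K. 1 * (2 powr real_of_int k * (B y / (2 * S))))"
      using c S By by (intro sum_mono mult_right_mono) auto
    also have "\<dots> = (\<Sum>k\<in>?K. 2 powr real_of_int k) * (B y / (2 * S))" by (simp only: sum_distrib_right mult_1_left)
    also have "\<dots> \<le> 2 * (S / B y) * (B y / (2 * S))" using S By by (intro mult_right_mono *) auto
    also have "\<dots> = 1" using S By by simp
    finally show ?thesis by simp
  qed
  define \<theta> :: "'x \<Rightarrow> 'y \<Rightarrow> real" where "\<theta> x y = (if ok (l x) y \<or> A x = 0 then 1 else 0)" for x y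
  have "(\<lambda>(x, y). 0 * 0 + (\<Sum>k\<in>K. a k x * b k y)) \<in> protocols \<Omega> 2"
    by (rule protocols_sum_products[OF fin finK a b])
  then have "(\<lambda>(x, y). c * \<theta> x y * (A x * B y) / (4 * S)) \<in> protocols \<Omega> 2"
  proof (rule mix_cong, clarify)
    fix x y assume "(x, y) \<in> \<Omega>"
    then have lK: "l x \<in> K" by (force simp: K_def)
    have "(\<Sum>k\<in>K. a k x * b k y) = (\<Sum>k\<in>K. if k = l x then a k x * b k y else 0)"
      by (intro sum.cong) (auto simp: a_def)
    also have "\<dots> = a (l x) x * b (l x) y" using finK lK by simp
    also have "\<dots> = c * \<theta> x y * (A x * B y) / (4 * S)"
      by (auto simp: a_def b_def \<theta>_def)
    finally show "c * \<theta> x y * (A x * B y) / (4 * S) = 0 * 0 + (\<Sum>k\<in>K. a k x * b k y)" by simp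
  qed
  moreover have "\<theta> x y = 1" if "A x * B y \<le> S" for x y
  proof (cases "A x = 0")
    case False
    then have "2 powr l x * B y \<le> A x * B y" using A[of x] B[of y] l(1)[of x] by (intro mult_right_mono) auto
    then show ?thesis using that by (simp add: \<theta>_def ok_def)
  qed (simp add: \<theta>_def)
  ultimately show thesis using that[of \<theta>] by (auto simp: \<theta>_def)
qed

lemma correlation_le_adv:
  assumes "finite_randomness \<pi>" "real (communication \<pi>) \<le> T"
  shows "correlation \<mu> \<pi> f \<le> adv \<mu> T f"
  unfolding adv_def
proof (rule cSUP_upper)
  show "bdd_above ((\<lambda>\<pi>. correlation \<mu> \<pi> f) ` {\<pi>. finite_randomness \<pi> \<and> real (communication \<pi>) \<le> T})"
  proof (rule bdd_aboveI2)
    fix \<pi> :: "('a, 'b) protocol"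
    show "correlation \<mu> \<pi> f \<le> 1" unfolding correlation_def
      by (intro measure_pmf.integral_le_const measure_pmf.integrable_const_bound[where B = 1])
         (auto simp: power_add minus_one_power_iff)
  qed
qed (use assms in auto)

text \<open>The correlation is a linear functional, so by the definition of \<open>mixes\<close> a
  single tree does at least as well as \<open>g\<close>; this tree with trivial seeds is the
  protocol.\<close>

lemma protocols_le_adv:
  fixes f :: "'x \<Rightarrow> 'y \<Rightarrow> bool"
  assumes g: "g \<in> protocols \<Omega> n" and \<Omega>: "finite \<Omega>" "set_pmf \<mu> \<subseteq> \<Omega>" and T: "real n \<le> T"
  shows "(\<Sum>(x, y)\<in>\<Omega>. pmf \<mu> (x, y) * (- 1) ^ of_bool (f x y) * g (x, y)) \<le> adv \<mu> T f"
proof -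
  obtain t where t: "depth t \<le> n"
    "(\<Sum>\<omega>\<in>\<Omega>. (case \<omega> of (x, y) \<Rightarrow> pmf \<mu> (x, y) * (- 1) ^ of_bool (f x y)) * g \<omega>)
      \<le> (\<Sum>\<omega>\<in>\<Omega>. (case \<omega> of (x, y) \<Rightarrow> pmf \<mu> (x, y) * (- 1) ^ of_bool (f x y)) * tree_sign t \<omega>)"
    using mixD[OF g, of "\<lambda>(x, y). pmf \<mu> (x, y) * (- 1) ^ of_bool (f x y)"] unfolding signs_def by blast
  let ?\<pi> = "\<lparr>public_seed = return_pmf 0, alice_seed = return_pmf 0, bob_seed = return_pmf 0, tree = (\<lambda>_. t)\<rparr>"
  have "correlation \<mu> ?\<pi> f = measure_pmf.expectation \<mu> (\<lambda>(x, y). (- 1) ^ (of_bool (run t x 0 y 0) + of_bool (f x y)))"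
    unfolding correlation_def
    by (simp add: pair_return_pmf1 pair_return_pmf2 pair_map_pmf2 case_prod_unfold)
  also have "\<dots> = (\<Sum>\<omega>\<in>\<Omega>. pmf \<mu> \<omega> * (case \<omega> of (x, y) \<Rightarrow> (- 1) ^ (of_bool (run t x 0 y 0) + of_bool (f x y))))"
    using \<Omega> by (subst integral_measure_pmf_real[of \<Omega>]) (auto simp: ac_simps)
  also have "\<dots> = (\<Sum>\<omega>\<in>\<Omega>. (case \<omega> of (x, y) \<Rightarrow> pmf \<mu> (x, y) * (- 1) ^ of_bool (f x y)) * tree_sign t \<omega>)"
    by (intro sum.cong) (auto simp: tree_sign_def power_add)
  finally have "(\<Sum>(x, y)\<in>\<Omega>. pmf \<mu> (x, y) * (- 1) ^ of_bool (f x y) * g (x, y)) \<le> correlation \<mu> ?\<pi> f"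
    using t(2) by (simp add: case_prod_beta)
  also have "\<dots> \<le> adv \<mu> T f"
    using t(1) T by (intro correlation_le_adv) (auto simp: finite_randomness_def communication_def)
  finally show ?thesis .
qed

section \<open>Sampling a walk in chunks\<close>

definition words :: "nat \<Rightarrow> nat list set" where
  "words d = {w. length w = d \<and> set w \<subseteq> {0, 1}}"

definition words_le :: "nat \<Rightarrow> nat list set" where
  "words_le d = {w. length w \<le> d \<and> set w \<subseteq> {0, 1}}"

lemma finite_words: "finite (words d)"
  using finite_lists_length_eq[of "{0, 1 :: nat}" d] by (simp add: words_def conj_commute)

lemma finite_words_le: "finite (words_le d)"
  using finite_lists_length_le[of "{0, 1 :: nat}" d] by (simp add: words_le_def conj_commute)

lemma words_0: "words 0 = {[]}"
  by (auto simp: words_def)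

lemma words_le_0: "words_le 0 = {[]}"
  by (auto simp: words_le_def)

lemma words_Suc: "words (Suc d) = (#) 0 ` words d \<union> (#) 1 ` words d"
  by (auto simp: words_def length_Suc_conv image_iff)

lemma words_le_Suc: "words_le (Suc d) = insert [] ((#) 0 ` words_le d \<union> (#) 1 ` words_le d)"
proof -
  have "w \<in> words_le (Suc d) \<longleftrightarrow> w \<in> insert [] ((#) 0 ` words_le d \<union> (#) 1 ` words_le d)" for w
    by (cases w) (auto simp: words_le_def)
  then show ?thesis by blast
qed

lemma sum_words_Suc:
  fixes F :: "nat list \<Rightarrow> real"
  shows "(\<Sum>w\<in>words (Suc d). F w) = (\<Sum>c\<in>{0, 1}. \<Sum>w\<in>words d. F (c # w))"
proof -
  have "(\<Sum>w\<in>words (Suc d). F w) = (\<Sum>w\<in>(#) 0 ` words d. F w) + (\<Sum>w\<in>(#) 1 ` words d. F w)"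
    unfolding words_Suc by (intro sum.union_disjoint) (auto simp: finite_words)
  then show ?thesis by (simp add: sum.reindex)
qed

lemma sum_words_le_Suc:
  fixes F :: "nat list \<Rightarrow> real"
  shows "(\<Sum>w\<in>words_le (Suc d). F w) = F [] + (\<Sum>c\<in>{0, 1}. \<Sum>w\<in>words_le d. F (c # w))"
proof -
  have "(\<Sum>w\<in>words_le (Suc d). F w) = F [] + (\<Sum>w\<in>(#) 0 ` words_le d \<union> (#) 1 ` words_le d. F w)"
    unfolding words_le_Suc by (intro sum.insert) (auto simp: finite_words_le)
  also have "(\<Sum>w\<in>(#) 0 ` words_le d \<union> (#) 1 ` words_le d. F w)
      = (\<Sum>w\<in>(#) 0 ` words_le d. F w) + (\<Sum>w\<in>(#) 1 ` words_le d. F w)"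
    by (intro sum.union_disjoint) (auto simp: finite_words_le)
  finally show ?thesis by (simp add: sum.reindex)
qed

fun path_prod :: "(nat list \<Rightarrow> nat \<Rightarrow> real) \<Rightarrow> nat list \<Rightarrow> nat list \<Rightarrow> real" where
  "path_prod f v [] = 1"
| "path_prod f v (c # w) = f v c * path_prod f (v @ [c]) w"

lemma path_prod_nonneg: "(\<And>v c. 0 \<le> f v c) \<Longrightarrow> 0 \<le> path_prod f v w"
  by (induction f v w rule: path_prod.induct) auto

lemma path_prod_sum_le_words_le:
  assumes "\<And>v c. 0 \<le> f v c" "\<And>v. f v 0 + f v 1 \<le> 1"
  shows "(\<Sum>w\<in>words_le d. path_prod f v w) \<le> real d + 1"
proof (induction d arbitrary: v)
  case 0
  then show ?case by (simp add: words_le_0)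
next
  case (Suc d)
  have "(\<Sum>w\<in>words_le (Suc d). path_prod f v w) = 1 + (\<Sum>c\<in>{0, 1}. f v c * (\<Sum>w\<in>words_le d. path_prod f (v @ [c]) w))"
    by (simp add: sum_words_le_Suc sum_distrib_left)
  also have "\<dots> \<le> 1 + (\<Sum>c\<in>{0, 1}. f v c * (real d + 1))"
    by (intro add_left_mono sum_mono mult_left_mono Suc assms)
  also have "\<dots> = 1 + (f v 0 + f v 1) * (real d + 1)" by (simp add: algebra_simps)
  also have "\<dots> \<le> 1 + 1 * (real d + 1)" by (intro add_left_mono mult_right_mono assms) auto
  finally show ?case by simp
qed

text \<open>\<open>stop\<close> and \<open>stay\<close> split the law of a chunk between the
  players. Here a player's likelihood of \<open>w\<close> counts only if it first lifts the ratio,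
  which starts at \<open>s\<close>, above \<open>2\<close> at the last letter of \<open>w\<close>; a
  word that uses up all \<open>d\<close> steps without crossing gets the extra weight
  \<open>e\<close>.\<close>

fun stop :: "(nat list \<Rightarrow> nat \<Rightarrow> real) \<Rightarrow> real \<Rightarrow> nat list \<Rightarrow> real \<Rightarrow> nat \<Rightarrow> nat list \<Rightarrow> real" where
  "stop f e v s d [] = (if d = 0 then e else 0)"
| "stop f e v s d (c # w) =
    (if d = 0 then 0
     else if s * f v c > 2 then (if w = [] then f v c else 0)
     else f v c * stop f e (v @ [c]) (s * f v c) (d - 1) w)"

fun stay :: "(nat list \<Rightarrow> nat \<Rightarrow> real) \<Rightarrow> nat list \<Rightarrow> real \<Rightarrow> nat list \<Rightarrow> real" where
  "stay f v s [] = 1"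
| "stay f v s (c # w) = (if s * f v c > 2 then 0 else f v c * stay f (v @ [c]) (s * f v c) w)"

lemma stop_nonneg: "(\<And>v c. 0 \<le> f v c) \<Longrightarrow> 0 \<le> e \<Longrightarrow> 0 \<le> stop f e v s d w"
  by (induction f e v s d w rule: stop.induct) auto

lemma stay_nonneg: "(\<And>v c. 0 \<le> f v c) \<Longrightarrow> 0 \<le> stay f v s w"
  by (induction f v s w rule: stay.induct) auto

text \<open>Before the last step the ratio is at most \<open>2\<close>, and one step multiplies it
  by at most \<open>L\<close>.\<close>

lemma stop_le:
  assumes "\<And>v c. 0 \<le> f v c" "\<And>v c. f v c \<le> L" "1 \<le> L" "e \<le> 1" "0 \<le> s" "s \<le> 2"
  shows "s * stop f e v s d w \<le> 2 * L"
  using assms(5,6)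
proof (induction w arbitrary: v s d)
  case Nil
  have "s * e \<le> s * 1" using Nil assms by (intro mult_left_mono) auto
  then show ?case using Nil assms by auto
next
  case (Cons c w)
  have 1: "0 \<le> s * f v c" using Cons assms by simp
  have 2: "s * f v c \<le> 2 * L" using Cons assms by (intro mult_mono) auto
  show ?case using Cons.IH[of "s * f v c" "v @ [c]" "d - 1"] 1 2 assms(3) by (auto simp: mult.assoc)
qed

lemma stay_le:
  assumes "\<And>v c. 0 \<le> f v c" "0 \<le> s" "s \<le> 2"
  shows "s * stay f v s w \<le> 2"
  using assms(2,3)
proof (induction w arbitrary: v s)
  case (Cons c w)
  have "0 \<le> s * f v c" using Cons assms by simp
  then show ?case using Cons.IH[of "s * f v c" "v @ [c]"] by (auto simp: mult.assoc)
qed simp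

text \<open>The words after which a chunk can end are prefix-free, so their weights form a
  subprobability, as \<open>rejection_sampling\<close> requires.\<close>

lemma sum_stop_le:
  assumes "\<And>v c. 0 \<le> f v c" "\<And>v c. 0 \<le> r v c" "\<And>v. r v 0 * f v 0 + r v 1 * f v 1 \<le> 1" "0 \<le> e" "e \<le> 1"
  shows "(\<Sum>w\<in>words_le d. path_prod r v w * stop f e v s d w) \<le> 1"
proof (induction d arbitrary: v s)
  case 0
  then show ?case using assms by (simp add: words_le_0)
next
  case (Suc d)
  have *: "(\<Sum>w\<in>words_le d. path_prod r v (c # w) * stop f e v s (Suc d) (c # w)) \<le> r v c * f v c" for c
  proof (cases "s * f v c > 2")
    case True
    have "(\<Sum>w\<in>words_le d. path_prod r v (c # w) * stop f e v s (Suc d) (c # w))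
      = (\<Sum>w\<in>words_le d. if w = [] then r v c * f v c else 0)"
      using True by (intro sum.cong) auto
    also have "\<dots> \<le> r v c * f v c" using assms by (simp add: finite_words_le)
    finally show ?thesis .
  next
    case False
    then have "(\<Sum>w\<in>words_le d. path_prod r v (c # w) * stop f e v s (Suc d) (c # w))
      = r v c * f v c * (\<Sum>w\<in>words_le d. path_prod r (v @ [c]) w * stop f e (v @ [c]) (s * f v c) d w)"
      by (simp add: sum_distrib_left mult_ac)
    also have "\<dots> \<le> r v c * f v c * 1" using assms by (intro mult_left_mono Suc) auto
    finally show ?thesis by simp
  qed
  have "(\<Sum>w\<in>words_le (Suc d). path_prod r v w * stop f e v s (Suc d) w)
    = (\<Sum>c\<in>{0,1}. \<Sum>w\<in>words_le d. path_prod r v (c # w) * stop f e v s (Suc d) (c # w))"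
    unfolding sum_words_le_Suc by simp
  also have "\<dots> \<le> (\<Sum>c\<in>{0,1}. r v c * f v c)" by (intro sum_mono *)
  also have "\<dots> \<le> 1" using assms(3)[of v] by simp
  finally show ?case .
qed

text \<open>This is cosh of half the logarithm of \<open>t\<close>, the Hellinger potential of a
  likelihood ratio; it is minimal at \<open>1\<close>.\<close>

definition psi :: "real \<Rightarrow> real" where
  "psi t = (sqrt t + 1 / sqrt t) / 2"

lemma psi_1: "psi 1 = 1" by (simp add: psi_def)

lemma psi_ge_1: "t > 0 \<Longrightarrow> 1 \<le> psi t"
proof -
  assume "t > 0"
  define u where "u = sqrt t"
  have u: "u > 0" using \<open>t > 0\<close> by (simp add: u_def)
  have "0 \<le> (u - 1)\<^sup>2" by simp
  then have "2 * u \<le> u * u + 1" by (simp add: power2_eq_square algebra_simps)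
  then show ?thesis using u by (simp add: psi_def u_def[symmetric] field_simps)
qed

text \<open>Source of the reward \<open>21 / 20\<close>: the value at \<open>2\<close> is
  \<open>3 / (2 * sqrt 2)\<close>, about 1.06.\<close>

lemma psi_ge: "t > 2 \<Longrightarrow> 21 / 20 \<le> psi t"
proof -
  assume t: "t > 2"
  define u where "u = sqrt t"
  have "sqrt t > sqrt ((14 / 10)\<^sup>2)" using t by (subst real_sqrt_less_iff) (simp add: power2_eq_square)
  then have u: "u > 14 / 10" by (simp add: u_def)
  then have "0 \<le> (u - 14 / 10) * (u - 7 / 10)" by (intro mult_nonneg_nonneg) auto
  then have "21 / 10 * u \<le> u * u + 1" using u by (simp add: algebra_simps)
  then show ?thesis using u by (simp add: psi_def u_def[symmetric] field_simps)
qed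

lemma psi_pos: "t > 0 \<Longrightarrow> 0 < psi t"
  using psi_ge_1[of t] by simp

text \<open>The right-hand side is affine in \<open>u\<close>. Averaged over the next bit, where the
  likelihood ratio \<open>u\<close> has prior mean at most \<open>1\<close>, it is therefore at most
  \<open>psi t\<close>: the affinity weighted by \<open>psi\<close> is a supermartingale.\<close>

lemma sqrt_psi_mult: "u \<ge> 0 \<Longrightarrow> t > 0 \<Longrightarrow> u \<noteq> 0 \<Longrightarrow> sqrt u * psi (t * u) = (u * sqrt t + 1 / sqrt t) / 2"
  by (simp add: psi_def real_sqrt_mult field_simps)

text \<open>Bits are appended to \<open>v\<close> with prior probability \<open>r v c\<close>; the true probability is
  \<open>r v c * a x v c * b y v c\<close>. Alice moves at \<open>v\<close> of odd length, and the likelihood ratio of the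
  player who does not move is \<open>1\<close>.\<close>

locale two_party_walk =
  fixes r :: "nat list \<Rightarrow> nat \<Rightarrow> real"
    and a :: "'x \<Rightarrow> nat list \<Rightarrow> nat \<Rightarrow> real"
    and b :: "'y \<Rightarrow> nat list \<Rightarrow> nat \<Rightarrow> real"
    and L :: real
  assumes r_nonneg: "0 \<le> r v c" and r_sum: "r v 0 + r v 1 \<le> 1"
    and a_nonneg: "0 \<le> a x v c" and a_le: "a x v c \<le> L"
    and b_nonneg: "0 \<le> b y v c" and b_le: "b y v c \<le> L"
    and L_ge: "1 \<le> L"
    and a_idle: "even (length v) \<Longrightarrow> a x v c = 1"
    and b_idle: "odd (length v) \<Longrightarrow> b y v c = 1"
    and a_sum: "odd (length v) \<Longrightarrow> r v 0 * a x v 0 + r v 1 * a x v 1 = 1"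
    and b_sum: "even (length v) \<Longrightarrow> r v 0 * b y v 0 + r v 1 * b y v 1 = 1"
begin

lemma a_sum_le: "r v 0 * a x v 0 + r v 1 * a x v 1 \<le> 1"
  using a_sum[of v x] a_idle[of v x] r_sum[of v] by (cases "odd (length v)") auto

lemma b_sum_le: "r v 0 * b y v 0 + r v 1 * b y v 1 \<le> 1"
  using b_sum[of v y] b_idle[of v y] r_sum[of v] by (cases "odd (length v)") auto

lemma ab_sum: "r v 0 * a x v 0 * b y v 0 + r v 1 * a x v 1 * b y v 1 = 1"
  using a_sum[of v x] b_sum[of v y] a_idle[of v x] b_idle[of v y] by (cases "odd (length v)") auto

text \<open>Here \<open>s\<close> and \<open>t\<close> are the likelihood ratios of the players since the start of the chunk.\<close>

fun chunk :: "'x \<Rightarrow> 'y \<Rightarrow> nat \<Rightarrow> nat list \<Rightarrow> real \<Rightarrow> real \<Rightarrow> (nat list \<Rightarrow> real) \<Rightarrow> real" where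
  "chunk x y 0 v s t g = g v"
| "chunk x y (Suc d) v s t g = (\<Sum>c\<in>{0, 1}. r v c * a x v c * b y v c *
     (if s * a x v c > 2 \<or> t * b y v c > 2 then g (v @ [c])
      else chunk x y d (v @ [c]) (s * a x v c) (t * b y v c) g))"

lemma chunk_const: "chunk x y d v s t (\<lambda>_. 1) = 1"
proof (induction d arbitrary: v s t)
  case (Suc d)
  then show ?case using ab_sum[of v x y] by simp
qed simp

text \<open>One player moves at a time and the ratio of the idle one does not change, so every
  crossing has exactly one author; the two summands tell which. The weights \<open>1\<close> and
  \<open>0\<close> attribute a word that ends without crossing to Alice alone, so that it is not
  counted twice.\<close>

lemma chunk_decompose:
  assumes "s \<le> 2" "t \<le> 2"
  shows "chunk x y d v s t g = (\<Sum>w\<in>words_le d. path_prod r v w *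
    (stop (a x) 1 v s d w * stay (b y) v t w + stay (a x) v s w * stop (b y) 0 v t d w) * g (v @ w))"
  using assms
proof (induction d arbitrary: v s t)
  case 0
  then show ?case by (simp add: words_le_0)
next
  case (Suc d)
  let ?F = "\<lambda>v s t d w. path_prod r v w *
    (stop (a x) 1 v s d w * stay (b y) v t w + stay (a x) v s w * stop (b y) 0 v t d w) * g (v @ w)"
  have *: "(\<Sum>w\<in>words_le d. ?F v s t (Suc d) (c # w)) = r v c * a x v c * b y v c *
     (if s * a x v c > 2 \<or> t * b y v c > 2 then g (v @ [c])
      else chunk x y d (v @ [c]) (s * a x v c) (t * b y v c) g)" for c
  proof (cases "s * a x v c > 2 \<or> t * b y v c > 2")
    case False
    then have IH: "chunk x y d (v @ [c]) (s * a x v c) (t * b y v c) g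
      = (\<Sum>w\<in>words_le d. ?F (v @ [c]) (s * a x v c) (t * b y v c) d w)" by (intro Suc.IH) auto
    show ?thesis unfolding IH using False
      by (auto simp: sum_distrib_left algebra_simps intro!: sum.cong)
  next
    case True
    have "?F v s t (Suc d) (c # w) = (if w = [] then r v c * a x v c * b y v c * g (v @ [c]) else 0)" for w
    proof (cases "even (length v)")
      case True
      then show ?thesis using \<open>s * a x v c > 2 \<or> t * b y v c > 2\<close> Suc.prems by (auto simp: a_idle)
    next
      case False
      then show ?thesis using \<open>s * a x v c > 2 \<or> t * b y v c > 2\<close> Suc.prems by (auto simp: b_idle)
    qed
    then have "(\<Sum>w\<in>words_le d. ?F v s t (Suc d) (c # w))
      = (\<Sum>w\<in>words_le d. if w = [] then r v c * a x v c * b y v c * g (v @ [c]) else 0)" by simp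
    also have "\<dots> = r v c * a x v c * b y v c * g (v @ [c])"
      using finite_words_le[of d] by (auto simp: words_le_def)
    finally show ?thesis using True by simp
  qed
  have "(\<Sum>w\<in>words_le (Suc d). ?F v s t (Suc d) w) = (\<Sum>c\<in>{0, 1}. \<Sum>w\<in>words_le d. ?F v s t (Suc d) (c # w))"
    unfolding sum_words_le_Suc by simp
  also have "\<dots> = chunk x y (Suc d) v s t g" unfolding * by (simp only: chunk.simps)
  finally show ?case by simp
qed

text \<open>The \<open>1 / 8\<close> is a product of three halves: a public coin guesses who ends
  the chunk, rejection sampling by that player succeeds, and the other player, whose ratio is at
  most \<open>2\<close>, accepts with probability \<open>stay / 2\<close>. After any failure the
  walk is still at \<open>v\<close>.\<close>

lemma chunk_protocol:
  assumes fin: "finite \<Omega>" and g: "\<And>u. g u \<in> protocols \<Omega> n" and j: "4 * (real d + 1) * L + 1 \<le> 2 ^ j"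
  shows "(\<lambda>(x, y). 7 / 8 * g v (x, y) + 1 / 8 * chunk x y d v 1 1 (\<lambda>u. g u (x, y))) \<in> protocols \<Omega> (Suc n + j)"
proof -
  let ?U = "words_le d"
  \<comment> \<open>The length of the public word is drawn uniformly, because the words of each
    single length already have total prior up to \<open>1\<close>.\<close>
  define s where "s w = path_prod r v w / (real d + 1)" for w
  define L' where "L' = 2 * (real d + 1) * L"
  have s: "0 \<le> s w" for w unfolding s_def by (intro divide_nonneg_nonneg path_prod_nonneg r_nonneg) auto
  have s1: "sum s ?U \<le> 1"
    unfolding s_def sum_divide_distrib[symmetric]
    using path_prod_sum_le_words_le[where f = r and d = d and v = v, OF r_nonneg r_sum] by (simp add: field_simps)
  have L'_ge: "L' \<ge> 1" "2 * L' + 1 \<le> 2 ^ j"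
  proof -
    have "1 * 1 \<le> (2 * (real d + 1)) * L" using L_ge by (intro mult_mono) auto
    then show "L' \<ge> 1" by (simp add: L'_def)
  qed (use j in \<open>simp add: L'_def mult_ac\<close>)
  have eL: "path_prod r v w * stop f e v 1 d w \<le> L' * s w"
    if "\<And>v c. 0 \<le> f v c" "\<And>v c. f v c \<le> L" "e \<le> 1" for f e w
  proof -
    have "path_prod r v w * stop f e v 1 d w \<le> path_prod r v w * (2 * L)"
      using stop_le[of f L e 1 v d w] that L_ge by (intro mult_left_mono path_prod_nonneg r_nonneg) auto
    also have "\<dots> = L' * s w" by (simp add: s_def L'_def field_simps)
    finally show ?thesis .
  qed
  have A: "(\<lambda>\<omega>. g v \<omega> + 1 / 2 * (\<Sum>w\<in>?U. path_prod r v w * stop (a (fst \<omega>)) 1 v 1 d w *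
      ((stay (b (snd \<omega>)) v 1 w / 2 * g (v @ w) \<omega> + (1 - stay (b (snd \<omega>)) v 1 w / 2) * g v \<omega>) - g v \<omega>)))
    \<in> protocols \<Omega> (Suc n + j)"
  proof (rule rejection_sampling[where e = "\<lambda>x w. path_prod r v w * stop (a x) 1 v 1 d w" and s = s and L = L'])
    show "(\<lambda>\<omega>. stay (b (snd \<omega>)) v 1 w / 2 * g (v @ w) \<omega> + (1 - stay (b (snd \<omega>)) v 1 w / 2) * g v \<omega>) \<in> protocols \<Omega> (Suc n)" for w
      using stay_le[of "b _" 1 v w] stay_nonneg[of "b _" v 1 w]
      by (intro protocols_select fin speaker_snd g) (auto simp: b_nonneg)
    show "g v \<in> protocols \<Omega> (Suc n)" using protocols_mono[of n "Suc n" \<Omega>] g by auto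
  qed (use s s1 L'_ge in \<open>auto intro!: fin finite_words_le speaker_fst eL sum_stop_le mult_nonneg_nonneg path_prod_nonneg stop_nonneg r_nonneg a_nonneg a_le a_sum_le\<close>)
  have B: "(\<lambda>\<omega>. g v \<omega> + 1 / 2 * (\<Sum>w\<in>?U. path_prod r v w * stop (b (snd \<omega>)) 0 v 1 d w *
      ((stay (a (fst \<omega>)) v 1 w / 2 * g (v @ w) \<omega> + (1 - stay (a (fst \<omega>)) v 1 w / 2) * g v \<omega>) - g v \<omega>)))
    \<in> protocols \<Omega> (Suc n + j)"
  proof (rule rejection_sampling[where e = "\<lambda>y w. path_prod r v w * stop (b y) 0 v 1 d w" and s = s and L = L'])
    show "(\<lambda>\<omega>. stay (a (fst \<omega>)) v 1 w / 2 * g (v @ w) \<omega> + (1 - stay (a (fst \<omega>)) v 1 w / 2) * g v \<omega>) \<in> protocols \<Omega> (Suc n)" for w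
      using stay_le[of "a _" 1 v w] stay_nonneg[of "a _" v 1 w]
      by (intro protocols_select fin speaker_fst g) (auto simp: a_nonneg)
    show "g v \<in> protocols \<Omega> (Suc n)" using protocols_mono[of n "Suc n" \<Omega>] g by auto
  qed (use s s1 L'_ge in \<open>auto intro!: fin finite_words_le speaker_snd eL sum_stop_le mult_nonneg_nonneg path_prod_nonneg stop_nonneg r_nonneg b_nonneg b_le b_sum_le\<close>)
  show ?thesis
  proof (rule mix_cong[OF mix_convex2[of "1/2", OF _ _ A B]], simp, simp, clarify)
    fix x y
    let ?p = "path_prod r v"
    define SA where "SA w = stop (a x) 1 v 1 d w * stay (b y) v 1 w" for w
    define SB where "SB w = stay (a x) v 1 w * stop (b y) 0 v 1 d w" for w
    have tot: "(\<Sum>w\<in>?U. ?p w * (SA w + SB w)) = 1"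
      using chunk_const[of x y d v 1 1] by (simp add: chunk_decompose SA_def SB_def)
    define G where "G = (\<Sum>w\<in>?U. ?p w * (SA w + SB w) * g (v @ w) (x, y))"
    have G: "chunk x y d v 1 1 (\<lambda>u. g u (x, y)) = G"
      by (simp add: chunk_decompose SA_def SB_def G_def)
    have 1: "(\<Sum>w\<in>?U. ?p w * stop (a x) 1 v 1 d w * (stay (b y) v 1 w / 2 * g (v @ w) (x, y) + (1 - stay (b y) v 1 w / 2) * g v (x, y) - g v (x, y)))
       = 1/2 * (\<Sum>w\<in>?U. ?p w * SA w * (g (v @ w) (x, y) - g v (x, y)))"
      unfolding sum_distrib_left SA_def by (intro sum.cong refl) (simp add: field_simps)
    have 2: "(\<Sum>w\<in>?U. ?p w * stop (b y) 0 v 1 d w * (stay (a x) v 1 w / 2 * g (v @ w) (x, y) + (1 - stay (a x) v 1 w / 2) * g v (x, y) - g v (x, y)))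
       = 1/2 * (\<Sum>w\<in>?U. ?p w * SB w * (g (v @ w) (x, y) - g v (x, y)))"
      unfolding sum_distrib_left SB_def by (intro sum.cong refl) (simp add: field_simps)
    have 3: "(\<Sum>w\<in>?U. ?p w * SA w * (g (v @ w) (x, y) - g v (x, y))) + (\<Sum>w\<in>?U. ?p w * SB w * (g (v @ w) (x, y) - g v (x, y)))
       = G - (\<Sum>w\<in>?U. ?p w * (SA w + SB w)) * g v (x, y)"
      unfolding G_def sum_distrib_right sum.distrib[symmetric] sum_subtractf[symmetric]
      by (intro sum.cong refl) (simp add: algebra_simps)
    show "7 / 8 * g v (x, y) + 1 / 8 * chunk x y d v 1 1 (\<lambda>u. g u (x, y)) =
       1 / 2 * (g v (x, y) + 1 / 2 * (\<Sum>w\<in>?U. ?p w * stop (a (fst (x, y))) 1 v 1 d w * (stay (b (snd (x, y))) v 1 w / 2 * g (v @ w) (x, y) + (1 - stay (b (snd (x, y))) v 1 w / 2) * g v (x, y) - g v (x, y)))) +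
       (1 - 1 / 2) * (g v (x, y) + 1 / 2 * (\<Sum>w\<in>?U. ?p w * stop (b (snd (x, y))) 0 v 1 d w * (stay (a (fst (x, y))) v 1 w / 2 * g (v @ w) (x, y) + (1 - stay (a (fst (x, y))) v 1 w / 2) * g v (x, y) - g v (x, y))))"
      unfolding fst_conv snd_conv 1 2 G using 3 unfolding tot by (simp add: field_simps)
  qed
qed

text \<open>The simulation with a budget of \<open>B\<close> attempts to sample a chunk; it outputs \<open>0\<close>, i.e. a fair
  coin, when the budget is exhausted before a leaf is reached.\<close>

fun simulate :: "nat \<Rightarrow> (nat list \<Rightarrow> 'x \<times> 'y \<Rightarrow> real) \<Rightarrow> nat \<Rightarrow> nat list \<Rightarrow> 'x \<times> 'y \<Rightarrow> real" where
  "simulate n leaf 0 v = (if length v \<ge> n then leaf v else (\<lambda>_. 0))"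
| "simulate n leaf (Suc B) v = (\<lambda>(x, y). 7 / 8 * simulate n leaf B v (x, y) +
     1 / 8 * chunk x y (n - length v) v 1 1 (\<lambda>u. simulate n leaf B u (x, y)))"

lemma simulate_protocol:
  assumes "finite \<Omega>" "\<And>v. leaf v \<in> protocols \<Omega> k" "4 * (real n + 1) * L + 1 \<le> 2 ^ j"
  shows "simulate n leaf B v \<in> protocols \<Omega> (k + B * Suc j)"
proof (induction B arbitrary: v)
  case 0
  then show ?case using assms by (simp add: protocols_const)
next
  case (Suc B)
  have "4 * (real (n - length v) + 1) * L + 1 \<le> 4 * (real n + 1) * L + 1"
    using L_ge by (intro add_right_mono mult_right_mono) auto
  with assms(3) have "4 * (real (n - length v) + 1) * L + 1 \<le> 2 ^ j" by linarith
  from chunk_protocol[where g = "simulate n leaf B" and v = v, OF assms(1) Suc this]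
  show ?case by (simp add: algebra_simps)
qed

text \<open>\<open>success x y B v w\<close> is the probability that \<open>B\<close> attempts suffice, given that the walk from \<open>v\<close>
  follows \<open>w\<close>; in \<open>finish \<phi>\<close> the current chunk is completed and \<open>\<phi>\<close> accounts for the rest.\<close>

fun finish :: "(nat list \<Rightarrow> nat list \<Rightarrow> real) \<Rightarrow> 'x \<Rightarrow> 'y \<Rightarrow> nat list \<Rightarrow> real \<Rightarrow> real \<Rightarrow> nat list \<Rightarrow> real" where
  "finish \<phi> x y v s t [] = \<phi> v []"
| "finish \<phi> x y v s t (c # w) = (if s * a x v c > 2 \<or> t * b y v c > 2 then \<phi> (v @ [c]) w
     else finish \<phi> x y (v @ [c]) (s * a x v c) (t * b y v c) w)"

fun success :: "'x \<Rightarrow> 'y \<Rightarrow> nat \<Rightarrow> nat list \<Rightarrow> nat list \<Rightarrow> real" where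
  "success x y 0 v w = (if w = [] then 1 else 0)"
| "success x y (Suc B) v w = 7 / 8 * success x y B v w + 1 / 8 * finish (success x y B) x y v 1 1 w"

definition walk_prob :: "'x \<Rightarrow> 'y \<Rightarrow> nat list \<Rightarrow> nat list \<Rightarrow> real" where
  "walk_prob x y v w = path_prod r v w * path_prod (a x) v w * path_prod (b y) v w"

text \<open>Turns the recursion over chunks into a sum over full words: if after the chunk a
  continuation is weighted by \<open>\<phi>\<close>, then before it the whole word is weighted by
  \<open>finish \<phi>\<close>.\<close>

lemma chunk_finish:
  assumes "\<And>u. length u = length v + d \<Longrightarrow> g u = \<phi> u [] * l u"
    and "\<And>u. length v < length u \<Longrightarrow> length u \<le> length v + d \<Longrightarrow>
      g u = (\<Sum>w\<in>words (length v + d - length u). walk_prob x y u w * \<phi> u w * l (u @ w))"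
  shows "chunk x y d v s t g = (\<Sum>w\<in>words d. walk_prob x y v w * finish \<phi> x y v s t w * l (v @ w))"
  using assms
proof (induction d arbitrary: v s t)
  case 0
  then show ?case by (simp add: words_0 walk_prob_def)
next
  case (Suc d)
  have "(if s * a x v c > 2 \<or> t * b y v c > 2 then g (v @ [c])
      else chunk x y d (v @ [c]) (s * a x v c) (t * b y v c) g)
    = (\<Sum>w\<in>words d. walk_prob x y (v @ [c]) w * finish \<phi> x y v s t (c # w) * l (v @ c # w))" for c
  proof (cases "s * a x v c > 2 \<or> t * b y v c > 2")
    case True
    then show ?thesis using Suc.prems(2)[of "v @ [c]"] by simp
  next
    case False
    have "chunk x y d (v @ [c]) (s * a x v c) (t * b y v c) g =
       (\<Sum>w\<in>words d. walk_prob x y (v @ [c]) w * finish \<phi> x y (v @ [c]) (s * a x v c) (t * b y v c) w * l ((v @ [c]) @ w))"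
      by (rule Suc.IH) (use Suc.prems in auto)
    then show ?thesis using False by simp
  qed
  then show ?case
    by (simp only: chunk.simps sum_words_Suc) (simp add: sum_distrib_left walk_prob_def mult_ac)
qed

lemma success_Nil: "success x y B v [] = 1"
  by (induction B) auto

lemma simulate_expand:
  assumes "length v \<le> n"
  shows "simulate n leaf B v (x, y) =
    (\<Sum>w\<in>words (n - length v). walk_prob x y v w * success x y B v w * leaf (v @ w) (x, y))"
  using assms
proof (induction B arbitrary: v)
  case 0
  show ?case
  proof (cases "length v = n")
    case True
    then show ?thesis by (simp add: words_0 walk_prob_def)
  next
    case False
    then have "success x y 0 v w = 0" if "w \<in> words (n - length v)" for w
      using that 0 by (auto simp: words_def)
    then show ?thesis using False 0 by simp
  qed
next
  case (Suc B)
  have "chunk x y (n - length v) v 1 1 (\<lambda>u. simulate n leaf B u (x, y))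
    = (\<Sum>w\<in>words (n - length v). walk_prob x y v w * finish (success x y B) x y v 1 1 w * leaf (v @ w) (x, y))"
  proof (rule chunk_finish)
    fix u :: "nat list" assume "length u = length v + (n - length v)"
    with Suc show "simulate n leaf B u (x, y) = success x y B u [] * leaf u (x, y)"
      by (simp add: words_0 walk_prob_def)
  next
    fix u :: "nat list" assume "length v < length u" "length u \<le> length v + (n - length v)"
    with Suc show "simulate n leaf B u (x, y) = (\<Sum>w\<in>words (length v + (n - length v) - length u). walk_prob x y u w * success x y B u w * leaf (u @ w) (x, y))"
      by simp
  qed
  then show ?case using Suc.IH[OF Suc.prems]
    by (simp only: simulate.simps success.simps prod.case sum_distrib_left sum.distrib[symmetric])
       (intro sum.cong refl, simp add: algebra_simps)
qed

text \<open>Both ratios restart at \<open>1\<close> after a crossing, as in the simulation. The last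
  chunk, which ends without crossing, is not counted.\<close>

fun crossings :: "'x \<Rightarrow> 'y \<Rightarrow> nat list \<Rightarrow> real \<Rightarrow> real \<Rightarrow> nat list \<Rightarrow> nat" where
  "crossings x y v s t [] = 0"
| "crossings x y v s t (c # w) = (if s * a x v c > 2 \<or> t * b y v c > 2
     then Suc (crossings x y (v @ [c]) 1 1 w)
     else crossings x y (v @ [c]) (s * a x v c) (t * b y v c) w)"

lemma finish_bounds:
  assumes "\<And>v w. 0 \<le> \<phi> v w" "\<And>v w. \<phi> v w \<le> 1"
  shows "0 \<le> finish \<phi> x y v s t w" "finish \<phi> x y v s t w \<le> 1"
  using assms by (induction w arbitrary: v s t) auto

lemma success_bounds: "0 \<le> success x y B v w" "success x y B v w \<le> 1"
proof (induction B arbitrary: v w)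
  case (Suc B)
  { case 1 show ?case using Suc finish_bounds[of "success x y B"] by simp }
  { case 2 show ?case using Suc(2)[of v w] finish_bounds(2)[of "success x y B" x y v 1 1 w, OF Suc] by simp }
qed auto

text \<open>A Chernoff bound: the walk is incomplete only if at most \<open>crossings\<close> of the
  \<open>B\<close> attempts succeed, and \<open>7 / 8 + 1 / (8 * z)\<close> is the mean of
  \<open>z\<close> to the power minus a Bernoulli variable of mean \<open>1 / 8\<close>.\<close>

lemma success_lower:
  fixes z :: real
  assumes z: "z \<ge> 1"
  shows "1 - success x y B v w \<le> z * z ^ crossings x y v 1 1 w * (7 / 8 + 1 / (8 * z)) ^ B"
proof (induction B arbitrary: v w)
  case 0
  have "1 \<le> z * z ^ crossings x y v 1 1 w" using z by (simp add: one_le_power flip: power_Suc)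
  then show ?case by auto
next
  case (Suc B)
  let ?q = "7 / 8 + 1 / (8 * z)"
  have fin: "1 - finish (success x y B) x y v s t w \<le> z ^ crossings x y v s t w * ?q ^ B" for s t
  proof (induction w arbitrary: v s t)
    case Nil
    then show ?case using z by (simp add: success_Nil)
  next
    case (Cons c w)
    then show ?case using Suc[of "v @ [c]" w] by simp
  qed
  have "1 - success x y (Suc B) v w = 7 / 8 * (1 - success x y B v w) + 1 / 8 * (1 - finish (success x y B) x y v 1 1 w)"
    by (simp add: algebra_simps diff_divide_distrib)
  also have "\<dots> \<le> 7 / 8 * (z * z ^ crossings x y v 1 1 w * ?q ^ B) + 1 / 8 * (z ^ crossings x y v 1 1 w * ?q ^ B)"
    by (intro add_mono mult_left_mono Suc fin) auto
  also have "\<dots> = z * z ^ crossings x y v 1 1 w * ?q ^ Suc B"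
    using z by (simp add: field_simps)
  finally show ?case .
qed

text \<open>The Hellinger affinity of the walk and of its prior stays at most \<open>1\<close> even if every crossing
  is rewarded with a factor \<open>21/20\<close>.\<close>

lemma affinity_crossings:
  assumes "s > 0" "t > 0"
  shows "(\<Sum>w\<in>words d. path_prod r v w * sqrt (path_prod (a x) v w * path_prod (b y) v w) * (21 / 20) ^ crossings x y v s t w)
    \<le> psi s * psi t"
  using assms
proof (induction d arbitrary: v s t)
  case 0
  have "1 * 1 \<le> psi s * psi t" using psi_ge_1 0 by (intro mult_mono) (auto intro: less_imp_le psi_pos)
  then show ?case by (simp add: words_0)
next
  case (Suc d)
  let ?F = "\<lambda>v s t w. path_prod r v w * sqrt (path_prod (a x) v w * path_prod (b y) v w) * (21 / 20) ^ crossings x y v s t w"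
  have *: "(\<Sum>w\<in>words d. ?F v s t (c # w)) \<le> r v c * (sqrt (a x v c * b y v c) * (psi (s * a x v c) * psi (t * b y v c)))" for c
  proof (cases "a x v c = 0 \<or> b y v c = 0")
    case True
    then show ?thesis by auto
  next
    case False
    then have pos: "a x v c > 0" "b y v c > 0" using a_nonneg[of x v c] b_nonneg[of y v c] by auto
    then have pos': "s * a x v c > 0" "t * b y v c > 0" using Suc.prems by auto
    have ge: "1 \<le> psi (s * a x v c)" "1 \<le> psi (t * b y v c)" using pos' psi_ge_1 by auto
    show ?thesis
    proof (cases "s * a x v c > 2 \<or> t * b y v c > 2")
      case True
      have "(\<Sum>w\<in>words d. ?F v s t (c # w)) = r v c * sqrt (a x v c * b y v c) * (21 / 20) * (\<Sum>w\<in>words d. ?F (v @ [c]) 1 1 w)"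
        using True by (simp add: sum_distrib_left real_sqrt_mult mult_ac)
      also have "\<dots> \<le> r v c * sqrt (a x v c * b y v c) * (21 / 20) * (psi 1 * psi 1)"
        using pos r_nonneg by (intro mult_left_mono Suc.IH) auto
      also have "\<dots> = r v c * (sqrt (a x v c * b y v c) * (21 / 20))" by (simp add: psi_1)
      also have "\<dots> \<le> r v c * (sqrt (a x v c * b y v c) * (psi (s * a x v c) * psi (t * b y v c)))"
      proof (intro mult_left_mono r_nonneg)
        \<comment> \<open>The potential pays for the reward: it exceeds \<open>21 / 20\<close> at
          the crossing and is reset to \<open>psi 1 * psi 1 = 1\<close>.\<close>
        show "21 / 20 \<le> psi (s * a x v c) * psi (t * b y v c)"
        proof (cases "s * a x v c > 2")
          case True
          have "21 / 20 * 1 \<le> psi (s * a x v c) * psi (t * b y v c)"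
            using ge psi_ge[OF True] by (intro mult_mono) auto
          then show ?thesis by simp
        next
          case False
          have "1 * (21 / 20) \<le> psi (s * a x v c) * psi (t * b y v c)"
            using ge psi_ge[of "t * b y v c"] True False by (intro mult_mono) auto
          then show ?thesis by simp
        qed
      qed (use pos in auto)
      finally show ?thesis .
    next
      case False
      have "(\<Sum>w\<in>words d. ?F v s t (c # w)) = r v c * sqrt (a x v c * b y v c) * (\<Sum>w\<in>words d. ?F (v @ [c]) (s * a x v c) (t * b y v c) w)"
        using False by (simp add: sum_distrib_left real_sqrt_mult mult_ac)
      also have "\<dots> \<le> r v c * sqrt (a x v c * b y v c) * (psi (s * a x v c) * psi (t * b y v c))"
        using pos r_nonneg pos' by (intro mult_left_mono Suc.IH) auto
      finally show ?thesis by (simp add: mult.assoc)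
    qed
  qed
  have step: "(\<Sum>c\<in>{0,1}. r v c * (sqrt (f c) * psi (u * f c))) \<le> psi u"
    if "\<And>c. 0 \<le> f c" "u > 0" "r v 0 * f 0 + r v 1 * f 1 \<le> 1" for f u
  proof -
    have "(\<Sum>c\<in>{0,1}. r v c * (sqrt (f c) * psi (u * f c))) \<le> (\<Sum>c\<in>{0,1}. r v c * ((f c * sqrt u + 1 / sqrt u) / 2))"
    proof (intro sum_mono mult_left_mono r_nonneg)
      fix c
      show "sqrt (f c) * psi (u * f c) \<le> (f c * sqrt u + 1 / sqrt u) / 2"
        using that sqrt_psi_mult[of "f c" u] by (cases "f c = 0") auto
    qed
    also have "\<dots> = ((r v 0 * f 0 + r v 1 * f 1) * sqrt u + (r v 0 + r v 1) * (1 / sqrt u)) / 2"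
      by (simp add: algebra_simps add_divide_distrib)
    also have "\<dots> \<le> (1 * sqrt u + 1 * (1 / sqrt u)) / 2"
      using that r_sum[of v] by (intro divide_right_mono add_mono mult_right_mono) auto
    finally show ?thesis by (simp add: psi_def)
  qed
  have "(\<Sum>w\<in>words (Suc d). ?F v s t w) = (\<Sum>c\<in>{0, 1}. \<Sum>w\<in>words d. ?F v s t (c # w))"
    by (rule sum_words_Suc)
  also have "\<dots> \<le> (\<Sum>c\<in>{0, 1}. r v c * (sqrt (a x v c * b y v c) * (psi (s * a x v c) * psi (t * b y v c))))"
    by (intro sum_mono *)
  also have "\<dots> \<le> psi s * psi t"
  proof (cases "even (length v)")
    case True
    have "(\<Sum>c\<in>{0, 1}. r v c * (sqrt (a x v c * b y v c) * (psi (s * a x v c) * psi (t * b y v c))))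
      = psi s * (\<Sum>c\<in>{0, 1}. r v c * (sqrt (b y v c) * psi (t * b y v c)))"
      using True by (simp add: a_idle sum_distrib_left algebra_simps)
    also have "\<dots> \<le> psi s * psi t"
      using psi_pos[of s] Suc.prems b_sum_le[of v y] b_nonneg by (intro mult_left_mono step) auto
    finally show ?thesis .
  next
    case False
    have "(\<Sum>c\<in>{0, 1}. r v c * (sqrt (a x v c * b y v c) * (psi (s * a x v c) * psi (t * b y v c))))
      = psi t * (\<Sum>c\<in>{0, 1}. r v c * (sqrt (a x v c) * psi (s * a x v c)))"
      using False by (simp add: b_idle sum_distrib_left algebra_simps)
    also have "\<dots> \<le> psi t * psi s"
      using psi_pos[of t] Suc.prems a_sum_le[of v x] a_nonneg by (intro mult_left_mono step) auto
    finally show ?thesis by (simp add: mult.commute)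
  qed
  finally show ?case .
qed

lemma walk_prob_nonneg: "0 \<le> walk_prob x y v w"
  unfolding walk_prob_def by (intro mult_nonneg_nonneg path_prod_nonneg r_nonneg a_nonneg b_nonneg)

end

section \<open>Consequences of a bounded cost\<close>

text \<open>In the application \<open>i\<close> ranges over triples \<open>(x, y, m)\<close>, \<open>u\<close> is \<open>q(xy|m) / p(xy)\<close> and
  \<open>\<beta>\<close> is the absolute bias given \<open>m\<close>. Averaging the logarithm of the cost over \<open>q\<close> leaves three
  relative entropies, which are nonnegative.\<close>

locale bounded_cost =
  fixes S :: "'i set" and p q u \<beta> :: "'i \<Rightarrow> real" and I l :: real
  assumes fin: "finite S" and q_pos: "\<And>i. i \<in> S \<Longrightarrow> 0 < q i" and p_pos: "\<And>i. i \<in> S \<Longrightarrow> 0 < p i"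
    and u_pos: "\<And>i. i \<in> S \<Longrightarrow> 0 < u i" and \<beta>_pos: "\<And>i. i \<in> S \<Longrightarrow> 0 < \<beta> i" and \<beta>_le: "\<And>i. i \<in> S \<Longrightarrow> \<beta> i \<le> 1"
    and q_sum: "sum q S = 1" and p_sum: "sum p S \<le> 1" and u_sum: "(\<Sum>i\<in>S. q i / u i) \<le> 1"
    and I_ge: "1 \<le> I"
    and cost: "\<And>i. i \<in> S \<Longrightarrow> u i * (q i / p i) powr I * \<beta> i powr (- 180 * I) \<le> exp (l * I)"
begin

lemma ln_cost: "i \<in> S \<Longrightarrow> ln (u i) + I * ln (q i / p i) + 180 * I * - ln (\<beta> i) \<le> l * I"
proof -
  assume i: "i \<in> S"
  then have "ln (u i * (q i / p i) powr I * \<beta> i powr (- 180 * I)) \<le> ln (exp (l * I))"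
    using cost[OF i] q_pos[OF i] p_pos[OF i] u_pos[OF i] \<beta>_pos[OF i]
    by (subst ln_le_cancel_iff) (auto intro!: mult_pos_pos)
  also have "ln (u i * (q i / p i) powr I * \<beta> i powr (- 180 * I)) = ln (u i) + I * ln (q i / p i) + 180 * I * - ln (\<beta> i)"
    using i q_pos[OF i] p_pos[OF i] u_pos[OF i] \<beta>_pos[OF i] by (simp add: ln_mult ln_powr)
  finally show ?thesis by simp
qed

lemma ln_ge: "t > 0 \<Longrightarrow> 1 - 1 / t \<le> ln (t :: real)"
  using ln_le_minus_one[of "1 / t"] by (simp add: ln_div)

lemma divergence_point: "i \<in> S \<Longrightarrow> q i - p i \<le> q i * ln (q i / p i)"
proof -
  assume i: "i \<in> S"
  have "q i * (1 - 1 / (q i / p i)) \<le> q i * ln (q i / p i)"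
    using q_pos[OF i] p_pos[OF i] by (intro mult_left_mono ln_ge) auto
  moreover have "q i * (1 - 1 / (q i / p i)) = q i - p i" using q_pos[OF i] by (simp add: right_diff_distrib)
  ultimately show ?thesis by simp
qed

lemma entropies:
  shows "(\<Sum>i\<in>S. q i * ln (q i / p i)) \<le> l" and "(\<Sum>i\<in>S. q i * - ln (\<beta> i)) \<le> l"
proof -
  let ?D = "\<Sum>i\<in>S. q i * ln (q i / p i)" and ?E = "\<Sum>i\<in>S. q i * - ln (\<beta> i)"
  have "(\<Sum>i\<in>S. q i * (1 - 1 / u i)) \<le> (\<Sum>i\<in>S. q i * ln (u i))"
    by (intro sum_mono mult_left_mono ln_ge u_pos less_imp_le[OF q_pos])
  then have U: "0 \<le> (\<Sum>i\<in>S. q i * ln (u i))"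
    using q_sum u_sum by (simp add: right_diff_distrib sum_subtractf)
  have "(\<Sum>i\<in>S. q i - p i) \<le> ?D" by (intro sum_mono divergence_point)
  then have D: "0 \<le> ?D" using q_sum p_sum by (simp add: sum_subtractf)
  have E: "0 \<le> ?E"
    using q_pos \<beta>_pos \<beta>_le by (intro sum_nonneg mult_nonneg_nonneg) (auto intro: less_imp_le)
  have "(\<Sum>i\<in>S. q i * (ln (u i) + I * ln (q i / p i) + 180 * I * - ln (\<beta> i))) \<le> (\<Sum>i\<in>S. q i * (l * I))"
    by (intro sum_mono mult_left_mono ln_cost less_imp_le[OF q_pos])
  also have "\<dots> = l * I" using q_sum by (simp add: sum_distrib_right[symmetric])
  also have "(\<Sum>i\<in>S. q i * (ln (u i) + I * ln (q i / p i) + 180 * I * - ln (\<beta> i)))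
     = (\<Sum>i\<in>S. q i * ln (u i)) + I * ?D + 180 * I * ?E"
    unfolding sum_distrib_left sum.distrib[symmetric] by (intro sum.cong refl) (simp add: algebra_simps)
  finally have *: "I * ?D + 180 * I * ?E \<le> l * I" using U by simp
  have "0 \<le> 180 * I * ?E" "0 \<le> I * ?D" "I * ?E \<le> 180 * I * ?E" using I_ge E D by (auto intro: mult_right_mono)
  with * have "I * ?D \<le> I * l" "I * ?E \<le> I * l" by (simp_all only: mult.commute[of l I])
  then show "?D \<le> l" "?E \<le> l" using I_ge by auto
qed

lemma l_nonneg: "0 \<le> l"
proof -
  have "(\<Sum>i\<in>S. q i - p i) \<le> (\<Sum>i\<in>S. q i * ln (q i / p i))" by (intro sum_mono divergence_point)
  then show ?thesis using q_sum p_sum entropies(1) by (simp add: sum_subtractf)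
qed

text \<open>Jensen's inequality for \<open>exp\<close>, by way of its tangent at
  \<open>- l\<close>.\<close>

lemma mean_bias: "exp (- l) \<le> (\<Sum>i\<in>S. q i * \<beta> i)"
proof -
  have "exp (- l) * (1 + (l + ln (\<beta> i))) \<le> \<beta> i" if "i \<in> S" for i
  proof -
    have "exp (- l) * (1 + (l + ln (\<beta> i))) \<le> exp (- l) * exp (l + ln (\<beta> i))"
      by (intro mult_left_mono exp_ge_add_one_self) auto
    then show ?thesis using \<beta>_pos[OF that] by (simp add: exp_add[symmetric])
  qed
  then have "(\<Sum>i\<in>S. q i * (exp (- l) * (1 + (l + ln (\<beta> i))))) \<le> (\<Sum>i\<in>S. q i * \<beta> i)"
    by (intro sum_mono mult_left_mono less_imp_le[OF q_pos])
  moreover have "(\<Sum>i\<in>S. q i * (exp (- l) * (1 + (l + ln (\<beta> i)))))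
    = exp (- l) * ((1 + l) * sum q S - (\<Sum>i\<in>S. q i * - ln (\<beta> i)))"
    unfolding sum_distrib_left sum_subtractf[symmetric] by (intro sum.cong refl) (simp add: algebra_simps)
  moreover have "exp (- l) * 1 \<le> exp (- l) * ((1 + l) * sum q S - (\<Sum>i\<in>S. q i * - ln (\<beta> i)))"
    using entropies(2) q_sum by (intro mult_left_mono) auto
  ultimately show ?thesis by (simp only: mult_1_right)
qed

text \<open>Markov's inequality for the log-likelihood. Adding \<open>p i\<close> makes the terms
  nonnegative: by \<open>divergence_point\<close>, \<open>q i * ln (q i / p i) + p i\<close> is at
  least \<open>q i\<close>.\<close>

lemma large_ratio:
  assumes "1 < R"
  shows "(\<Sum>i | i \<in> S \<and> q i > R * p i. q i) \<le> (l + 1) / ln R"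
proof -
  have "ln R * (\<Sum>i | i \<in> S \<and> q i > R * p i. q i) = (\<Sum>i\<in>S. if q i > R * p i then ln R * q i else 0)"
    using fin by (simp add: sum.inter_filter sum_distrib_left if_distrib cong: if_cong)
  also have "\<dots> \<le> (\<Sum>i\<in>S. q i * ln (q i / p i) + p i)"
  proof (intro sum_mono)
    fix i assume i: "i \<in> S"
    show "(if q i > R * p i then ln R * q i else 0) \<le> q i * ln (q i / p i) + p i"
    proof (cases "q i > R * p i")
      case True
      then have "R \<le> q i / p i" using p_pos[OF i] by (simp add: field_simps)
      then have "ln R \<le> ln (q i / p i)" using assms by (subst ln_le_cancel_iff) auto
      then have "ln R * q i \<le> q i * ln (q i / p i)" using q_pos[OF i] by (simp add: mult.commute)
      then show ?thesis using True p_pos[OF i] by simp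
    next
      case False
      then show ?thesis using divergence_point[OF i] q_pos[OF i] by simp
    qed
  qed
  also have "\<dots> \<le> l + 1" using entropies(1) p_sum by (simp add: sum.distrib)
  finally show ?thesis using assms by (simp add: field_simps)
qed

lemma small_ratio:
  assumes "0 < R"
  shows "(\<Sum>i | i \<in> S \<and> R * q i < p i. q i) \<le> 1 / R"
proof -
  have "(\<Sum>i | i \<in> S \<and> R * q i < p i. q i) \<le> (\<Sum>i | i \<in> S \<and> R * q i < p i. p i / R)"
    using assms by (intro sum_mono) (auto simp: field_simps)
  also have "\<dots> \<le> (\<Sum>i\<in>S. p i / R)"
    using fin assms p_pos by (intro sum_mono2) (auto intro: less_imp_le)
  also have "\<dots> \<le> 1 / R" using assms p_sum by (simp add: sum_divide_distrib[symmetric] divide_right_mono)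
  finally show ?thesis .
qed

text \<open>Where the density of \<open>q\<close> is at most \<open>R\<close>, Markov's inequality
  under \<open>p\<close> carries over to \<open>q\<close> with a loss of \<open>R\<close>.\<close>

lemma transfer_markov:
  assumes V: "\<And>i. i \<in> S \<Longrightarrow> 0 \<le> V i" "(\<Sum>i\<in>S. p i * V i) \<le> 2" and "0 < e" "0 < R"
  shows "(\<Sum>i | i \<in> S \<and> q i \<le> R * p i \<and> V i > 1 / e. q i) \<le> 2 * e * R"
proof -
  have "(\<Sum>i | i \<in> S \<and> q i \<le> R * p i \<and> V i > 1 / e. q i) \<le> (\<Sum>i | i \<in> S \<and> q i \<le> R * p i \<and> V i > 1 / e. R * e * (p i * V i))"
  proof (intro sum_mono, clarify)
    fix i assume i: "i \<in> S" "q i \<le> R * p i" "V i > 1 / e"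
    then have "1 \<le> e * V i" using assms by (simp add: field_simps)
    then have "R * p i * 1 \<le> R * p i * (e * V i)"
      using p_pos[OF i(1)] assms by (intro mult_left_mono) auto
    then show "q i \<le> R * e * (p i * V i)" using i by (simp add: mult_ac)
  qed
  also have "\<dots> \<le> (\<Sum>i\<in>S. R * e * (p i * V i))"
    using fin assms p_pos by (intro sum_mono2) (auto intro!: mult_nonneg_nonneg less_imp_le[OF p_pos])
  also have "\<dots> = R * e * (\<Sum>i\<in>S. p i * V i)" by (simp add: sum_distrib_left)
  also have "\<dots> \<le> R * e * 2" using assms by (intro mult_left_mono V) auto
  finally show ?thesis by (simp add: mult_ac)
qed

text \<open>Chosen so that the bound \<open>(l + 1) / ln R\<close> of \<open>large_ratio\<close>
  becomes \<open>exp (- l) / 8\<close>.\<close>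

definition ratio_bound :: real where
  "ratio_bound = exp (8 * (l + 1) / exp (- l))"

text \<open>Each of the three conditions fails with \<open>q\<close>-probability at most
  \<open>exp (- l) / 8\<close>.\<close>

lemma typical_set:
  assumes V: "\<And>i. i \<in> S \<Longrightarrow> 0 \<le> V i" "(\<Sum>i\<in>S. p i * V i) \<le> 2"
  defines "G \<equiv> {i \<in> S. q i \<le> ratio_bound * p i \<and> p i \<le> 8 / exp (- l) * q i \<and> V i \<le> 16 * ratio_bound / exp (- l)}"
  shows "(\<Sum>i\<in>S - G. q i) \<le> 3 / 8 * exp (- l)"
proof -
  let ?b = "exp (- l)"
  define R where "R = ratio_bound"
  have R: "1 < R" using l_nonneg by (simp add: R_def ratio_bound_def)
  let ?A = "{i \<in> S. q i > R * p i}" and ?B = "{i \<in> S. 8 / ?b * q i < p i}"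
  let ?C = "{i \<in> S. q i \<le> R * p i \<and> V i > 1 / (?b / (16 * R))}"
  have sub: "S - G \<subseteq> ?A \<union> (?B \<union> ?C)" by (auto simp: G_def R_def[symmetric] not_le)
  have qn: "0 \<le> q i" if "i \<in> S" for i using q_pos[OF that] by simp
  have un: "sum q (A \<union> B) \<le> sum q A + sum q B" if "A \<subseteq> S" "B \<subseteq> S" for A B
  proof -
    have "finite A" "finite B" using that fin finite_subset by auto
    then have "sum q (A \<union> B) + sum q (A \<inter> B) = sum q A + sum q B" by (rule sum.union_inter)
    moreover have "0 \<le> sum q (A \<inter> B)" using that qn by (intro sum_nonneg) auto
    ultimately show ?thesis by simp
  qed
  have "(\<Sum>i\<in>S - G. q i) \<le> (\<Sum>i\<in>?A \<union> (?B \<union> ?C). q i)"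
    using fin sub qn by (intro sum_mono2) auto
  also have "\<dots> \<le> (\<Sum>i\<in>?A. q i) + (\<Sum>i\<in>?B \<union> ?C. q i)"
    using fin by (intro un) auto
  also have "(\<Sum>i\<in>?B \<union> ?C. q i) \<le> (\<Sum>i\<in>?B. q i) + (\<Sum>i\<in>?C. q i)"
    using fin by (intro un) auto
  also have "(\<Sum>i\<in>?A. q i) \<le> (l + 1) / ln R" using large_ratio[OF R] .
  also have "\<dots> = ?b / 8"
  proof -
    have "ln R = 8 * (l + 1) / ?b" by (simp add: R_def ratio_bound_def)
    moreover have "k / (8 * k / b) = b / 8" if "k \<noteq> 0" for k b :: real using that by simp
    moreover have "l + 1 \<noteq> 0" using l_nonneg by simp
    ultimately show ?thesis by (simp only: not_False_eq_True)
  qed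
  also have "(\<Sum>i\<in>?B. q i) \<le> 1 / (8 / ?b)" by (rule small_ratio) simp
  also have "(\<Sum>i\<in>?C. q i) \<le> 2 * (?b / (16 * R)) * R"
    using R by (intro transfer_markov V) auto
  finally show ?thesis using R by (simp add: field_simps)
qed

end

section \<open>Near-optimal rectangular distributions\<close>

lemma path_prod_eq_prod: "path_prod f v w = (\<Prod>i<length w. f (v @ take i w) (w ! i))"
proof (induction w arbitrary: v)
  case (Cons c w)
  show ?case by (simp only: length_Cons prod.lessThan_Suc_shift) (simp add: Cons)
qed simp

lemma cond_prob_eq_pmf:
  fixes p :: "('x, 'y) joint"
  assumes "(x, y, m) \<in> set_pmf p" "P (x, y, m)"
  shows "cond_prob (measure_pmf p) (\<lambda>(x', y', m'). m' ! i = c) P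
    = pmf (map_pmf (\<lambda>(x', y', m'). m' ! i) (cond_pmf p {w. P w})) c"
proof -
  have ne: "set_pmf p \<inter> {w. P w} \<noteq> {}" using assms by blast
  have "pmf (map_pmf (\<lambda>(x', y', m'). m' ! i) (cond_pmf p {w. P w})) c
      = measure (cond_pmf p {w. P w}) {w. (case w of (x', y', m') \<Rightarrow> m' ! i) = c}"
    by (simp add: pmf_map vimage_def)
  also have "\<dots> = measure p ({w. P w} \<inter> {w. (case w of (x', y', m') \<Rightarrow> m' ! i) = c}) / measure p {w. P w}"
    by (simp add: cond_pmf.rep_eq[OF ne] measure_uniform_measure measure_pmf.emeasure_eq_measure measure_measure_pmf_not_zero[OF ne])
  also have "\<dots> = cond_prob (measure_pmf p) (\<lambda>(x', y', m'). m' ! i = c) P"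
    unfolding cond_prob_def by (intro arg_cong2[where f = "(/)"] arg_cong[where f = "measure p"]) auto
  finally show ?thesis by simp
qed

lemma cond_prob_null:
  assumes "\<not> (\<exists>w\<in>set_pmf p. P w)"
  shows "cond_prob (measure_pmf p) Q P = 0"
proof -
  have "measure p {w. P w} = 0" using assms by (subst measure_pmf_zero_iff) auto
  then show ?thesis by (simp add: cond_prob_def)
qed

lemma sum_pmf_le_1: "finite A \<Longrightarrow> (\<Sum>x\<in>A. pmf p x) \<le> 1"
  by (simp add: measure_measure_pmf_finite[symmetric])

locale near_optimal =
  fixes X :: "'x set" and Y :: "'y set" and M :: "nat set" and C :: nat
    and p q :: "('x, 'y) joint" and f :: "'x \<Rightarrow> 'y \<Rightarrow> bool" and I l :: real
  assumes X: "finite X" and Y: "finite Y" and M: "finite M" and C: "2 \<le> C"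
    and prot: "protocol_distribution X Y M C p"
    and bits: "\<forall>(x, y, m)\<in>set_pmf p. \<forall>i\<in>{2..C}. m ! i \<in> {0, 1}"
    and I_ge_1: "1 \<le> I"
    and rect: "rectangular (inputs p) q"
    and ext: "\<forall>w\<in>set_pmf q. ext_cost I p f q w \<le> ereal (l * I / ln 2)"
begin

section \<open>Supports, posteriors and the bias of \<open>q\<close>\<close>

abbreviation \<mu> where "\<mu> \<equiv> inputs p"

lemma supp_p: "set_pmf p \<subseteq> X \<times> Y \<times> {m. set m \<subseteq> M \<and> length m = C + 1}"
  using prot by (auto simp: protocol_distribution_def)

lemma finite_p: "finite (set_pmf p)"
  by (rule finite_subset[OF supp_p]) (intro finite_cartesian_product X Y finite_lists_length_eq M)

lemma supp_q: "set_pmf q \<subseteq> set_pmf p"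
proof clarify
  fix x y m assume "(x, y, m) \<in> set_pmf q"
  then have "ext_cost I p f q (x, y, m) \<noteq> \<infinity>" using ext by fastforce
  then show "(x, y, m) \<in> set_pmf p" by (auto simp: ext_cost_def set_pmf_iff split: if_splits)
qed

lemma bias_nonzero: "(x, y, m) \<in> set_pmf q \<Longrightarrow> bias q f m \<noteq> 0"
proof -
  assume "(x, y, m) \<in> set_pmf q"
  then have "ext_cost I p f q (x, y, m) \<noteq> \<infinity>" using ext by fastforce
  then show ?thesis by (auto simp: ext_cost_def split: if_splits)
qed

lemma finite_q: "finite (set_pmf q)"
  using finite_subset[OF supp_q finite_p] .

lemma supp_inputs: "set_pmf \<mu> \<subseteq> X \<times> Y"
  using supp_p by (auto simp: inputs_def)

lemma inputs_pos: "(x, y, m) \<in> set_pmf p \<Longrightarrow> 0 < pmf \<mu> (x, y)"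
  by (subst pmf_positive_iff) (force simp: inputs_def)

lemma p_length: "(x, y, m) \<in> set_pmf p \<Longrightarrow> length m = C + 1"
  using supp_p by auto

lemma p_bits: "(x, y, m) \<in> set_pmf p \<Longrightarrow> drop 2 m \<in> words (C - 1)"
proof -
  assume w: "(x, y, m) \<in> set_pmf p"
  then have len: "length m = C + 1" by (rule p_length)
  have "m ! (i + 2) \<in> {0, 1}" if "i < C - 1" for i
  proof -
    have "i + 2 \<in> {2..C}" using that by auto
    then show ?thesis using bits w by blast
  qed
  then have "drop 2 m ! i \<in> {0, 1}" if "i < length (drop 2 m)" for i
    using that len by (simp add: add.commute)
  then have "set (drop 2 m) \<subseteq> {0, 1}" by (metis in_set_conv_nth subsetI)
  then show ?thesis using len by (simp add: words_def)
qed

definition q_messages :: "nat list pmf" where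
  "q_messages = map_pmf (\<lambda>(x, y, m). m) q"

lemma q_messages_pos: "(x, y, m) \<in> set_pmf q \<Longrightarrow> 0 < pmf q_messages m"
  by (subst pmf_positive_iff) (force simp: q_messages_def)

lemma measure_q_message: "measure q {(x', y', m'). m' = m} = pmf q_messages m"
  unfolding q_messages_def pmf_map by (intro arg_cong[where f = "measure q"]) auto

lemma cond_q_pmf:
  assumes "(x, y, m) \<in> set_pmf q"
  shows "pmf (cond_pmf q {(x', y', m'). m' = m}) w = (if snd (snd w) = m then pmf q w / pmf q_messages m else 0)"
proof -
  have "set_pmf q \<inter> {(x', y', m'). m' = m} \<noteq> {}" using assms by blast
  then show ?thesis by (auto simp: pmf_cond measure_q_message)
qed

lemma pmf_posterior:
  assumes "(x, y, m) \<in> set_pmf q"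
  shows "pmf (posterior q m) (x, y) = pmf q (x, y, m) / pmf q_messages m"
proof -
  have ne: "set_pmf q \<inter> {(x', y', m'). m' = m} \<noteq> {}" using assms by blast
  have "pmf (posterior q m) (x, y) = measure (cond_pmf q {(x', y', m'). m' = m}) ((\<lambda>(x, y, m). (x, y)) -` {(x, y)})"
    by (simp add: posterior_def inputs_def pmf_map)
  also have "\<dots> = measure (cond_pmf q {(x', y', m'). m' = m}) {(x, y, m)}"
    by (rule measure_prob_cong_0) (auto simp: set_cond_pmf[OF ne] pmf_eq_0_set_pmf)
  also have "\<dots> = pmf q (x, y, m) / pmf q_messages m"
    by (simp add: measure_pmf_single cond_q_pmf[OF assms])
  finally show ?thesis .
qed

lemma bias_eq:
  assumes "(x, y, m) \<in> set_pmf q"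
  shows "pmf q_messages m * bias q f m = (\<Sum>(x, y, m') | (x, y, m') \<in> set_pmf q \<and> m' = m. pmf q (x, y, m') * (- 1) ^ of_bool (f x y))"
proof -
  have ne: "set_pmf q \<inter> {(x', y', m'). m' = m} \<noteq> {}" using assms by blast
  have fin: "finite {(x, y, m'). (x, y, m') \<in> set_pmf q \<and> m' = m}"
    by (rule finite_subset[OF _ finite_q]) auto
  have "bias q f m = measure_pmf.expectation (cond_pmf q {(x', y', m'). m' = m}) (\<lambda>(x, y, m). (- 1) ^ of_bool (f x y))"
    by (simp add: bias_def posterior_def inputs_def case_prod_unfold)
  also have "\<dots> = (\<Sum>w\<in>{(x, y, m'). (x, y, m') \<in> set_pmf q \<and> m' = m}. (case w of (x, y, m) \<Rightarrow> (- 1) ^ of_bool (f x y)) * pmf (cond_pmf q {(x', y', m'). m' = m}) w)"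
    by (rule integral_measure_pmf_real[OF fin]) (auto simp: set_cond_pmf[OF ne])
  also have "\<dots> = (\<Sum>(x, y, m') | (x, y, m') \<in> set_pmf q \<and> m' = m. pmf q (x, y, m') * (- 1) ^ of_bool (f x y) / pmf q_messages m)"
    by (intro sum.cong) (auto simp: cond_q_pmf[OF assms])
  finally show ?thesis using q_messages_pos[OF assms]
    by (simp add: sum_distrib_left case_prod_unfold)
qed

lemma bias_le_1: "\<bar>bias q f m\<bar> \<le> 1"
proof -
  have "\<bar>bias q f m\<bar> \<le> measure_pmf.expectation (posterior q m) (\<lambda>(x, y). \<bar>(- 1) ^ of_bool (f x y)\<bar>)"
    unfolding bias_def case_prod_unfold by (rule integral_abs_bound)
  then show ?thesis by (simp add: case_prod_unfold power_abs)
qed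

text \<open>Tower rule: conditioning on the message replaces the sign of \<open>f\<close> by the
  bias.\<close>

lemma sum_sign_bias:
  "(\<Sum>(x, y, m)\<in>set_pmf q. pmf q (x, y, m) * (- 1) ^ of_bool (f x y) * h m)
    = (\<Sum>(x, y, m)\<in>set_pmf q. pmf q (x, y, m) * (bias q f m * h m))"
proof -
  let ?Q = "set_pmf q" and ?m = "\<lambda>(x, y, m). m"
  have grp: "(\<Sum>w\<in>?Q. g w) = (\<Sum>m\<in>?m ` ?Q. \<Sum>w | w \<in> ?Q \<and> ?m w = m. g w)" for g :: "'x \<times> 'y \<times> nat list \<Rightarrow> real"
    using sum.group[OF finite_q finite_imageI[OF finite_q], of ?m ?m g] by simp
  have set_eq: "{w \<in> ?Q. ?m w = m} = {(x, y, m'). (x, y, m') \<in> ?Q \<and> m' = m}" for m by auto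
  have 1: "(\<Sum>w | w \<in> ?Q \<and> ?m w = m. case w of (x, y, m) \<Rightarrow> pmf q (x, y, m) * (- 1) ^ of_bool (f x y) * h m)
     = (\<Sum>w | w \<in> ?Q \<and> ?m w = m. case w of (x, y, m) \<Rightarrow> pmf q (x, y, m) * (bias q f m * h m))" if m: "m \<in> ?m ` ?Q" for m
  proof -
    obtain x y where xy: "(x, y, m) \<in> ?Q" using m by auto
    have "(\<Sum>w | w \<in> ?Q \<and> ?m w = m. case w of (x, y, m) \<Rightarrow> pmf q (x, y, m) * (- 1) ^ of_bool (f x y) * h m)
      = (\<Sum>w | w \<in> ?Q \<and> ?m w = m. case w of (x, y, m) \<Rightarrow> pmf q (x, y, m) * (- 1) ^ of_bool (f x y)) * h m"
      unfolding sum_distrib_right by (intro sum.cong) auto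
    also have "\<dots> = pmf q_messages m * (bias q f m * h m)"
      using bias_eq[OF xy] by (simp add: set_eq)
    also have "pmf q_messages m = (\<Sum>w | w \<in> ?Q \<and> ?m w = m. pmf q w)"
    proof -
      have "pmf q_messages m = measure q {w \<in> ?Q. ?m w = m}"
        unfolding q_messages_def pmf_map by (rule measure_prob_cong_0) (auto simp: set_pmf_iff)
      also have "\<dots> = (\<Sum>w | w \<in> ?Q \<and> ?m w = m. pmf q w)"
        using finite_q by (intro measure_measure_pmf_finite) auto
      finally show ?thesis .
    qed
    also have "(\<Sum>w | w \<in> ?Q \<and> ?m w = m. pmf q w) * (bias q f m * h m)
      = (\<Sum>w | w \<in> ?Q \<and> ?m w = m. case w of (x, y, m) \<Rightarrow> pmf q (x, y, m) * (bias q f m * h m))"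
      unfolding sum_distrib_right by (intro sum.cong) auto
    finally show ?thesis .
  qed
  show ?thesis unfolding grp by (intro sum.cong refl 1)
qed

text \<open>By \<open>gain_eq\<close> this is the density of \<open>q\<close> with respect to the
  product of \<open>\<mu>\<close> and the message marginal of \<open>q\<close>, so its reciprocal
  has \<open>q\<close>-mean at most \<open>1\<close>.\<close>

definition gain :: "'x \<times> 'y \<times> nat list \<Rightarrow> real" where
  "gain = (\<lambda>(x, y, m). pmf (posterior q m) (x, y) / pmf \<mu> (x, y))"

lemma gain_eq: "(x, y, m) \<in> set_pmf q \<Longrightarrow> gain (x, y, m) = pmf q (x, y, m) / (pmf q_messages m * pmf \<mu> (x, y))"
  by (simp add: gain_def pmf_posterior)

sublocale bounded_cost "set_pmf q" "pmf p" "pmf q" gain "\<lambda>(x, y, m). \<bar>bias q f m\<bar>" I l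
proof
  show "finite (set_pmf q)" by (rule finite_q)
  show "0 < pmf q i" if "i \<in> set_pmf q" for i using that by (simp add: pmf_positive)
  show "0 < pmf p i" if "i \<in> set_pmf q" for i using that supp_q by (auto intro: pmf_positive)
  show gain: "0 < gain i" if "i \<in> set_pmf q" for i
  proof -
    obtain x y m where i: "i = (x, y, m)" by (cases i)
    show ?thesis using that supp_q unfolding i
      by (auto simp: gain_eq intro!: divide_pos_pos mult_pos_pos pmf_positive q_messages_pos inputs_pos)
  qed
  show "0 < (case i of (x, y, m) \<Rightarrow> \<bar>bias q f m\<bar>)" if "i \<in> set_pmf q" for i
    using that bias_nonzero by (auto split: prod.splits)
  show "(case i of (x, y, m) \<Rightarrow> \<bar>bias q f m\<bar>) \<le> 1" for i
    using bias_le_1 by (auto split: prod.splits)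
  show "(\<Sum>i\<in>set_pmf q. pmf q i) = 1" using finite_q by (intro sum_pmf_eq_1) auto
  show "(\<Sum>i\<in>set_pmf q. pmf p i) \<le> 1" using finite_q by (rule sum_pmf_le_1)
  show "(\<Sum>i\<in>set_pmf q. pmf q i / gain i) \<le> 1"
  proof -
    let ?h = "\<lambda>(x, y, m). ((x, y), m)"
    have "(\<Sum>i\<in>set_pmf q. pmf q i / gain i) = (\<Sum>i\<in>set_pmf q. pmf (pair_pmf \<mu> q_messages) (?h i))"
    proof (intro sum.cong refl)
      fix i assume i: "i \<in> set_pmf q"
      obtain x y m where [simp]: "i = (x, y, m)" by (cases i)
      have "pmf q i > 0" using i by (simp add: pmf_positive)
      then show "pmf q i / gain i = pmf (pair_pmf \<mu> q_messages) (?h i)"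
        using i by (simp add: gain_eq pmf_pair)
    qed
    also have "\<dots> = (\<Sum>j\<in>?h ` set_pmf q. pmf (pair_pmf \<mu> q_messages) j)"
      by (subst sum.reindex) (auto simp: inj_on_def)
    also have "\<dots> \<le> 1" using finite_q by (intro sum_pmf_le_1) auto
    finally show ?thesis .
  qed
  show "1 \<le> I" by (rule I_ge_1)
  show "gain i * (pmf q i / pmf p i) powr I * (case i of (x, y, m) \<Rightarrow> \<bar>bias q f m\<bar>) powr (- 180 * I) \<le> exp (l * I)"
    if i: "i \<in> set_pmf q" for i
  proof -
    obtain x y m where [simp]: "i = (x, y, m)" by (cases i)
    let ?E = "gain (x, y, m) * (pmf q (x, y, m) / pmf p (x, y, m)) powr I * \<bar>bias q f m\<bar> powr (- 180 * I)"
    have p: "0 < pmf p (x, y, m)" using i supp_q by (auto intro: pmf_positive)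
    have q: "0 < pmf q (x, y, m)" using i by (auto intro: pmf_positive)
    have b: "bias q f m \<noteq> 0" using i bias_nonzero by auto
    have E: "0 < ?E" using gain[OF i] p q b by (auto intro!: mult_pos_pos)
    have "ext_cost I p f q (x, y, m) \<le> ereal (l * I / ln 2)" using ext i by auto
    then have "log 2 ?E \<le> l * I / ln 2"
      \<comment> \<open>The exponent \<open>180 * I\<close> is \<open>12 * I / delta\<close> with
        \<open>delta = 1 / 15\<close>.\<close>
      using p b by (simp add: ext_cost_def gain_def delta_def)
    then have "ln ?E \<le> l * I" by (simp add: log_def divide_le_cancel)
    then have "exp (ln ?E) \<le> exp (l * I)" by (subst exp_le_cancel_iff)
    then have "?E \<le> exp (l * I)" by (simp only: exp_ln[OF E])
    then show ?thesis by simp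
  qed
qed

section \<open>The public prior on messages\<close>

definition prefix_prob :: "nat list \<Rightarrow> real" where
  "prefix_prob v = measure q {(x, y, m). take (length v) m = v}"

lemma prefix_prob_Suc: "prefix_prob (v @ [0]) + prefix_prob (v @ [1]) \<le> prefix_prob v"
proof -
  have "prefix_prob (v @ [0]) + prefix_prob (v @ [1])
    = measure q ({(x, y, m). take (length (v @ [0])) m = v @ [0]} \<union> {(x, y, m). take (length (v @ [1])) m = v @ [1]})"
    unfolding prefix_prob_def by (subst measure_pmf.finite_measure_Union) auto
  also have "\<dots> \<le> prefix_prob v"
    unfolding prefix_prob_def
  proof (rule measure_pmf.finite_measure_mono)
    have "take (length v) m = v" if "take (Suc (length v)) m = v @ [c]" for m c
      using that by (metis append_eq_conv_conj lessI min.strict_order_iff take_take)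
    then show "{(x, y, m). take (length (v @ [0])) m = v @ [0]} \<union> {(x, y, m). take (length (v @ [1])) m = v @ [1]}
      \<subseteq> {(x, y, m). take (length v) m = v}" by auto
  qed simp
  finally show ?thesis .
qed

lemma prefix_prob_nonneg: "0 \<le> prefix_prob v"
  by (simp add: prefix_prob_def)

text \<open>The prior is kept away from \<open>0\<close>, at the expense of a constant factor over \<open>C\<close> steps.\<close>

definition prior :: "nat list \<Rightarrow> nat \<Rightarrow> real" where
  "prior v c = (1 - 1 / (2 * real C)) * (prefix_prob (v @ [c]) / prefix_prob v) + 1 / (4 * real C)"

lemma smoothing: "0 \<le> 1 - 1 / (2 * real C)" "1 - 1 / (2 * real C) \<le> 1"
  using C by (auto simp: field_simps)

lemma prior_ge: "1 / (4 * real C) \<le> prior v c"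
proof -
  have "0 \<le> (1 - 1 / (2 * real C)) * (prefix_prob (v @ [c]) / prefix_prob v)"
    by (intro mult_nonneg_nonneg divide_nonneg_nonneg smoothing prefix_prob_nonneg)
  then show ?thesis unfolding prior_def by linarith
qed

lemma prior_pos: "0 < prior v c"
proof (rule less_le_trans[OF _ prior_ge])
  show "0 < 1 / (4 * real C)" using C by simp
qed

lemma prior_sum: "prior v 0 + prior v 1 \<le> 1"
proof -
  have "(prefix_prob (v @ [0]) + prefix_prob (v @ [1])) / prefix_prob v \<le> 1"
    using prefix_prob_Suc[of v] prefix_prob_nonneg[of v] by (auto simp: divide_le_eq_1 less_le)
  then have "(1 - 1 / (2 * real C)) * ((prefix_prob (v @ [0]) + prefix_prob (v @ [1])) / prefix_prob v) \<le> (1 - 1 / (2 * real C)) * 1"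
    using smoothing by (intro mult_left_mono) auto
  then show ?thesis using C by (simp add: prior_def add_divide_distrib distrib_left)
qed

lemma prefix_prob_mono: "prefix_prob (v @ w) \<le> prefix_prob v"
  unfolding prefix_prob_def
proof (rule measure_pmf.finite_measure_mono)
  have "take (length v) m = v" if "take (length (v @ w)) m = v @ w" for m
  proof -
    have "take (length v) (take (length (v @ w)) m) = take (length v) (v @ w)" using that by simp
    then show ?thesis by (simp add: min_def split: if_splits)
  qed
  then show "{(x, y, m). take (length (v @ w)) m = v @ w} \<subseteq> {(x, y, m). take (length v) m = v}" by auto
qed simp

lemma prefix_prob_le_prior:
  "prefix_prob (v @ w) * (1 - 1 / (2 * real C)) ^ length w \<le> prefix_prob v * path_prod prior v w"
proof (induction w arbitrary: v)
  case (Cons c w)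
  let ?g = "1 - 1 / (2 * real C)"
  have "prefix_prob ((v @ [c]) @ w) * ?g ^ length w * ?g \<le> prefix_prob (v @ [c]) * path_prod prior (v @ [c]) w * ?g"
    using smoothing by (intro mult_right_mono Cons) auto
  also have "\<dots> = ?g * prefix_prob (v @ [c]) * path_prod prior (v @ [c]) w" by simp
  also have "\<dots> \<le> prefix_prob v * prior v c * path_prod prior (v @ [c]) w"
  proof (intro mult_right_mono path_prod_nonneg less_imp_le[OF prior_pos])
    show "?g * prefix_prob (v @ [c]) \<le> prefix_prob v * prior v c"
    proof (cases "prefix_prob v = 0")
      case True
      then have "prefix_prob (v @ [c]) = 0" using prefix_prob_mono[of v "[c]"] prefix_prob_nonneg[of "v @ [c]"] by simp
      then show ?thesis using True by simp
    next
      case False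
      have "0 \<le> prefix_prob v * (1 / (4 * real C))" using prefix_prob_nonneg by simp
      then show ?thesis using False by (simp add: prior_def distrib_left)
    qed
  qed
  finally show ?case by (simp add: mult_ac)
qed simp

lemma prefix_prob_full: "(x, y, m) \<in> set_pmf q \<Longrightarrow> prefix_prob m = pmf q_messages m"
proof -
  assume "(x, y, m) \<in> set_pmf q"
  then have "length m = C + 1" using supp_q p_length by blast
  then have "prefix_prob m = measure q {(x', y', m'). m' = m}"
    unfolding prefix_prob_def using supp_q p_length
    by (intro measure_prob_cong_0) (auto simp: pmf_eq_0_set_pmf dest!: subsetD[OF supp_q] p_length)
  then show ?thesis by (simp add: measure_q_message)
qed

text \<open>By Bernoulli's inequality \<open>(1 - 1 / (2 * C)) ^ C\<close> is at least
  \<open>1 / 2\<close>, so smoothing every step loses a factor \<open>2\<close> in total.\<close>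

lemma message_prob_le:
  assumes "(x, y, m) \<in> set_pmf q"
  shows "pmf q_messages m \<le> 2 * prefix_prob (take 2 m) * path_prod prior (take 2 m) (drop 2 m)"
proof -
  let ?g = "1 - 1 / (2 * real C)"
  have len: "length (drop 2 m) \<le> C" using assms supp_q p_length by fastforce
  have "1 / 2 = 1 + real C * (- 1 / (2 * real C))" using C by simp
  also have "\<dots> \<le> (1 + (- 1 / (2 * real C))) ^ C" using C by (intro Bernoulli_inequality) (auto simp: field_simps)
  also have "\<dots> \<le> ?g ^ length (drop 2 m)" using len smoothing by (simp add: power_decreasing)
  finally have g: "1 / 2 \<le> ?g ^ length (drop 2 m)" .
  have "pmf q_messages m * (1 / 2) \<le> pmf q_messages m * ?g ^ length (drop 2 m)"
    by (intro mult_left_mono g) auto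
  also have "\<dots> \<le> prefix_prob (take 2 m) * path_prod prior (take 2 m) (drop 2 m)"
    using prefix_prob_le_prior[of "take 2 m" "drop 2 m"] by (simp add: prefix_prob_full[OF assms])
  finally show ?thesis by simp
qed

text \<open>The values outside of the support are chosen such that the two bits always have total probability
  \<open>1\<close>; the conditional probabilities in the definition of a protocol distribution are all \<open>0\<close> there.\<close>

definition kernel :: "('x \<times> 'y \<times> nat list \<Rightarrow> bool) \<Rightarrow> nat \<Rightarrow> nat \<Rightarrow> real" where
  "kernel P i c = (if 2 \<le> i \<and> i \<le> C \<and> (\<exists>w\<in>set_pmf p. P w)
     then pmf (map_pmf (\<lambda>(x, y, m). m ! i) (cond_pmf p {w. P w})) c else 1 / 2)"

lemma kernel_nonneg: "0 \<le> kernel P i c"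
  by (simp add: kernel_def)

lemma kernel_le_1: "kernel P i c \<le> 1"
  by (simp add: kernel_def pmf_le_1)

lemma kernel_sum: "kernel P i 0 + kernel P i 1 = 1"
proof (cases "2 \<le> i \<and> i \<le> C \<and> (\<exists>w\<in>set_pmf p. P w)")
  case True
  let ?K = "map_pmf (\<lambda>(x, y, m). m ! i) (cond_pmf p {w. P w})"
  have ne: "set_pmf p \<inter> {w. P w} \<noteq> {}" using True by blast
  have "set_pmf ?K \<subseteq> {0, 1}"
  proof
    fix c assume "c \<in> set_pmf ?K"
    then obtain x y m where w: "(x, y, m) \<in> set_pmf p" and c: "c = m ! i"
      by (auto simp: set_cond_pmf[OF ne])
    have "i \<in> {2..C}" using True by simp
    then have "m ! i \<in> {0, 1}" using bits w by blast
    then show "c \<in> {0, 1}" by (simp only: c)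
  qed
  then have "(\<Sum>c\<in>{0, 1}. pmf ?K c) = 1" by (intro sum_pmf_eq_1) auto
  then show ?thesis using True by (simp add: kernel_def)
next
  case False
  then have *: "kernel P i c = 1 / 2" for c unfolding kernel_def by auto
  show ?thesis by (simp only: *)
qed

text \<open>The length of \<open>v\<close> is the index of the next message, so odd lengths are
  Alice's turns.\<close>

definition alice_ratio :: "'x \<Rightarrow> nat list \<Rightarrow> nat \<Rightarrow> real" where
  "alice_ratio x v c = (if odd (length v)
     then kernel (\<lambda>(x', y', m'). x' = x \<and> take (length v) m' = v) (length v) c / prior v c else 1)"

definition bob_ratio :: "'y \<Rightarrow> nat list \<Rightarrow> nat \<Rightarrow> real" where
  "bob_ratio y v c = (if even (length v)
     then kernel (\<lambda>(x', y', m'). y' = y \<and> take (length v) m' = v) (length v) c / prior v c else 1)"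

lemma kernel_ratio_le: "kernel P i c / prior v c \<le> 4 * real C"
proof -
  have "kernel P i c / prior v c \<le> 1 / (1 / (4 * real C))"
    using C by (intro frac_le kernel_le_1 prior_ge) auto
  then show ?thesis by simp
qed

sublocale walk: two_party_walk prior alice_ratio bob_ratio "4 * real C"
proof
  fix v :: "nat list" and x y and c :: nat
  show "0 \<le> prior v c" using prior_pos[of v c] by simp
  show "prior v 0 + prior v 1 \<le> 1" by (rule prior_sum)
  show "1 \<le> 4 * real C" using C by simp
  show "0 \<le> alice_ratio x v c" "0 \<le> bob_ratio y v c"
    using prior_pos[of v c] kernel_nonneg by (auto simp: alice_ratio_def bob_ratio_def)
  show "alice_ratio x v c \<le> 4 * real C" "bob_ratio y v c \<le> 4 * real C"
    using C kernel_ratio_le by (auto simp: alice_ratio_def bob_ratio_def)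
  show "even (length v) \<Longrightarrow> alice_ratio x v c = 1" "odd (length v) \<Longrightarrow> bob_ratio y v c = 1"
    by (auto simp: alice_ratio_def bob_ratio_def)
  have nz: "prior v c \<noteq> 0" for c using prior_pos[of v c] by simp
  show "odd (length v) \<Longrightarrow> prior v 0 * alice_ratio x v 0 + prior v 1 * alice_ratio x v 1 = 1"
    "even (length v) \<Longrightarrow> prior v 0 * bob_ratio y v 0 + prior v 1 * bob_ratio y v 1 = 1"
    using nz by (auto simp: alice_ratio_def bob_ratio_def kernel_sum[unfolded One_nat_def])
qed

text \<open>This is \<open>p(m_0) * p(m_1|x m_0)\<close>. Bob's input does not enter, so Alice can
  sample both messages in one rejection step.\<close>

definition start_prob :: "'x \<Rightarrow> nat list \<Rightarrow> real" where
  "start_prob x v = pmf (public_marginal p) (v ! 0) * alice_msg_prob p 1 x v"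

lemma start_prob_nonneg: "0 \<le> start_prob x v"
  by (simp add: start_prob_def alice_msg_prob_def cond_prob_def)

lemma start_prob_sum:
  assumes fin: "finite U" and U: "\<And>v. v \<in> U \<Longrightarrow> length v = 2"
  shows "(\<Sum>v\<in>U. start_prob x v) \<le> 1"
proof -
  define P where "P a = (\<lambda>(x', y' :: 'y, m' :: nat list). x' = x \<and> take 1 m' = [a])" for a
  define K where "K a = map_pmf (\<lambda>(x', y', m'). m' ! 1) (cond_pmf p {w. P a w})" for a
  have le: "alice_msg_prob p 1 x [a, b] \<le> pmf (K a) b" for a b
  proof -
    have *: "alice_msg_prob p 1 x [a, b] = cond_prob (measure_pmf p) (\<lambda>(x', y', m'). m' ! 1 = b) (P a)"
      by (simp add: alice_msg_prob_def P_def)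
    show ?thesis
    proof (cases "\<exists>w\<in>set_pmf p. P a w")
      case True
      then obtain x' y' m' where w: "(x', y', m') \<in> set_pmf p" "P a (x', y', m')" by auto
      show ?thesis unfolding * K_def by (simp add: cond_prob_eq_pmf[where P = "P a", OF w])
    next
      case False
      show ?thesis unfolding * by (simp add: cond_prob_null[OF False])
    qed
  qed
  let ?h = "\<lambda>(a, b). [a, b]"
  define A where "A = (\<lambda>v. v ! 0) ` U"
  define B where "B = (\<lambda>v. v ! 1) ` U"
  have sub: "U \<subseteq> ?h ` (A \<times> B)"
  proof
    fix v assume v: "v \<in> U"
    have "v = ?h (v ! 0, v ! 1)" using U[OF v] by (auto intro!: nth_equalityI simp: less_2_cases_iff)
    then show "v \<in> ?h ` (A \<times> B)" by (rule image_eqI) (use v in \<open>auto simp: A_def B_def\<close>)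
  qed
  have "(\<Sum>v\<in>U. start_prob x v) \<le> (\<Sum>v\<in>?h ` (A \<times> B). start_prob x v)"
    using fin sub by (intro sum_mono2 start_prob_nonneg) (auto simp: A_def B_def)
  also have "\<dots> = (\<Sum>(a, b)\<in>A \<times> B. start_prob x [a, b])"
    by (subst sum.reindex) (auto simp: inj_on_def intro!: sum.cong)
  also have "\<dots> = (\<Sum>a\<in>A. \<Sum>b\<in>B. pmf (public_marginal p) a * alice_msg_prob p 1 x [a, b])"
    by (simp add: sum.cartesian_product start_prob_def)
  also have "\<dots> \<le> (\<Sum>a\<in>A. \<Sum>b\<in>B. pmf (public_marginal p) a * pmf (K a) b)"
    by (intro sum_mono mult_left_mono le) auto
  also have "\<dots> = (\<Sum>a\<in>A. pmf (public_marginal p) a * (\<Sum>b\<in>B. pmf (K a) b))" by (simp add: sum_distrib_left)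
  also have "\<dots> \<le> (\<Sum>a\<in>A. pmf (public_marginal p) a * 1)"
    using fin by (intro sum_mono mult_left_mono sum_pmf_le_1) (auto simp: B_def)
  also have "\<dots> \<le> 1" using sum_pmf_le_1[of A "public_marginal p"] fin by (simp add: A_def)
  finally show ?thesis .
qed

text \<open>On the support of \<open>p\<close> no conditioning event is null, so
  \<open>kernel\<close> agrees with the factors of the protocol distribution, and the prior
  cancels.\<close>

lemma p_eq_walk:
  assumes w: "(x, y, m) \<in> set_pmf p"
  shows "pmf p (x, y, m) = pmf \<mu> (x, y) * (start_prob x (take 2 m) * walk.walk_prob x y (take 2 m) (drop 2 m))"
proof -
  have len: "length m = C + 1" using w by (rule p_length)
  define g where "g i = (if odd i then alice_msg_prob p i x m else bob_msg_prob p i y m)" for i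
  have g: "prior (take i m) (m ! i) * alice_ratio x (take i m) (m ! i) * bob_ratio y (take i m) (m ! i) = g i"
    if i: "i \<in> {2..C}" for i
  proof -
    have li: "min (length m) i = i" using i len by simp
    have nz: "prior (take i m) (m ! i) \<noteq> 0" using prior_pos[of "take i m" "m ! i"] by simp
    have "\<exists>w\<in>set_pmf p. (\<lambda>(x', y', m'). x' = x \<and> take i m' = take i m) w"
         "\<exists>w\<in>set_pmf p. (\<lambda>(x', y', m'). y' = y \<and> take i m' = take i m) w"
      using w by force+
    then have "kernel (\<lambda>(x', y', m'). x' = x \<and> take i m' = take i m) i (m ! i) = alice_msg_prob p i x m"
       "kernel (\<lambda>(x', y', m'). y' = y \<and> take i m' = take i m) i (m ! i) = bob_msg_prob p i y m"
      using i cond_prob_eq_pmf[OF w, where P = "\<lambda>(x', y', m'). x' = x \<and> take i m' = take i m" and i = i and c = "m ! i"]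
        cond_prob_eq_pmf[OF w, where P = "\<lambda>(x', y', m'). y' = y \<and> take i m' = take i m" and i = i and c = "m ! i"]
      by (simp_all add: kernel_def alice_msg_prob_def bob_msg_prob_def)
    then show ?thesis using nz by (simp add: g_def alice_ratio_def bob_ratio_def li)
  qed
  have "walk.walk_prob x y (take 2 m) (drop 2 m) = (\<Prod>i<C - 1. g (i + 2))"
  proof -
    have "take 2 m @ take i (drop 2 m) = take (i + 2) m" for i using take_add[of 2 i m] by (simp only: add.commute)
    moreover have "drop 2 m ! i = m ! (i + 2)" for i using len C by (simp add: add.commute)
    ultimately show ?thesis
      unfolding walk.walk_prob_def path_prod_eq_prod prod.distrib[symmetric] using len
      by (intro prod.cong) (auto intro!: g)
  qed
  also have "\<dots> = (\<Prod>i\<in>{2..C}. g i)"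
    by (rule prod.reindex_bij_witness[of _ "\<lambda>i. i - 2" "\<lambda>i. i + 2"]) auto
  finally have "start_prob x (take 2 m) * walk.walk_prob x y (take 2 m) (drop 2 m)
      = pmf (public_marginal p) (m ! 0) * (alice_msg_prob p 1 x m * (\<Prod>i\<in>{2..C}. g i))"
    by (simp add: start_prob_def alice_msg_prob_def)
  also have "alice_msg_prob p 1 x m * (\<Prod>i\<in>{2..C}. g i) = (\<Prod>i\<in>{1..C}. g i)"
  proof -
    have "{1..C} = insert 1 {2..C}" using C by auto
    then show ?thesis by (simp add: g_def)
  qed
  finally show ?thesis using prot len unfolding protocol_distribution_def g_def by simp
qed

definition starts :: "nat list set" where
  "starts = (\<lambda>(x, y, m). take 2 m) ` set_pmf q"

lemma finite_starts: "finite starts"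
  unfolding starts_def by (intro finite_imageI finite_q)

lemma starts_length: "v \<in> starts \<Longrightarrow> length v = 2"
  unfolding starts_def using supp_q p_length C by fastforce

lemma prefix_prob_starts: "(\<Sum>v\<in>starts. prefix_prob v) \<le> 1"
proof -
  have "(\<Sum>v\<in>starts. prefix_prob v) = (\<Sum>v\<in>starts. pmf (map_pmf (\<lambda>(x, y, m). take 2 m) q) v)"
    unfolding prefix_prob_def pmf_map
    by (intro sum.cong refl arg_cong[where f = "measure q"]) (auto simp: starts_length)
  also have "\<dots> \<le> 1" by (intro sum_pmf_le_1 finite_starts)
  finally show ?thesis .
qed

lemma q_triple:
  assumes "(x, y, m) \<in> set_pmf q"
  shows "(x, y) \<in> X \<times> Y" "take 2 m \<in> starts" "drop 2 m \<in> words (C - 1)"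
  using assms supp_q supp_p p_bits by (force simp: starts_def)+

lemma sum_triples:
  fixes F :: "'x \<times> 'y \<times> nat list \<Rightarrow> real"
  defines "T \<equiv> (\<lambda>((x, y), v, w). (x, y, v @ w)) ` ((X \<times> Y) \<times> starts \<times> words (C - 1))"
  shows "(\<Sum>i\<in>T. F i) = (\<Sum>(x, y)\<in>X \<times> Y. \<Sum>v\<in>starts. \<Sum>w\<in>words (C - 1). F (x, y, v @ w))"
    and "set_pmf q \<subseteq> T" and "finite T"
proof -
  have inj: "inj_on (\<lambda>((x, y), v, w). (x, y, v @ w)) ((X \<times> Y) \<times> starts \<times> words (C - 1))"
    by (auto simp: inj_on_def dest!: starts_length)
  have "(\<Sum>i\<in>T. F i) = (\<Sum>((x, y), v, w)\<in>(X \<times> Y) \<times> starts \<times> words (C - 1). F (x, y, v @ w))"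
    unfolding T_def by (subst sum.reindex[OF inj]) (auto intro!: sum.cong)
  also have "\<dots> = (\<Sum>xy\<in>X \<times> Y. \<Sum>(v, w)\<in>starts \<times> words (C - 1). case xy of (x, y) \<Rightarrow> F (x, y, v @ w))"
    by (subst sum.cartesian_product') (auto intro!: sum.cong)
  also have "\<dots> = (\<Sum>(x, y)\<in>X \<times> Y. \<Sum>v\<in>starts. \<Sum>w\<in>words (C - 1). F (x, y, v @ w))"
    by (intro sum.cong refl) (auto simp: sum.cartesian_product)
  finally show "(\<Sum>i\<in>T. F i) = (\<Sum>(x, y)\<in>X \<times> Y. \<Sum>v\<in>starts. \<Sum>w\<in>words (C - 1). F (x, y, v @ w))" .
  show "set_pmf q \<subseteq> T"
  proof clarify
    fix x y m assume "(x, y, m) \<in> set_pmf q"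
    from q_triple[OF this] show "(x, y, m) \<in> T"
      unfolding T_def by (intro image_eqI[of _ _ "((x, y), take 2 m, drop 2 m)"]) auto
  qed
  show "finite T" unfolding T_def by (intro finite_imageI finite_cartesian_product X Y finite_starts finite_words)
qed

lemma sum_q_le:
  fixes F :: "'x \<times> 'y \<times> nat list \<Rightarrow> real"
  assumes "\<And>x y v w. v \<in> starts \<Longrightarrow> 0 \<le> G x y v w"
    "\<And>x y m. (x, y, m) \<in> set_pmf q \<Longrightarrow> F (x, y, m) \<le> G x y (take 2 m) (drop 2 m)"
  shows "(\<Sum>i\<in>set_pmf q. F i) \<le> (\<Sum>(x, y)\<in>X \<times> Y. \<Sum>v\<in>starts. \<Sum>w\<in>words (C - 1). G x y v w)"
proof -
  let ?T = "(\<lambda>((x, y), v, w). (x, y, v @ w)) ` ((X \<times> Y) \<times> starts \<times> words (C - 1))"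
  let ?G = "\<lambda>(x, y, m). G x y (take 2 m) (drop 2 m)"
  have "(\<Sum>i\<in>set_pmf q. F i) \<le> (\<Sum>i\<in>set_pmf q. ?G i)" using assms(2) by (intro sum_mono) auto
  also have "\<dots> \<le> (\<Sum>i\<in>?T. ?G i)"
    using sum_triples(2,3) assms(1) by (intro sum_mono2) (auto simp: starts_length)
  also have "\<dots> = (\<Sum>(x, y)\<in>X \<times> Y. \<Sum>v\<in>starts. \<Sum>w\<in>words (C - 1). G x y v w)"
    unfolding sum_triples(1) by (intro sum.cong refl) (auto simp: starts_length intro!: sum.cong)
  finally show ?thesis .
qed

lemma sum_q_eq:
  fixes F :: "'x \<times> 'y \<times> nat list \<Rightarrow> real"
  assumes "\<And>x y m. (x, y, m) \<notin> set_pmf q \<Longrightarrow> F (x, y, m) = 0"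
  shows "(\<Sum>i\<in>set_pmf q. F i) = (\<Sum>(x, y)\<in>X \<times> Y. \<Sum>v\<in>starts. \<Sum>w\<in>words (C - 1). F (x, y, v @ w))"
  unfolding sum_triples(1)[symmetric]
  using sum_triples(2,3) assms by (intro sum.mono_neutral_left) auto

section \<open>Likelihood ratios, the potential and typical triples\<close>

definition ratio_start :: "'x \<Rightarrow> nat list \<Rightarrow> real" where
  "ratio_start x v = start_prob x v / prefix_prob v"

definition ratio_walk :: "'x \<Rightarrow> 'y \<Rightarrow> nat list \<Rightarrow> nat list \<Rightarrow> real" where
  "ratio_walk x y v w = path_prod (alice_ratio x) v w * path_prod (bob_ratio y) v w"

abbreviation crossing_factor :: "'x \<Rightarrow> 'y \<Rightarrow> nat list \<Rightarrow> nat list \<Rightarrow> real" where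
  "crossing_factor x y v w \<equiv> (21 / 20) ^ walk.crossings x y v 1 1 w"

text \<open>With \<rho> and \<omega> the ratios of the start and of the walk, this is the crossing
  factor over the root of \<rho>\<omega>, plus one over the root of \<omega>. Both summands have
  \<open>p\<close>-mean at most \<open>1\<close> by \<open>affinity\<close>. Conversely, a bound
  \<open>D\<close> on the potential bounds the crossing factor and the root of \<rho> by
  \<open>D\<close> times the root of \<rho>\<omega>.\<close>

definition potential :: "'x \<times> 'y \<times> nat list \<Rightarrow> real" where
  "potential = (\<lambda>(x, y, m). (crossing_factor x y (take 2 m) (drop 2 m) + sqrt (ratio_start x (take 2 m))) /
     sqrt (ratio_start x (take 2 m) * ratio_walk x y (take 2 m) (drop 2 m)))"

lemma walk_factor: "walk.walk_prob x y v w = path_prod prior v w * ratio_walk x y v w"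
  by (simp add: walk.walk_prob_def ratio_walk_def)

lemma q_positive:
  assumes w: "(x, y, m) \<in> set_pmf q"
  shows "0 < prefix_prob (take 2 m)" "0 < ratio_start x (take 2 m)" "0 < ratio_walk x y (take 2 m) (drop 2 m)"
    "0 < path_prod prior (take 2 m) (drop 2 m)" "0 < start_prob x (take 2 m)"
proof -
  have "0 < pmf q_messages m" by (rule q_messages_pos[OF w])
  also have "\<dots> \<le> 2 * (prefix_prob (take 2 m) * path_prod prior (take 2 m) (drop 2 m))"
    using message_prob_le[OF w] by (simp add: mult.assoc)
  finally have "0 < prefix_prob (take 2 m) * path_prod prior (take 2 m) (drop 2 m)" by simp
  then show 1: "0 < prefix_prob (take 2 m)" "0 < path_prod prior (take 2 m) (drop 2 m)"
    using prefix_prob_nonneg[of "take 2 m"] by (auto simp: zero_less_mult_iff)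
  have "0 < pmf p (x, y, m)" using w supp_q by (auto intro: pmf_positive)
  also have "pmf p (x, y, m) = pmf \<mu> (x, y) * (start_prob x (take 2 m) * walk.walk_prob x y (take 2 m) (drop 2 m))"
    using w supp_q by (intro p_eq_walk) auto
  finally have "start_prob x (take 2 m) \<noteq> 0" "walk.walk_prob x y (take 2 m) (drop 2 m) \<noteq> 0" by auto
  moreover have "0 \<le> walk.walk_prob x y (take 2 m) (drop 2 m)" by (rule walk.walk_prob_nonneg)
  ultimately have 2: "0 < start_prob x (take 2 m)" "0 < walk.walk_prob x y (take 2 m) (drop 2 m)"
    using start_prob_nonneg[of x "take 2 m"] by auto
  then show "0 < ratio_start x (take 2 m)" "0 < start_prob x (take 2 m)"
    "0 < ratio_walk x y (take 2 m) (drop 2 m)"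
    using 1 by (auto simp: ratio_start_def walk_factor zero_less_mult_iff)
qed

lemma potential_nonneg: "i \<in> set_pmf q \<Longrightarrow> 0 \<le> potential i"
proof -
  assume "i \<in> set_pmf q"
  moreover obtain x y m where [simp]: "i = (x, y, m)" by (cases i)
  ultimately have "(x, y, m) \<in> set_pmf q" by simp
  from q_positive[OF this] show ?thesis
    by (auto simp: potential_def intro!: divide_nonneg_nonneg add_nonneg_nonneg)
qed

lemma affinity: "(\<Sum>w\<in>words d. path_prod prior v w * sqrt (ratio_walk x y v w) * crossing_factor x y v w) \<le> 1"
  using walk.affinity_crossings[of 1 1 v x y d] by (simp add: psi_1 ratio_walk_def)

lemma ratio_walk_nonneg: "0 \<le> ratio_walk x y v w"
  unfolding ratio_walk_def
  by (intro mult_nonneg_nonneg path_prod_nonneg walk.a_nonneg walk.b_nonneg)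

lemma prior_path_nonneg: "0 \<le> path_prod prior v w"
  by (intro path_prod_nonneg less_imp_le[OF prior_pos])

lemma potential_sum: "(\<Sum>i\<in>set_pmf q. pmf p i * potential i) \<le> 2"
proof -
  define c where "c x v = sqrt (start_prob x v * prefix_prob v) + start_prob x v" for x v
  have c0: "0 \<le> c x v" for x v unfolding c_def by (simp add: start_prob_nonneg prefix_prob_nonneg)
  have "(\<Sum>i\<in>set_pmf q. pmf p i * potential i) \<le> (\<Sum>(x, y)\<in>X \<times> Y. \<Sum>v\<in>starts. \<Sum>w\<in>words (C - 1).
     pmf \<mu> (x, y) * (c x v * (path_prod prior v w * sqrt (ratio_walk x y v w) * crossing_factor x y v w)))"
  proof (rule sum_q_le)
    show "0 \<le> pmf \<mu> (x, y) * (c x v * (path_prod prior v w * sqrt (ratio_walk x y v w) * crossing_factor x y v w))" for x y v w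
      by (intro mult_nonneg_nonneg c0 prior_path_nonneg) (auto simp: ratio_walk_nonneg)
    fix x y m assume w: "(x, y, m) \<in> set_pmf q"
    let ?v = "take 2 m" and ?w = "drop 2 m"
    note pos = q_positive[OF w]
    define R where "R = sqrt (ratio_walk x y ?v ?w)"
    define K where "K = crossing_factor x y ?v ?w"
    define k where "k = sqrt (ratio_start x ?v)"
    define Q where "Q = prefix_prob ?v"
    have R: "R > 0" "ratio_walk x y ?v ?w = R * R" using pos by (auto simp: R_def)
    have k: "k > 0" "ratio_start x ?v = k * k" using pos by (auto simp: k_def)
    have K: "K \<ge> 1" by (simp add: K_def)
    have Q: "Q > 0" using pos by (simp add: Q_def)
    have s: "start_prob x ?v = k * k * Q" using pos k by (simp add: ratio_start_def Q_def field_simps)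
    have cc: "c x ?v = k * Q + k * k * Q"
      using k Q by (simp add: c_def s Q_def[symmetric] real_sqrt_mult)
    have "pmf p (x, y, m) * potential (x, y, m)
      = pmf \<mu> (x, y) * (k * k * Q * (path_prod prior ?v ?w * (R * R))) * ((K + k) / (k * R))"
      using p_eq_walk[of x y m] w supp_q
      by (auto simp: potential_def walk_factor s R(2) k(2) K_def[symmetric] real_sqrt_mult k(1) R(1) abs_of_pos)
    also have "\<dots> = pmf \<mu> (x, y) * ((k * Q * K + k * k * Q) * (path_prod prior ?v ?w * R))"
      using k R by (simp add: field_simps)
    \<comment> \<open>The second summand also receives the factor \<open>K \<ge> 1\<close>, so that
      \<open>affinity\<close> handles both at once.\<close>
    also have "\<dots> \<le> pmf \<mu> (x, y) * ((k * Q * K + k * k * Q * K) * (path_prod prior ?v ?w * R))"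
      using K k Q R prior_path_nonneg
      by (intro mult_left_mono mult_right_mono add_left_mono) (auto intro!: mult_nonneg_nonneg)
    also have "\<dots> = pmf \<mu> (x, y) * (c x ?v * (path_prod prior ?v ?w * sqrt (ratio_walk x y ?v ?w) * crossing_factor x y ?v ?w))"
      by (simp add: cc R_def[symmetric] K_def[symmetric] algebra_simps)
    finally show "pmf p (x, y, m) * potential (x, y, m) \<le> \<dots>" .
  qed
  also have "\<dots> = (\<Sum>(x, y)\<in>X \<times> Y. pmf \<mu> (x, y) * (\<Sum>v\<in>starts. c x v *
      (\<Sum>w\<in>words (C - 1). path_prod prior v w * sqrt (ratio_walk x y v w) * crossing_factor x y v w)))"
    by (simp add: sum_distrib_left)
  also have "\<dots> \<le> (\<Sum>(x, y)\<in>X \<times> Y. pmf \<mu> (x, y) * 2)"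
  proof (intro sum_mono, clarify, intro mult_left_mono)
    fix x y
    have "(\<Sum>v\<in>starts. c x v * (\<Sum>w\<in>words (C - 1). path_prod prior v w * sqrt (ratio_walk x y v w) * crossing_factor x y v w))
      \<le> (\<Sum>v\<in>starts. c x v * 1)"
      by (intro sum_mono mult_left_mono affinity c0)
    also have "\<dots> \<le> (\<Sum>v\<in>starts. (start_prob x v + prefix_prob v) / 2 + start_prob x v)"
      unfolding c_def
      using arith_geo_mean_sqrt[OF start_prob_nonneg prefix_prob_nonneg] by (intro sum_mono) simp
    also have "\<dots> = ((\<Sum>v\<in>starts. start_prob x v) + (\<Sum>v\<in>starts. prefix_prob v)) / 2 + (\<Sum>v\<in>starts. start_prob x v)"
      by (simp only: sum.distrib sum_divide_distrib[symmetric])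
    also have "\<dots> \<le> 2"
    proof -
      have *: "(s + t) / 2 + s \<le> 2" if "s \<le> 1" "t \<le> 1" for s t :: real using that by (simp add: field_simps)
      show ?thesis by (rule *[OF start_prob_sum[OF finite_starts starts_length] prefix_prob_starts])
    qed
    finally show "(\<Sum>v\<in>starts. c x v * (\<Sum>w\<in>words (C - 1). path_prod prior v w * sqrt (ratio_walk x y v w) * crossing_factor x y v w)) \<le> 2" .
  qed simp
  also have "\<dots> = (\<Sum>xy\<in>X \<times> Y. pmf \<mu> xy) * 2" by (simp add: sum_distrib_right case_prod_unfold)
  also have "\<dots> \<le> 2" using sum_pmf_le_1[of "X \<times> Y" \<mu>] X Y by simp
  finally show ?thesis .
qed

text \<open>On typical triples this bounds both the likelihood ratio of the first two messages and the
  factor by which crossings are rewarded.\<close>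

definition typical_bound :: real where
  "typical_bound = 2 * exp (l * I) * (8 / exp (- l)) powr (I + 1) * (16 * ratio_bound / exp (- l))\<^sup>2"

definition typical :: "('x \<times> 'y \<times> nat list) set" where
  "typical = {i \<in> set_pmf q. pmf q i \<le> ratio_bound * pmf p i \<and>
     pmf p i \<le> 8 / exp (- l) * pmf q i \<and> potential i \<le> 16 * ratio_bound / exp (- l)}"

lemma atypical: "(\<Sum>i\<in>set_pmf q - typical. pmf q i) \<le> 3 / 8 * exp (- l)"
  unfolding typical_def using potential_nonneg potential_sum by (intro typical_set) auto

lemma ratio_bound_ge: "1 \<le> ratio_bound"
  using l_nonneg by (simp add: ratio_bound_def)

lemma typical_bound_ge: "1 \<le> typical_bound"
proof -
  have b: "exp (- l) \<le> 1" using l_nonneg by simp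
  have "exp (- l) \<le> 8" using b by linarith
  then have b8: "1 \<le> 8 / exp (- l)" by (simp add: field_simps)
  have "1 \<le> exp (l * I)" using l_nonneg I_ge by simp
  moreover have "1 \<le> (8 / exp (- l)) powr (I + 1)" using b8 I_ge by (intro ge_one_powr_ge_zero) auto
  moreover have "exp (- l) \<le> 16 * ratio_bound" using b ratio_bound_ge by linarith
  then have "1 \<le> 16 * ratio_bound / exp (- l)" by (simp add: field_simps)
  then have "1 \<le> (16 * ratio_bound / exp (- l))\<^sup>2" by (rule one_le_power)
  ultimately have "1 * 1 * 1 * 1 \<le> typical_bound" unfolding typical_bound_def by (intro mult_mono) auto
  then show ?thesis by simp
qed

text \<open>The total ratio \<open>\<zeta>\<close> is at most twice \<open>gain\<close> times
  \<open>p / q\<close>. The cost gives \<open>gain \<le> exp (l * I) * (p / q) powr I\<close>, the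
  bias factor being at least \<open>1\<close>, and on typical triples \<open>p / q\<close> is at
  most \<open>8 / exp (- l)\<close>. So \<open>\<zeta>\<close> is at most exponential in
  \<open>I\<close>, and the bound on the potential does the rest.\<close>

lemma typical_bounds:
  assumes t: "(x, y, m) \<in> typical"
  shows "ratio_start x (take 2 m) \<le> typical_bound" "crossing_factor x y (take 2 m) (drop 2 m) \<le> typical_bound"
proof -
  let ?v = "take 2 m" and ?w = "drop 2 m"
  let ?p = "pmf p (x, y, m)" and ?q = "pmf q (x, y, m)" and ?b = "exp (- l)"
  have w: "(x, y, m) \<in> set_pmf q" and pq: "?p \<le> 8 / ?b * ?q" and V: "potential (x, y, m) \<le> 16 * ratio_bound / ?b"
    using t by (auto simp: typical_def)
  note pos = q_positive[OF w]
  have p0: "0 < ?p" and q0: "0 < ?q" and g0: "0 < gain (x, y, m)" using p_pos[OF w] q_pos[OF w] u_pos[OF w] by auto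
  have \<mu>0: "0 < pmf \<mu> (x, y)" using w supp_q inputs_pos by auto
  define \<zeta> where "\<zeta> = ratio_start x ?v * ratio_walk x y ?v ?w"
  have \<zeta>0: "0 < \<zeta>" using pos by (simp add: \<zeta>_def)
  have "\<zeta> * (pmf \<mu> (x, y) * (prefix_prob ?v * path_prod prior ?v ?w)) = ?p"
    using p_eq_walk[of x y m] w supp_q pos by (auto simp: \<zeta>_def ratio_start_def walk_factor)
  moreover have "\<zeta> * (pmf \<mu> (x, y) * pmf q_messages m) \<le> \<zeta> * (pmf \<mu> (x, y) * (2 * (prefix_prob ?v * path_prod prior ?v ?w)))"
    using message_prob_le[OF w] \<zeta>0 \<mu>0 by (intro mult_left_mono) (auto simp: mult.assoc)
  ultimately have "\<zeta> * (pmf \<mu> (x, y) * pmf q_messages m) \<le> 2 * ?p" by simp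
  then have "\<zeta> \<le> 2 * gain (x, y, m) * (?p / ?q)"
    using \<mu>0 q_messages_pos[OF w] q0 by (simp add: gain_eq[OF w] field_simps)
  moreover have "gain (x, y, m) \<le> exp (l * I) * (?p / ?q) powr I"
  proof -
    have "1 \<le> \<bar>bias q f m\<bar> powr (- 180 * I)"
      using bias_le_1[of m] bias_nonzero[OF w] I_ge powr_mono'[of "- 180 * I" 0 "\<bar>bias q f m\<bar>"] by simp
    then have "gain (x, y, m) * (?q / ?p) powr I * 1 \<le> gain (x, y, m) * (?q / ?p) powr I * \<bar>bias q f m\<bar> powr (- 180 * I)"
      using g0 by (intro mult_left_mono) auto
    also have "\<dots> \<le> exp (l * I)" using cost[OF w] by simp
    finally have "gain (x, y, m) * (?q / ?p) powr I * (?p / ?q) powr I \<le> exp (l * I) * (?p / ?q) powr I"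
      by (intro mult_right_mono) auto
    moreover have "(?q / ?p) powr I * (?p / ?q) powr I = 1"
      using p0 q0 by (simp add: powr_mult[symmetric])
    ultimately show ?thesis by (simp add: mult.assoc)
  qed
  ultimately have "\<zeta> \<le> 2 * (exp (l * I) * (?p / ?q) powr I) * (?p / ?q)"
    using p0 q0 by (elim order_trans) (intro mult_right_mono mult_left_mono, auto)
  also have "\<dots> = 2 * exp (l * I) * (?p / ?q) powr (I + 1)"
    using p0 q0 by (simp add: powr_add)
  also have "\<dots> \<le> 2 * exp (l * I) * (8 / ?b) powr (I + 1)"
    using p0 q0 pq I_ge by (intro mult_left_mono powr_mono2) (auto simp: field_simps)
  finally have \<zeta>: "\<zeta> \<le> 2 * exp (l * I) * (8 / ?b) powr (I + 1)" .
  define D where "D = 16 * ratio_bound / ?b"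
  have D0: "0 \<le> D" using ratio_bound_ge by (simp add: D_def)
  have "crossing_factor x y ?v ?w + sqrt (ratio_start x ?v) \<le> D * sqrt \<zeta>"
    using V \<zeta>0 unfolding potential_def \<zeta>_def[symmetric] D_def[symmetric] by (simp add: \<zeta>_def[symmetric] field_simps)
  moreover have D\<zeta>: "(D * sqrt \<zeta>)\<^sup>2 \<le> typical_bound"
  proof -
    have "(D * sqrt \<zeta>)\<^sup>2 = \<zeta> * D\<^sup>2" using \<zeta>0 by (simp add: power_mult_distrib)
    also have "\<dots> \<le> typical_bound" unfolding typical_bound_def D_def[symmetric] by (intro mult_right_mono \<zeta>) simp
    finally show ?thesis .
  qed
  moreover have "1 \<le> crossing_factor x y ?v ?w" by simp
  moreover have "0 \<le> sqrt (ratio_start x ?v)" using pos by simp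
  ultimately have 1: "sqrt (ratio_start x ?v) \<le> D * sqrt \<zeta>" "crossing_factor x y ?v ?w \<le> D * sqrt \<zeta>" "1 \<le> D * sqrt \<zeta>" by linarith+
  have "ratio_start x ?v = (sqrt (ratio_start x ?v))\<^sup>2" using pos by simp
  also have "\<dots> \<le> (D * sqrt \<zeta>)\<^sup>2" using 1 pos by (intro power_mono) auto
  finally show "ratio_start x ?v \<le> typical_bound" using D\<zeta> by simp
  have "D * sqrt \<zeta> \<le> (D * sqrt \<zeta>)\<^sup>2" using 1(3) by (rule self_le_power) simp
  then show "crossing_factor x y ?v ?w \<le> typical_bound" using 1(2) D\<zeta> by linarith
qed

text \<open>Up to truncation, the simulation reproduces \<open>q\<close> scaled by
  \<open>1 / (8 * ratio_bound)\<close>: \<open>1 / 2\<close> comes from sampling the first two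
  messages, \<open>1 / (4 * ratio_bound)\<close> from the acceptance at the leaf. The correlation is
  at least this factor times the mean absolute bias minus the truncated mass.\<close>

lemma advantage:
  assumes j: "4 * (real C + 2) * (4 * real C) + 1 \<le> 2 ^ j"
    and k: "2 * typical_bound + 1 \<le> 2 ^ k"
    and B: "21 / 20 * typical_bound * (7 / 8 + 1 / (8 * (21 / 20))) ^ B \<le> exp (- l) / 8"
    and T: "real (2 + B * Suc j + k) \<le> T"
  shows "exp (- l) / (16 * ratio_bound) \<le> adv \<mu> T f"
proof -
  let ?\<Omega> = "X \<times> Y" and ?R = ratio_bound
  have R: "1 \<le> ?R" by (rule ratio_bound_ge)
  obtain A0 B0 where AB0: "\<And>x y m. pmf q (x, y, m) = pmf \<mu> (x, y) * A0 x m * B0 y m"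
    using rect unfolding rectangular_def by blast
  define PA where "PA x m = pmf (public_marginal p) (m ! 0) * (\<Prod>i\<in>{1..C} \<inter> {i. odd i}. alice_msg_prob p i x m)" for x m
  define PB where "PB y m = (\<Prod>i\<in>{1..C} \<inter> - {i. odd i}. bob_msg_prob p i y m)" for y m
  have PA0: "0 \<le> PA x m" and PB0: "0 \<le> PB y m" for x y m
    unfolding PA_def PB_def
    by (auto intro!: mult_nonneg_nonneg prod_nonneg simp: alice_msg_prob_def bob_msg_prob_def cond_prob_def)
  have P: "pmf p (x, y, m) = pmf \<mu> (x, y) * (PA x m * PB y m)" if "length m = C + 1" for x y m
  proof -
    have "(\<Prod>i\<in>{1..C}. if odd i then alice_msg_prob p i x m else bob_msg_prob p i y m)
      = (\<Prod>i\<in>{1..C} \<inter> {i. odd i}. alice_msg_prob p i x m) * PB y m"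
      unfolding PB_def by (rule prod.If_cases) simp
    then show ?thesis using prot that unfolding protocol_distribution_def PA_def by simp
  qed
  \<comment> \<open>\<open>A0\<close> and \<open>B0\<close> may both be negative; absolute values
    make the two factors of \<open>q / p\<close> nonnegative.\<close>
  define A1 where "A1 m x = \<bar>A0 x m\<bar> / PA x m" for m x
  define B1 where "B1 m y = \<bar>B0 y m\<bar> / PB y m" for m y
  have A1: "0 \<le> A1 m x" and B1: "0 \<le> B1 m y" for m x y using PA0 PB0 by (auto simp: A1_def B1_def)
  have pq: "pmf p (x, y, m) * (A1 m x * B1 m y) = pmf q (x, y, m)" if w: "(x, y, m) \<in> set_pmf q" for x y m
  proof -
    have wp: "(x, y, m) \<in> set_pmf p" using w supp_q by auto
    have "0 < pmf p (x, y, m)" using wp by (rule pmf_positive)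
    then have nz: "PA x m \<noteq> 0" "PB y m \<noteq> 0" unfolding P[OF p_length[OF wp]] by auto
    have "pmf p (x, y, m) * (A1 m x * B1 m y) = pmf \<mu> (x, y) * (\<bar>A0 x m\<bar> * \<bar>B0 y m\<bar>)"
      unfolding P[OF p_length[OF wp]] A1_def B1_def using nz by simp
    also have "\<dots> = \<bar>pmf q (x, y, m)\<bar>" unfolding AB0 by (simp add: abs_mult)
    finally show ?thesis by simp
  qed
  have q_walk: "pmf \<mu> (x, y) * (start_prob x v * walk.walk_prob x y v w) * (A1 (v @ w) x * B1 (v @ w) y) = pmf q (x, y, v @ w)"
    if v: "v \<in> starts" for x y v w
  proof (cases "(x, y, v @ w) \<in> set_pmf q")
    case True
    then have "(x, y, v @ w) \<in> set_pmf p" using supp_q by auto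
    from p_eq_walk[OF this] show ?thesis
      using pq[OF True] starts_length[OF v] by simp
  next
    \<comment> \<open>Off the support of \<open>q\<close> the walk need not agree with
      \<open>p\<close>, but there a factor of \<open>q\<close> vanishes and both sides are
      \<open>0\<close>.\<close>
    case False
    then have "pmf q (x, y, v @ w) = 0" by (simp add: set_pmf_iff)
    then have "pmf \<mu> (x, y) = 0 \<or> A0 x (v @ w) = 0 \<or> B0 y (v @ w) = 0" unfolding AB0 by simp
    then show ?thesis using \<open>pmf q (x, y, v @ w) = 0\<close> by (auto simp: A1_def B1_def)
  qed
  have "\<forall>m. \<exists>\<theta>. (\<forall>x y. 0 \<le> \<theta> x y \<and> \<theta> x y \<le> 1 \<and> (A1 m x * B1 m y \<le> ?R \<longrightarrow> \<theta> x y = 1)) \<and>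
    (\<lambda>(x, y). sgn (bias q f m) * \<theta> x y * (A1 m x * B1 m y) / (4 * ?R)) \<in> protocols ?\<Omega> 2"
  proof
    fix m
    obtain \<theta> where "\<And>x y. 0 \<le> \<theta> x y" "\<And>x y. \<theta> x y \<le> 1" "\<And>x y. A1 m x * B1 m y \<le> ?R \<Longrightarrow> \<theta> x y = 1"
      "(\<lambda>(x, y). sgn (bias q f m) * \<theta> x y * (A1 m x * B1 m y) / (4 * ?R)) \<in> protocols ?\<Omega> 2"
      using protocols_truncated_product[of ?\<Omega> "A1 m" "B1 m" ?R "sgn (bias q f m)"] X Y A1 B1 R
      by (auto simp: abs_sgn_eq)
    then show "\<exists>\<theta>. (\<forall>x y. 0 \<le> \<theta> x y \<and> \<theta> x y \<le> 1 \<and> (A1 m x * B1 m y \<le> ?R \<longrightarrow> \<theta> x y = 1)) \<and>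
    (\<lambda>(x, y). sgn (bias q f m) * \<theta> x y * (A1 m x * B1 m y) / (4 * ?R)) \<in> protocols ?\<Omega> 2" by blast
  qed
  from choice[OF this] obtain \<theta> where \<theta>: "\<And>m x y. 0 \<le> \<theta> m x y" "\<And>m x y. \<theta> m x y \<le> 1"
    "\<And>m x y. A1 m x * B1 m y \<le> ?R \<Longrightarrow> \<theta> m x y = 1"
    "\<And>m. (\<lambda>(x, y). sgn (bias q f m) * \<theta> m x y * (A1 m x * B1 m y) / (4 * ?R)) \<in> protocols ?\<Omega> 2"
    by blast
  define leaf where "leaf m = (\<lambda>(x, y). sgn (bias q f m) * \<theta> m x y * (A1 m x * B1 m y) / (4 * ?R))" for m
  define sim where "sim v = walk.simulate (C + 1) leaf B v" for v
  have sim: "sim v \<in> protocols ?\<Omega> (2 + B * Suc j)" for v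
    unfolding sim_def using X Y \<theta>(4) j by (intro walk.simulate_protocol) (auto simp: leaf_def add.commute)
  \<comment> \<open>Starts that rejection sampling with constant \<open>typical_bound\<close> cannot
    handle are dropped; typical triples have none.\<close>
  define ok where "ok x v \<longleftrightarrow> start_prob x v \<le> typical_bound * prefix_prob v" for x v
  define e where "e x v = (if ok x v then start_prob x v else 0)" for x v
  have e: "0 \<le> e x v" "e x v \<le> start_prob x v" "e x v \<le> typical_bound * prefix_prob v" for x v
    using start_prob_nonneg prefix_prob_nonneg typical_bound_ge by (auto simp: e_def ok_def)
  define g where "g = (\<lambda>\<omega>. (0::real) + 1 / 2 * (\<Sum>v\<in>starts. e (fst \<omega>) v * (sim v \<omega> - 0)))"
  have g: "g \<in> protocols ?\<Omega> (2 + B * Suc j + k)"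
    unfolding g_def
  proof (rule rejection_sampling[where s = prefix_prob and L = typical_bound])
    show "(\<Sum>v\<in>starts. e x v) \<le> 1" for x
    proof -
      have "(\<Sum>v\<in>starts. e x v) \<le> (\<Sum>v\<in>starts. start_prob x v)" by (intro sum_mono e)
      also have "\<dots> \<le> 1" by (rule start_prob_sum[OF finite_starts starts_length])
      finally show ?thesis .
    qed
  qed (use X Y k e typical_bound_ge prefix_prob_nonneg prefix_prob_starts finite_starts speaker_fst sim in
       \<open>auto intro!: protocols_const\<close>)
  \<comment> \<open>The part of a triple's weight that survives the three truncations: of the start,
    of the budget and of the acceptance.\<close>
  define \<xi> where "\<xi> = (\<lambda>(x, y, m). of_bool (ok x (take 2 m)) * walk.success x y B (take 2 m) (drop 2 m) * \<theta> m x y)"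
  have \<xi>: "0 \<le> \<xi> i" "\<xi> i \<le> 1" for i
    using \<theta>(1,2) walk.success_bounds
    by (auto simp: \<xi>_def split: prod.splits intro!: mult_nonneg_nonneg mult_le_one)
  define F where "F = (\<lambda>(x, y, m). pmf q (x, y, m) * (- 1) ^ of_bool (f x y) * (sgn (bias q f m) * \<xi> (x, y, m)) / (8 * ?R))"
  have "(\<Sum>(x, y)\<in>?\<Omega>. pmf \<mu> (x, y) * (- 1) ^ of_bool (f x y) * g (x, y))
    = (\<Sum>(x, y)\<in>?\<Omega>. \<Sum>v\<in>starts. \<Sum>w\<in>words (C - 1). F (x, y, v @ w))"
  proof (intro sum.cong refl, clarify)
    fix x y
    have "pmf \<mu> (x, y) * (- 1) ^ of_bool (f x y) * g (x, y)
      = (\<Sum>v\<in>starts. pmf \<mu> (x, y) * (- 1) ^ of_bool (f x y) * (e x v * sim v (x, y)) / 2)"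
      by (simp add: g_def sum_distrib_left sum_divide_distrib)
    also have "\<dots> = (\<Sum>v\<in>starts. \<Sum>w\<in>words (C - 1). F (x, y, v @ w))"
    proof (intro sum.cong refl)
      fix v assume v: "v \<in> starts"
      then have len: "length v = 2" by (rule starts_length)
      have s: "sim v (x, y) = (\<Sum>w\<in>words (C - 1). walk.walk_prob x y v w * walk.success x y B v w * leaf (v @ w) (x, y))"
        unfolding sim_def using len C by (subst walk.simulate_expand) auto
      have "pmf \<mu> (x, y) * (- 1) ^ of_bool (f x y) * (e x v * (walk.walk_prob x y v w * walk.success x y B v w * leaf (v @ w) (x, y))) / 2
        = F (x, y, v @ w)" for w
      proof (cases "ok x v")
        case True
        have "pmf \<mu> (x, y) * (- 1) ^ of_bool (f x y) * (e x v * (walk.walk_prob x y v w * walk.success x y B v w * leaf (v @ w) (x, y))) / 2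
          = (pmf \<mu> (x, y) * (start_prob x v * walk.walk_prob x y v w) * (A1 (v @ w) x * B1 (v @ w) y))
            * (- 1) ^ of_bool (f x y) * (sgn (bias q f (v @ w)) * \<xi> (x, y, v @ w)) / (8 * ?R)"
          using True len by (simp add: e_def leaf_def \<xi>_def)
        then show ?thesis unfolding q_walk[OF v] by (simp add: F_def)
      next
        case False
        then show ?thesis using len by (simp add: e_def F_def \<xi>_def)
      qed
      then show "pmf \<mu> (x, y) * (- 1) ^ of_bool (f x y) * (e x v * sim v (x, y)) / 2 = (\<Sum>w\<in>words (C - 1). F (x, y, v @ w))"
        unfolding s by (simp add: sum_distrib_left sum_divide_distrib)
    qed
    finally show "pmf \<mu> (x, y) * (- 1) ^ of_bool (f x y) * g (x, y) = (\<Sum>v\<in>starts. \<Sum>w\<in>words (C - 1). F (x, y, v @ w))" .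
  qed
  also have "\<dots> = (\<Sum>i\<in>set_pmf q. F i)" by (rule sum_q_eq[symmetric]) (simp add: F_def set_pmf_iff)
  finally have corr: "(\<Sum>i\<in>set_pmf q. F i) \<le> adv \<mu> T f"
    using protocols_le_adv[OF g _ supp_inputs T, of f] X Y by simp
  have xi_typical: "1 - \<xi> i \<le> exp (- l) / 8" if i: "i \<in> typical" for i
  proof -
    obtain x y m where [simp]: "i = (x, y, m)" by (cases i)
    have t: "(x, y, m) \<in> typical" and w: "(x, y, m) \<in> set_pmf q" and qp: "pmf q (x, y, m) \<le> ?R * pmf p (x, y, m)"
      using i by (auto simp: typical_def)
    have "ok x (take 2 m)"
      using typical_bounds(1)[OF t] q_positive(1)[OF w] by (simp add: ok_def ratio_start_def field_simps)
    moreover have "\<theta> m x y = 1"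
    proof (rule \<theta>(3))
      show "A1 m x * B1 m y \<le> ?R"
        using qp p_pos[OF w] unfolding pq[OF w, symmetric] by (simp add: mult.commute[of "?R"])
    qed
    ultimately have "1 - \<xi> i = 1 - walk.success x y B (take 2 m) (drop 2 m)" by (simp add: \<xi>_def)
    also have "\<dots> \<le> 21 / 20 * crossing_factor x y (take 2 m) (drop 2 m) * (7 / 8 + 1 / (8 * (21 / 20))) ^ B"
      by (rule walk.success_lower) simp
    also have "\<dots> \<le> 21 / 20 * typical_bound * (7 / 8 + 1 / (8 * (21 / 20))) ^ B"
      by (intro mult_right_mono mult_left_mono typical_bounds(2)[OF t]) auto
    also have "\<dots> \<le> exp (- l) / 8" by (rule B)
    finally show ?thesis .
  qed
  \<comment> \<open>Atypical triples lose \<open>3 / 8\<close> of \<open>exp (- l)\<close>, the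
    exhausted budget on typical ones \<open>1 / 8\<close>.\<close>
  have loss: "(\<Sum>i\<in>set_pmf q. pmf q i * (1 - \<xi> i)) \<le> exp (- l) / 2"
  proof -
    have sub: "typical \<subseteq> set_pmf q" by (auto simp: typical_def)
    have "(\<Sum>i\<in>set_pmf q. pmf q i * (1 - \<xi> i)) = (\<Sum>i\<in>set_pmf q - typical. pmf q i * (1 - \<xi> i)) + (\<Sum>i\<in>typical. pmf q i * (1 - \<xi> i))"
      using sub finite_q by (rule sum.subset_diff)
    also have "(\<Sum>i\<in>set_pmf q - typical. pmf q i * (1 - \<xi> i)) \<le> (\<Sum>i\<in>set_pmf q - typical. pmf q i * 1)"
      using \<xi> by (intro sum_mono mult_left_mono) auto
    also have "\<dots> \<le> 3 / 8 * exp (- l)" using atypical by simp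
    also have "(\<Sum>i\<in>typical. pmf q i * (1 - \<xi> i)) \<le> (\<Sum>i\<in>typical. pmf q i * (exp (- l) / 8))"
      using xi_typical by (intro sum_mono mult_left_mono) auto
    also have "\<dots> = (\<Sum>i\<in>typical. pmf q i) * (exp (- l) / 8)" by (simp add: sum_distrib_right)
    also have "\<dots> \<le> 1 * (exp (- l) / 8)"
      using finite_subset[OF sub finite_q] by (intro mult_right_mono sum_pmf_le_1) auto
    finally show ?thesis by simp
  qed
  have "exp (- l) / 2 \<le> (\<Sum>i\<in>set_pmf q. pmf q i * (case i of (x, y, m) \<Rightarrow> \<bar>bias q f m\<bar>)) - (\<Sum>i\<in>set_pmf q. pmf q i * (1 - \<xi> i))"
    using mean_bias loss by simp
  also have "(\<Sum>i\<in>set_pmf q. pmf q i * (case i of (x, y, m) \<Rightarrow> \<bar>bias q f m\<bar>))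
    = (\<Sum>(x, y, m)\<in>set_pmf q. pmf q (x, y, m) * (- 1) ^ of_bool (f x y) * sgn (bias q f m))"
    unfolding sum_sign_bias by (intro sum.cong refl) (auto simp: abs_sgn)
  also have "\<dots> - (\<Sum>i\<in>set_pmf q. pmf q i * (1 - \<xi> i)) \<le> (\<Sum>i\<in>set_pmf q. 8 * ?R * F i)"
    unfolding sum_subtractf[symmetric]
  proof (intro sum_mono, clarify)
    fix x y m
    let ?s = "(- 1) ^ of_bool (f x y) * sgn (bias q f m)"
    have "\<bar>?s\<bar> \<le> 1" by (simp add: abs_mult power_abs abs_sgn_eq)
    then have "?s * (1 - \<xi> (x, y, m)) \<le> 1 * (1 - \<xi> (x, y, m))"
      using \<xi>(2)[of "(x, y, m)"] by (intro mult_right_mono) auto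
    then have "?s - (1 - \<xi> (x, y, m)) \<le> ?s * \<xi> (x, y, m)" by (simp add: algebra_simps)
    then have "pmf q (x, y, m) * (?s - (1 - \<xi> (x, y, m))) \<le> pmf q (x, y, m) * (?s * \<xi> (x, y, m))"
      by (intro mult_left_mono) auto
    then show "pmf q (x, y, m) * (- 1) ^ of_bool (f x y) * sgn (bias q f m) - pmf q (x, y, m) * (1 - \<xi> (x, y, m)) \<le> 8 * ?R * F (x, y, m)"
      using R by (simp add: F_def right_diff_distrib mult.assoc)
  qed
  also have "\<dots> = 8 * ?R * (\<Sum>i\<in>set_pmf q. F i)" by (simp add: sum_distrib_left)
  finally have "exp (- l) / 2 \<le> 8 * ?R * (\<Sum>i\<in>set_pmf q. F i)" .
  then have "exp (- l) / (16 * ?R) \<le> (\<Sum>i\<in>set_pmf q. F i)" using R by (simp add: field_simps)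
  with corr show ?thesis by linarith
qed

text \<open>\<open>g\<close> is such that \<open>typical_bound \<le> exp (g * I)\<close>, and
  \<open>h\<close> such that \<open>21 / 20 * exp (- h)\<close> is \<open>b / 8\<close>. In
  \<open>\<Delta>\<close>, the second term pays for the attempts, the third for announcing the
  start, the \<open>5\<close> for roundings and the two final bits, and the last term yields the
  advantage.\<close>

lemma advantage_bound:
  fixes b R g h :: real
  defines "b \<equiv> exp (- l)"
  defines "R \<equiv> exp (8 * (l + 1) / b)"
  defines "g \<equiv> ln 2 + l + 2 * ln (8 / b) + 2 * ln (16 * R / b)"
  defines "h \<equiv> ln (42 / (5 * b))"
  defines "\<Delta> \<equiv> 5 + 10 * (168 * (g + h) + 1) + g / ln 2 + 16 * R / b"
  shows "1 / \<Delta> \<le> adv \<mu> (\<Delta> * I * (log 2 (real C))\<^sup>2) f"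
proof -
  have b: "0 < b" "b \<le> 1" using l_nonneg by (auto simp: b_def)
  have R_eq: "ratio_bound = R" by (simp add: ratio_bound_def R_def b_def)
  have R: "1 \<le> R" using ratio_bound_ge R_eq by simp
  have ln8: "0 \<le> ln (8 / b)" using b by (intro ln_ge_zero) (simp add: field_simps)
  have ln16: "0 \<le> ln (16 * R / b)"
  proof (rule ln_ge_zero)
    have "b \<le> 16 * R" using b R by linarith
    then show "1 \<le> 16 * R / b" using b by (simp add: field_simps)
  qed
  have h0: "0 \<le> h" unfolding h_def using b by (intro ln_ge_zero) (simp add: field_simps)
  have g0: "0 \<le> g" using l_nonneg ln8 ln16 by (simp add: g_def)
  have gI: "0 \<le> g * I" using g0 I_ge by simp
  have tb: "typical_bound \<le> exp (g * I)"
  proof -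
    have "typical_bound = exp (ln 2 + l * I + (I + 1) * ln (8 / b) + 2 * ln (16 * R / b))"
      using b R by (simp add: typical_bound_def R_eq b_def[symmetric] exp_add powr_def exp_double)
    also have "\<dots> \<le> exp (g * I)"
    proof (subst exp_le_cancel_iff)
      have gI_eq: "g * I = ln 2 * I + l * I + 2 * I * ln (8 / b) + 2 * ln (16 * R / b) * I"
        by (simp add: g_def algebra_simps)
      have "ln 2 * 1 \<le> ln 2 * I" using I_ge by (intro mult_left_mono) auto
      moreover have "(I + 1) * ln (8 / b) \<le> 2 * I * ln (8 / b)" using I_ge by (intro mult_right_mono ln8) auto
      moreover have "2 * ln (16 * R / b) * 1 \<le> 2 * ln (16 * R / b) * I"
        using I_ge ln16 by (intro mult_left_mono) linarith+
      ultimately show "ln 2 + l * I + (I + 1) * ln (8 / b) + 2 * ln (16 * R / b) \<le> g * I"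
        using gI_eq by linarith
    qed
    finally show ?thesis .
  qed
  define lg where "lg = log 2 (real C)"
  have lg: "1 \<le> lg" using C by (simp add: lg_def)
  \<comment> \<open>The constant in \<open>j1\<close> is at most \<open>64 * C ^ 2\<close>, hence
    the \<open>6\<close> and the factor \<open>2\<close>.\<close>
  define j where "j = nat \<lceil>2 * lg\<rceil> + 6"
  define k where "k = nat \<lceil>g * I / ln 2\<rceil> + 2"
  define B where "B = nat \<lceil>168 * (g * I + h)\<rceil>"
  have j1: "4 * (real C + 2) * (4 * real C) + 1 \<le> 2 ^ j"
  proof -
    have "64 * real C ^ 2 = 2 powr (2 * lg) * 2 ^ 6"
      using C by (simp add: lg_def powr_mult_base powr_powr[symmetric] mult.commute[of 2] powr_numeral)
    also have "\<dots> \<le> 2 powr real (nat \<lceil>2 * lg\<rceil>) * 2 ^ 6"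
      using lg by (intro mult_right_mono) (auto intro: powr_mono)
    also have "\<dots> = 2 ^ j" by (simp add: j_def power_add powr_realpow)
    finally have "64 * real C ^ 2 \<le> 2 ^ j" .
    moreover have "2 * real C \<le> real C * real C" "1 \<le> real C * real C"
      using C by (auto intro: mult_right_mono mult_mono[of 1 "real C" 1 "real C", simplified])
    ultimately show ?thesis by (simp add: power2_eq_square algebra_simps)
  qed
  have k1: "2 * typical_bound + 1 \<le> 2 ^ k"
  proof -
    have "exp (g * I) = 2 powr (g * I / ln 2)" by (simp add: powr_def)
    also have "\<dots> \<le> 2 powr real (nat \<lceil>g * I / ln 2\<rceil>)" by (intro powr_mono) linarith+
    also have "\<dots> = 2 ^ nat \<lceil>g * I / ln 2\<rceil>" by (simp add: powr_realpow)
    finally have "4 * exp (g * I) \<le> 2 ^ k" by (simp add: k_def power_add)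
    moreover have "1 \<le> exp (g * I)" using gI by simp
    ultimately show ?thesis using tb by linarith
  qed
  have B1: "21 / 20 * typical_bound * (7 / 8 + 1 / (8 * (21 / 20))) ^ B \<le> exp (- l) / 8"
  proof -
    \<comment> \<open>The base equals \<open>1 - 1 / 168\<close>.\<close>
    have "(7 / 8 + 1 / (8 * (21 / 20 :: real))) ^ B \<le> exp (- 1 / 168) ^ B"
      using exp_ge_add_one_self[of "- 1 / 168"] by (intro power_mono) auto
    also have "\<dots> = exp (- (real B / 168))" by (simp add: exp_of_nat_mult[symmetric])
    also have "\<dots> \<le> exp (- (g * I + h))"
    proof (subst exp_le_cancel_iff)
      have "168 * (g * I + h) \<le> real B" unfolding B_def by linarith
      then show "- (real B / 168) \<le> - (g * I + h)" by simp
    qed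
    also have "\<dots> = exp (- (g * I)) * (5 * b / 42)"
      using b by (simp add: h_def exp_add exp_diff exp_minus field_simps)
    finally have *: "(7 / 8 + 1 / (8 * (21 / 20 :: real))) ^ B \<le> exp (- (g * I)) * (5 * b / 42)" .
    have "21 / 20 * typical_bound * (7 / 8 + 1 / (8 * (21 / 20))) ^ B
      \<le> 21 / 20 * exp (g * I) * (exp (- (g * I)) * (5 * b / 42))"
      using tb typical_bound_ge by (intro mult_mono * mult_left_mono) auto
    also have "\<dots> = exp (- l) / 8" by (simp add: exp_minus b_def)
    finally show ?thesis .
  qed
  have \<Delta>16: "16 * R / b \<le> \<Delta>" "0 < 16 * R / b" using g0 h0 R b by (auto simp: \<Delta>_def)
  have T: "real (2 + B * Suc j + k) \<le> \<Delta> * I * lg\<^sup>2"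
  proof -
    have "real (Suc j) \<le> 2 * lg + 8" unfolding j_def using lg by linarith
    then have Sj: "real (Suc j) \<le> 10 * lg" using lg by linarith
    have hI: "h * 1 \<le> h * I" using h0 I_ge by (intro mult_left_mono) auto
    have "0 \<le> 168 * (g * I + h)" using gI h0 by simp
    then have "real B \<le> 168 * (g * I + h) + 1" unfolding B_def by linarith
    also have "\<dots> \<le> (168 * (g + h) + 1) * I" using hI I_ge by (simp add: algebra_simps)
    finally have BI: "real B \<le> (168 * (g + h) + 1) * I" .
    \<comment> \<open>The simulation uses \<open>O(I * lg)\<close> bits; passing to the square gives
      the form of the claimed bound.\<close>
    have "lg * 1 \<le> lg * lg" using lg by (intro mult_left_mono) auto
    then have Sj2: "real (Suc j) \<le> 10 * (lg * lg)" using Sj by linarith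
    have Ilg: "I * 1 \<le> I * lg\<^sup>2" using I_ge lg by (intro mult_left_mono) auto
    then have Ilg1: "1 \<le> I * lg\<^sup>2" using I_ge by linarith
    have "real B * real (Suc j) \<le> (168 * (g + h) + 1) * I * (10 * (lg * lg))"
      using g0 h0 I_ge by (intro mult_mono BI Sj2) auto
    then have 1: "real B * real (Suc j) \<le> 10 * (168 * (g + h) + 1) * (I * lg\<^sup>2)"
      by (simp add: power2_eq_square algebra_simps)
    have "0 \<le> g * I / ln 2" using gI by simp
    then have "real k \<le> g * I / ln 2 + 3" unfolding k_def by linarith
    also have "g * I / ln 2 = g / ln 2 * I" by simp
    also have "g / ln 2 * I + 3 \<le> g / ln 2 * (I * lg\<^sup>2) + 3 * (I * lg\<^sup>2)"
      using Ilg Ilg1 g0 by (intro add_mono mult_left_mono) simp_all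
    finally have 2: "real k \<le> g / ln 2 * (I * lg\<^sup>2) + 3 * (I * lg\<^sup>2)" .
    have 3: "2 \<le> 2 * (I * lg\<^sup>2)" using Ilg1 by simp
    have 4: "0 \<le> 16 * R / b * (I * lg\<^sup>2)"
      by (rule mult_nonneg_nonneg[OF less_imp_le[OF \<Delta>16(2)]]) (use Ilg1 in linarith)
    have "real (2 + B * Suc j + k) = 2 + real B * real (Suc j) + real k" by (simp add: algebra_simps)
    also have "\<dots> \<le> \<Delta> * (I * lg\<^sup>2)" using 1 2 3 4 by (simp add: \<Delta>_def distrib_right)
    finally show ?thesis by (simp add: mult.assoc)
  qed
  have "1 / \<Delta> \<le> 1 / (16 * R / b)" by (rule frac_le) (use \<Delta>16 in auto)
  also have "\<dots> = exp (- l) / (16 * ratio_bound)" by (simp add: R_eq b_def)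
  also have "\<dots> \<le> adv \<mu> (\<Delta> * I * lg\<^sup>2) f" by (rule advantage[OF j1 k1 B1 T])
  finally show ?thesis by (simp add: lg_def)
qed

end

theorem theorem8:
  fixes \<alpha> :: real
  assumes "\<alpha> > 0"
  shows "\<exists>\<Delta>::real. \<Delta> > 0 \<and>
    (\<forall>(I::real) (C::nat) (X::nat set) (Y::nat set) (M::nat set)
      (f :: nat \<Rightarrow> nat \<Rightarrow> bool) (p :: (nat, nat) joint) (\<mu> :: (nat \<times> nat) pmf).
      I \<ge> 1 \<longrightarrow> C \<ge> 2 \<longrightarrow> finite X \<longrightarrow> finite Y \<longrightarrow> finite M \<longrightarrow>
      protocol_distribution X Y M C p \<longrightarrow>
      M_ext I p f \<le> ereal (\<alpha> * I) \<longrightarrow>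
      \<mu> = inputs p \<longrightarrow>
      (\<forall>(x, y, m)\<in>set_pmf p. \<forall>i\<in>{2..C}. m ! i \<in> {0, 1}) \<longrightarrow>
      adv \<mu> (\<Delta> * I * (log 2 (real C))\<^sup>2) f \<ge> 1 / \<Delta>)"
proof -
  \<comment> \<open>The \<open>+ 1\<close> leaves room to choose a \<open>q\<close> whose cost is
    only close to the infimum; \<open>ln 2\<close> converts the base of the logarithm.\<close>
  define l where "l = ln 2 * (\<alpha> + 1)"
  define b where "b = exp (- l)"
  define R where "R = exp (8 * (l + 1) / b)"
  define g where "g = ln 2 + l + 2 * ln (8 / b) + 2 * ln (16 * R / b)"
  define h where "h = ln (42 / (5 * b))"
  define \<Delta> where "\<Delta> = 5 + 10 * (168 * (g + h) + 1) + g / ln 2 + 16 * R / b"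
  have l: "0 \<le> l" using assms by (simp add: l_def)
  have b: "0 < b" "b \<le> 1" using l by (auto simp: b_def)
  have R: "1 \<le> R" using l b by (simp add: R_def)
  have "b \<le> 16 * R" using b R by linarith
  then have "0 \<le> g" unfolding g_def using b l by (intro add_nonneg_nonneg mult_nonneg_nonneg ln_ge_zero) (auto simp: field_simps)
  moreover have "0 \<le> h" unfolding h_def using b by (intro ln_ge_zero) (simp add: field_simps)
  ultimately have \<Delta>: "0 < \<Delta>" unfolding \<Delta>_def using R b by (intro add_nonneg_pos add_nonneg_nonneg) auto
  show ?thesis
  proof (intro exI[of _ \<Delta>] conjI \<Delta> allI impI)
    fix I C X Y M and f :: "nat \<Rightarrow> nat \<Rightarrow> bool" and p :: "(nat, nat) joint" and \<mu>
    assume *: "1 \<le> I" "2 \<le> C" "finite X" "finite Y" "finite M" "protocol_distribution X Y M C p"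
      "M_ext I p f \<le> ereal (\<alpha> * I)" "\<mu> = inputs p"
      "\<forall>(x, y, m)\<in>set_pmf p. \<forall>i\<in>{2..C}. m ! i \<in> {0, 1}"
    have "M_ext I p f < ereal (l * I / ln 2)"
      using *(1,7) by (auto intro!: le_less_trans[OF *(7)] simp: l_def)
    then obtain q where q: "rectangular (inputs p) q" "(SUP w\<in>set_pmf q. ext_cost I p f q w) < ereal (l * I / ln 2)"
      unfolding M_ext_def INF_less_iff by auto
    have "ext_cost I p f q w \<le> ereal (l * I / ln 2)" if "w \<in> set_pmf q" for w
      using SUP_upper[OF that, of "ext_cost I p f q"] q(2) by (metis less_imp_le order_trans)
    then interpret near_optimal X Y M C p q f I l
      using * q by unfold_locales auto
    show "1 / \<Delta> \<le> adv \<mu> (\<Delta> * I * (log 2 (real C))\<^sup>2) f"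
      unfolding *(8) \<Delta>_def g_def h_def R_def b_def by (rule advantage_bound)
  qed
qed

end
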